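(* Let $p\ge1$ be an integer and let $n\in\mathbf N_0$ have one of the properties $(j_p)$, $j\in\{1,2,3\}$, with $D_p=\det(s_{i+l})_{i,l=0}^{p}\ne0$. Let $e_k,d_k$, $k=0,\dots,p$, be the polynomials of the first and second kind associated with $n$ and let $b_{p-1}>0$ be the corresponding recurrence coefficient. Then $$n(z)=-\frac{d_{p-1}(z)\,\check n_p(z)+b_{p-1}d_p(z)}{e_{p-1}(z)\,\check n_p(z)+b_{p-1}e_p(z)},\qquad z\in\mathbb C\setminus\mathbb R,$$ where $\check n_p$ is a Nevanlinna function such that $\check n_p\in\mathcal L(\check n_p)$ and $$\check n_p(z)=\big(R_z\check n_p,\check n_p\big)_{\mathcal L(\check n_p)},\qquad z\in\mathbb C\setminus\mathbb R.$$
   Context: A Nevanlinna function is a function $n$ that is analytic in the open upper half plane $\mathbb C^+$ with $\operatorname{Im} n(z)\ge 0$ for $z\in\mathbb C^+$; it is always extended to the lower half plane by $n(z)=n(z^* )^*$, where $z^*$ denotes the complex conjugate. $\mathbf N_0$ denotes the set of all Nevanlinna functions. For an integer $p\ge 1$ the properties mean that there are real numbers $s_0,s_1,\dots$ such that, for $z=iy$, $y\to\pm\infty$: $(1_p)$: $n(z)=-\frac{s_0}{z}-\frac{s_1}{z^2}-\cdots-\frac{s_{2p}}{z^{2p+1}}+\mathrm o\!\left(\frac1{z^{2p+1}}\right)$; $(2_p)$: $n(z)=-\frac{s_0}{z}-\cdots-\frac{s_{2p}}{z^{2p+1}}+\mathrm O\!\left(\frac1{z^{2p+2}}\right)$; $(3_p)$: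 $n(z)=-\frac{s_0}{z}-\cdots-\frac{s_{2p+1}}{z^{2p+2}}+\mathrm o\!\left(\frac1{z^{2p+2}}\right)$. Each of them implies that $n(z)=\int_{\mathbb R}\frac{d\sigma(t)}{t-z}$ with a unique finite positive Borel measure $\sigma$, with $s_i=\int t^i\,d\sigma(t)$, $0\le i\le2p$. The polynomials of the first kind $e_0,\dots,e_p$ are obtained by Gram–Schmidt orthonormalization of $1,t,\dots,t^p$ in $L^2(\sigma)$: $e_k$ is a real polynomial of degree $k$ with positive leading coefficient and $\int e_ie_k\,d\sigma=\delta_{ik}$. They satisfy $te_k=b_{k-1}e_{k-1}+a_ke_k+b_ke_{k+1}$, $0\le k\le p-1$, with $b_{-1}=0$, $a_k\in\mathbb R$, $b_k>0$. The polynomials of the second kind are $d_k(z)=\int_{\mathbb R}\frac{e_k(z)-e_k(t)}{z-t}\,d\sigma(t)$, $k=0,\dots,p$. For $m\in\mathbf N_0$, $\mathcal L(m)$ denotes the reproducing kernel Hilbert space of functions on $\mathbb C\setminus\mathbb R$ with the (positive definite) reproducing kernel $L_m(z,w)=\frac{m(z)-m(w)^*}{z-w^*}$, $z,w\in\mathbb C\setminus\mathbb R$, $z\ne w^*$ (extended by continuity to $z=w^*$), and $R_z$ is the difference-quotient operator $(R_zf)(\zeta)=\frac{f(\zeta)-f(z)}{\zeta-z}$, $f\in\mathcal L(m)$, which maps $\mathcal L(m)$ into itself. *)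

theory Defs
  imports
    "HOL-Analysis.Analysis"
    "HOL-Library.Landau_Symbols"
    "HOL-Computational_Algebra.Polynomial"
    "Jordan_Normal_Form.Determinant"
begin

abbreviation nonreal :: "complex set" where
  "nonreal \<equiv> {z. Im z \<noteq> 0}"

text \<open>Only the values on \<^term>\<open>nonreal\<close> matter; values on the real line are arbitrary.\<close>

definition nevanlinna :: "(complex \<Rightarrow> complex) \<Rightarrow> bool" where
  "nevanlinna n \<longleftrightarrow>
     n analytic_on {z. Im z > 0} \<and>
     (\<forall>z. Im z > 0 \<longrightarrow> Im (n z) \<ge> 0) \<and>
     (\<forall>z. Im z < 0 \<longrightarrow> n z = cnj (n (cnj z)))"

text \<open>The three asymptotic properties along the imaginary axis. The variable \<open>y\<close> is real, and
  \<^term>\<open>at_infinity :: real filter\<close> covers both \<open>y \<rightarrow> +\<infinity>\<close> and \<open>y \<rightarrow> -\<infinity>\<close>. The expansion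
  remainder is written with the sum moved to the left of the equation.\<close>

definition expansion_remainder :: "(complex \<Rightarrow> complex) \<Rightarrow> (nat \<Rightarrow> real) \<Rightarrow> nat \<Rightarrow> real \<Rightarrow> complex" where
  "expansion_remainder n s N y =
     n (\<i> * of_real y) - (- (\<Sum>k\<le>N. of_real (s k) / (\<i> * of_real y) ^ (k + 1)))"

definition property1 :: "nat \<Rightarrow> (complex \<Rightarrow> complex) \<Rightarrow> (nat \<Rightarrow> real) \<Rightarrow> bool" where
  "property1 p n s \<longleftrightarrow>
     expansion_remainder n s (2 * p) \<in> o[at_infinity](\<lambda>y. 1 / (\<i> * of_real y) ^ (2 * p + 1))"

definition property2 :: "nat \<Rightarrow> (complex \<Rightarrow> complex) \<Rightarrow> (nat \<Rightarrow> real) \<Rightarrow> bool" where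
  "property2 p n s \<longleftrightarrow>
     expansion_remainder n s (2 * p) \<in> O[at_infinity](\<lambda>y. 1 / (\<i> * of_real y) ^ (2 * p + 2))"

definition property3 :: "nat \<Rightarrow> (complex \<Rightarrow> complex) \<Rightarrow> (nat \<Rightarrow> real) \<Rightarrow> bool" where
  "property3 p n s \<longleftrightarrow>
     expansion_remainder n s (2 * p + 1) \<in> o[at_infinity](\<lambda>y. 1 / (\<i> * of_real y) ^ (2 * p + 2))"

definition hankel_det :: "(nat \<Rightarrow> real) \<Rightarrow> nat \<Rightarrow> real" where
  "hankel_det s p = Determinant.det (mat (p + 1) (p + 1) (\<lambda>(i, l). s (i + l)))"

definition cauchy_represents :: "real measure \<Rightarrow> (complex \<Rightarrow> complex) \<Rightarrow> bool" where
  "cauchy_represents \<sigma> n \<longleftrightarrow>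
     sets \<sigma> = sets borel \<and> finite_measure \<sigma> \<and>
     (\<forall>z\<in>nonreal. n z = (\<integral>t. 1 / (of_real t - z) \<partial>\<sigma>))"

text \<open>At most one measure represents a given function (Stieltjes inversion), so the choice
  below is no choice whenever a representing measure exists. Its existence is not assumed
  anywhere; it is a consequence of each of the three asymptotic properties.\<close>

definition spectral_measure :: "(complex \<Rightarrow> complex) \<Rightarrow> real measure" where
  "spectral_measure n = (SOME \<sigma>. cauchy_represents \<sigma> n)"

text \<open>Gram--Schmidt orthonormalization of \<open>1, t, t\<^sup>2, \<dots>\<close> in \<open>L\<^sup>2(\<sigma>)\<close>.\<close>

fun first_kind :: "real measure \<Rightarrow> nat \<Rightarrow> real poly" where
  "first_kind \<sigma> k =
     (let q = Polynomial.monom 1 k -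
            (\<Sum>i<k. Polynomial.smult (\<integral>t. t ^ k * poly (first_kind \<sigma> i) t \<partial>\<sigma>) (first_kind \<sigma> i))
      in Polynomial.smult (1 / sqrt (\<integral>t. (poly q t)\<^sup>2 \<partial>\<sigma>)) q)"

declare first_kind.simps [simp del]

definition cpoly :: "real poly \<Rightarrow> complex \<Rightarrow> complex" where
  "cpoly q z = poly (map_poly of_real q) z"

text \<open>Meaningful for nonreal \<open>z\<close> only: for real \<open>z\<close> the integrand is \<open>0\<close> instead of the
  derivative at the single point \<open>t = z\<close>.\<close>

definition second_kind :: "real measure \<Rightarrow> nat \<Rightarrow> complex \<Rightarrow> complex" where
  "second_kind \<sigma> k z =
     (\<integral>t. (cpoly (first_kind \<sigma> k) z - of_real (poly (first_kind \<sigma> k) t)) / (z - of_real t) \<partial>\<sigma>)"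

text \<open>The three-term recurrence for \<open>0 \<le> k \<le> p - 1\<close>; the case distinction is \<open>b\<^bsub>-1\<^esub> = 0\<close>.\<close>

definition recurrence_coeffs ::
  "(nat \<Rightarrow> real poly) \<Rightarrow> nat \<Rightarrow> (nat \<Rightarrow> real) \<Rightarrow> (nat \<Rightarrow> real) \<Rightarrow> bool" where
  "recurrence_coeffs e p a b \<longleftrightarrow>
     (\<forall>k<p. b k > 0 \<and>
        [:0, 1:] * e k =
          (if k = 0 then 0 else Polynomial.smult (b (k - 1)) (e (k - 1)))
          + Polynomial.smult (a k) (e k) + Polynomial.smult (b k) (e (k + 1)))"

text \<open>Functions on \<open>X\<close> are represented by total functions vanishing outside \<open>X\<close>. The inner
  product is linear in its first argument.\<close>

locale rkhs =
  fixes X :: "'a set"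
    and K :: "'a \<Rightarrow> 'a \<Rightarrow> complex"
    and H :: "('a \<Rightarrow> complex) set"
    and ip :: "('a \<Rightarrow> complex) \<Rightarrow> ('a \<Rightarrow> complex) \<Rightarrow> complex"
  assumes vanish_outside: "f \<in> H \<Longrightarrow> x \<notin> X \<Longrightarrow> f x = 0"
    and zero_closed: "(\<lambda>x. 0) \<in> H"
    and add_closed: "f \<in> H \<Longrightarrow> g \<in> H \<Longrightarrow> (\<lambda>x. f x + g x) \<in> H"
    and scale_closed: "f \<in> H \<Longrightarrow> (\<lambda>x. c * f x) \<in> H"
    and ip_add: "f \<in> H \<Longrightarrow> g \<in> H \<Longrightarrow> h \<in> H \<Longrightarrow> ip (\<lambda>x. f x + g x) h = ip f h + ip g h"
    and ip_scale: "f \<in> H \<Longrightarrow> h \<in> H \<Longrightarrow> ip (\<lambda>x. c * f x) h = c * ip f h"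
    and ip_commute: "f \<in> H \<Longrightarrow> g \<in> H \<Longrightarrow> ip g f = cnj (ip f g)"
    and ip_nonneg: "f \<in> H \<Longrightarrow> Re (ip f f) \<ge> 0"
    and ip_definite: "f \<in> H \<Longrightarrow> ip f f = 0 \<Longrightarrow> f = (\<lambda>x. 0)"
    and complete: "Metric_space.mcomplete H
          (\<lambda>f g. sqrt (Re (ip (\<lambda>x. f x - g x) (\<lambda>x. f x - g x))))"
    and kernel_mem: "w \<in> X \<Longrightarrow> (\<lambda>z. if z \<in> X then K z w else 0) \<in> H"
    and reproducing: "f \<in> H \<Longrightarrow> w \<in> X \<Longrightarrow> ip f (\<lambda>z. if z \<in> X then K z w else 0) = f w"

definition nev_kernel :: "(complex \<Rightarrow> complex) \<Rightarrow> complex \<Rightarrow> complex \<Rightarrow> complex" where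
  "nev_kernel m z w =
     (if z = cnj w then Lim (at z) (\<lambda>\<zeta>. (m \<zeta> - cnj (m w)) / (\<zeta> - cnj w))
      else (m z - cnj (m w)) / (z - cnj w))"

text \<open>\<open>H\<close> with inner product \<open>ip\<close> is the space \<open>\<L>(m)\<close>; a reproducing kernel Hilbert space is
  uniquely determined by its kernel.\<close>

definition is_L_space ::
  "(complex \<Rightarrow> complex) \<Rightarrow> (complex \<Rightarrow> complex) set \<Rightarrow>
   ((complex \<Rightarrow> complex) \<Rightarrow> (complex \<Rightarrow> complex) \<Rightarrow> complex) \<Rightarrow> bool" where
  "is_L_space m H ip \<longleftrightarrow> rkhs nonreal (nev_kernel m) H ip"

definition off_real :: "(complex \<Rightarrow> complex) \<Rightarrow> complex \<Rightarrow> complex" where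
  "off_real f z = (if z \<in> nonreal then f z else 0)"

definition diff_quot :: "complex \<Rightarrow> (complex \<Rightarrow> complex) \<Rightarrow> complex \<Rightarrow> complex" where
  "diff_quot z f = off_real (\<lambda>\<zeta>.
     if \<zeta> = z then Lim (at z) (\<lambda>\<eta>. (f \<eta> - f z) / (\<eta> - z))
     else (f \<zeta> - f z) / (\<zeta> - z))"

end

theory Submission
  imports Defs "HOL-Probability.Helly_Selection" "HOL-Complex_Analysis.Cauchy_Integral_Formula"
    "HOL-Real_Asymp.Real_Asymp"
begin

text \<open>
  Put \<open>q\<^sub>k(z) = \<integral> e\<^sub>k(t) / (t - z) d\<sigma>(t) = n(z) e\<^sub>k(z) + d\<^sub>k(z)\<close>. Solving the claimed formula for the unknown
  function gives \<open>m = - b\<^bsub>p-1\<^esub> q\<^sub>p / q\<^bsub>p-1\<^esub>\<close>. The three-term recurrence for the \<open>q\<^sub>k\<close> turns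
  \<open>b\<^bsub>p-1\<^esub> Im (q\<^sub>p q\<^bsub>p-1\<^esub>\<^sup>*)\<close> into \<open>Im z \<Sum>\<^bsub>k<p\<^esub> |q\<^sub>k|\<^sup>2 - Im n\<close>, and Bessel's inequality for \<open>1 / (t - z)\<close> and
  \<open>e\<^sub>0, \<dots>, e\<^sub>p\<close> bounds this by \<open>- Im z |q\<^sub>p|\<^sup>2\<close>. Hence \<open>b\<^bsub>p-1\<^esub>\<^sup>2 Im m \<ge> Im z |m|\<^sup>2\<close>: so \<open>m\<close> is a
  Nevanlinna function with \<open>|m(z)| \<le> b\<^bsub>p-1\<^esub>\<^sup>2 / Im z\<close>, and therefore the Cauchy transform of a finite
  measure \<open>\<rho>\<close>. Under the Cauchy transform \<open>\<L>(m)\<close> is \<open>L\<^sup>2(\<rho>)\<close>, with \<open>m\<close> corresponding to \<open>1\<close> and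
  \<open>R\<^sub>z m\<close> to \<open>1 / (t - z)\<close>, so that \<open>(R\<^sub>z m, m) = \<integral> 1 / (t - z) d\<rho>(t) = m(z)\<close>.
\<close>

section \<open>Herglotz representation\<close>

text \<open>No measure is given at the outset, so a Herglotz representation is built and then used
  twice: for \<open>n\<close>, where the asymptotics bound \<open>y * |n(iy)|\<close>, and for
  \<open>m\<close>, where the estimate of \<open>Im m\<close> does. Even the existence of the
  moments has to be extracted from the asymptotics. The \<open>q k\<close> recur like the
  polynomials except for a constant at index 0. This single inhomogeneity produces both the
  Wronskian -1, which keeps \<open>q (p - 1)\<close> and the denominator of the formula away from 0,
  and the term \<open>- Im n\<close> of the quadratic form. Stopping Bessel at index
  \<open>p - 1\<close> would give only \<open>Im m >= 0\<close>; the polynomial of index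
  \<open>p\<close> supplies the decay of \<open>m\<close>. Conversely, membership of
  \<open>m\<close> in its own space forces decay of this kind, as evaluation by the kernel shows.
  The nonzero determinant enters through positivity of the total mass; from there the recurrence
  keeps every polynomial from degenerating to 0.\<close>

lemma unit_circle_cauchy:
  assumes "h holomorphic_on cball 0 1" "cmod w < 1"
  shows "((\<lambda>t. h (cis (2 * pi * t)) * (cis (2 * pi * t) / (cis (2 * pi * t) - w)))
           has_integral h w) {0..1}"
proof -
  have "((\<lambda>u. h u / (u - w)) has_contour_integral (2 * of_real pi * \<i> * h w)) (circlepath 0 1)"
    using Cauchy_integral_circlepath_simple[OF assms(1)] assms(2) by simp
  then have "((\<lambda>x. h (circlepath 0 1 x) / (circlepath 0 1 x - w) *
               vector_derivative (circlepath 0 1) (at x within {0..1}))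
             has_integral 2 * of_real pi * \<i> * h w) {0..1}"
    by (simp add: has_contour_integral_def)
  \<comment> \<open>On the circle \<open>du = 2 pi i u dt\<close>: the constant cancels, and the
    factor \<open>u\<close> stays in the kernel.\<close>
  then have "((\<lambda>x. (2 * of_real pi * \<i>) * (h (cis (2 * pi * x)) * (cis (2 * pi * x) / (cis (2 * pi * x) - w))))
             has_integral (2 * of_real pi * \<i>) * h w) {0..1}"
    by (rule has_integral_eq[rotated])
       (simp add: vector_derivative_circlepath01, simp add: circlepath cis_conv_exp mult_ac)
  from has_integral_mult_right[OF this, of "1 / (2 * of_real pi * \<i>)"]
  show ?thesis by simp
qed

text \<open>On the circle \<open>cnj u = 1 / u\<close>, so \<open>cnj h / (1 - w * cnj u)\<close>
  carries the same kernel \<open>u / (u - w)\<close> as Cauchy's integrand. It is the conjugate of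
  \<open>h / (1 - cnj w * u)\<close>, which is holomorphic on the closed disc and has mean value
  \<open>h 0\<close>. Adding the two produces \<open>2 * Re h\<close>; subtracting the mean of
  \<open>Re h\<close> turns \<open>2 * u / (u - w)\<close> into
  \<open>(u + w) / (u - w)\<close>.\<close>

lemma schwarz_formula:
  assumes h: "h holomorphic_on cball 0 1" and w: "cmod w < 1"
  shows "((\<lambda>t. of_real (Re (h (cis (2 * pi * t)))) * ((cis (2 * pi * t) + w) / (cis (2 * pi * t) - w)))
           has_integral (h w - \<i> * of_real (Im (h 0)))) {0..1}"
proof -
  define u where "u = (\<lambda>t. cis (2 * pi * t))"
  have nz: "1 - cnj w * z \<noteq> 0" if "cmod z \<le> 1" for z
  proof -
    have "cmod (cnj w * z) < 1" using w that
      by (simp add: norm_mult) (metis mult_left_le norm_ge_zero order_le_less_trans)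
    then show ?thesis by auto
  qed
  have nz2: "u t - w \<noteq> 0" for t using w unfolding u_def by auto
  have un: "u t \<noteq> 0" "cnj (u t) = 1 / u t" for t unfolding u_def by (auto simp: cis_cnj divide_inverse)
  have I1: "((\<lambda>t. h (u t) * (u t / (u t - w))) has_integral h w) {0..1}"
    using unit_circle_cauchy[OF h w] by (simp add: u_def)
  have I2: "((\<lambda>t. h (u t)) has_integral h 0) {0..1}"
    using unit_circle_cauchy[OF h, of 0] by (simp add: u_def)
  have "(\<lambda>z. h z / (1 - cnj w * z)) holomorphic_on cball 0 1"
    using nz h by (auto intro!: holomorphic_intros)
  from unit_circle_cauchy[OF this, of 0]
  have "((\<lambda>t. h (u t) / (1 - cnj w * u t)) has_integral h 0) {0..1}"
    by (simp add: u_def)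
  from has_integral_linear[OF this bounded_linear_cnj]
  have I3: "((\<lambda>t. cnj (h (u t)) / (1 - w * cnj (u t))) has_integral cnj (h 0)) {0..1}"
    by (simp add: o_def)
  from has_integral_linear[OF has_integral_linear[OF I2 bounded_linear_Re] bounded_linear_of_real]
  have I4: "((\<lambda>t. complex_of_real (Re (h (u t)))) has_integral of_real (Re (h 0))) {0..1}"
    by (simp add: o_def)
  have "((\<lambda>t. h (u t) * (u t / (u t - w)) + cnj (h (u t)) / (1 - w * cnj (u t)) - of_real (Re (h (u t))))
      has_integral h w + cnj (h 0) - of_real (Re (h 0))) {0..1}"
    by (intro has_integral_diff has_integral_add I1 I3 I4)
  moreover have "h (u t) * (u t / (u t - w)) + cnj (h (u t)) / (1 - w * cnj (u t)) - of_real (Re (h (u t)))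
     = of_real (Re (h (u t))) * ((u t + w) / (u t - w))" for t
  proof -
    have "1 - w * cnj (u t) = (u t - w) / u t" using un by (simp add: field_simps)
    then have "h (u t) * (u t / (u t - w)) + cnj (h (u t)) / (1 - w * cnj (u t))
       = (h (u t) + cnj (h (u t))) * (u t / (u t - w))" using un(1)[of t] by (simp add: ring_distribs add_divide_distrib)
    also have "\<dots> = of_real (Re (h (u t))) * (2 * u t / (u t - w))"
      by (simp add: complex_add_cnj)
    also have "2 * u t / (u t - w) = (u t + w) / (u t - w) + 1" using nz2[of t] by (simp add: field_simps)
    finally show ?thesis by (simp add: algebra_simps)
  qed
  moreover have "h w + cnj (h 0) - of_real (Re (h 0)) = h w - \<i> * of_real (Im (h 0))"
    by (simp add: complex_eq_iff)
  ultimately show ?thesis unfolding u_def by simp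
qed

text \<open>Restricting \<open>f\<close> to circles of radius \<open>r j < 1\<close> gives densities
  \<open>Re (f (r j * u)) / c\<close> on the parameter interval, probability measures by the mean
  value property. Helly selection yields a weak limit, which suffices because for fixed
  \<open>w\<close> in the open disc the kernel is bounded and continuous in
  \<open>t\<close>.\<close>

lemma herglotz_disc:
  assumes f: "f holomorphic_on ball 0 1" and pos: "\<And>w. cmod w < 1 \<Longrightarrow> Re (f w) \<ge> 0"
  obtains \<mu> :: "real measure" where "finite_measure \<mu>" "sets \<mu> = sets borel"
    "\<And>w. cmod w < 1 \<Longrightarrow> f w = \<i> * of_real (Im (f 0)) +
       (\<integral>t. (cis (2 * pi * t) + w) / (cis (2 * pi * t) - w) \<partial>\<mu>)"
proof -
  define u where "u = (\<lambda>t. cis (2 * pi * t))"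
  define c where "c = Re (f 0)"
  define k where "k = (\<lambda>w t. (u t + w) / (u t - w))"
  have nu: "cmod (u t) = 1" for t by (simp add: u_def)
  have cu: "continuous_on S u" for S unfolding u_def by (intro continuous_intros)
  have kne: "u t - w \<noteq> 0" if "cmod w < 1" for w t using nu[of t] that by auto
  have ck: "continuous_on S (k w)" if "cmod w < 1" for S w
    unfolding k_def using kne[OF that] by (intro continuous_intros cu) auto
  have kb: "cmod (k w t) \<le> 2 / (1 - cmod w)" if "cmod w < 1" for w t
  proof -
    have "cmod (u t - w) \<ge> 1 - cmod w" using norm_triangle_ineq2[of "u t" w] nu[of t] by simp
    moreover have "cmod (u t + w) \<le> 2" using norm_triangle_ineq[of "u t" w] nu[of t] that by simp
    ultimately show ?thesis unfolding k_def norm_divide using that by (intro frac_le) auto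
  qed
  define r where "r = (\<lambda>j::nat. 1 - 1 / (real j + 2))"
  have r: "0 < r j" "r j < 1" for j by (auto simp: r_def field_simps)
  have rlim: "r \<longlonglongrightarrow> 1" unfolding r_def by real_asymp
  define g where "g = (\<lambda>j z. f (of_real (r j) * z))"
  have rz: "cmod (of_real (r j) * z) < 1" if "cmod z \<le> 1" for j z
    using r[of j] that by (simp add: norm_mult) (metis abs_of_pos mult_left_le norm_ge_zero order_le_less_trans less_imp_le)
  have gh: "g j holomorphic_on cball 0 1" for j
    unfolding g_def
    by (rule holomorphic_on_compose_gen[OF _ f, unfolded o_def]) (use rz in \<open>auto intro!: holomorphic_intros\<close>)
  have g0: "g j 0 = f 0" for j by (simp add: g_def)
  have cg: "continuous_on S (\<lambda>t. g j (u t))" for S j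
    by (rule continuous_on_compose2[OF holomorphic_on_imp_continuous_on[OF gh] cu]) (auto simp: nu)
  have gpos: "Re (g j (u t)) \<ge> 0" for j t unfolding g_def using pos rz nu by simp
  have gint: "integral {0..1} (\<lambda>t. of_real (Re (g j (u t))) * k w t) = g j w - \<i> * of_real (Im (f 0))"
    if "cmod w < 1" for j w
    using schwarz_formula[OF gh that, of j] unfolding g0 k_def u_def by (simp add: integral_unique)
  have gmean: "((\<lambda>t. Re (g j (u t))) has_integral c) {0..1}" for j
  proof -
    have "((\<lambda>t. complex_of_real (Re (g j (u t)))) has_integral g j 0 - \<i> * of_real (Im (g j 0))) {0..1}"
      using schwarz_formula[OF gh, of 0 j] by (simp add: u_def)
    from has_integral_linear[OF this bounded_linear_Re]
    show ?thesis by (simp add: o_def g0 c_def)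
  qed
  have glim: "(\<lambda>j. g j w) \<longlonglongrightarrow> f w" if "cmod w < 1" for w
  proof -
    have "isCont f w" using holomorphic_on_imp_continuous_on[OF f] that by (simp add: continuous_on_eq_continuous_at)
    moreover have "(\<lambda>j. of_real (r j) * w) \<longlonglongrightarrow> of_real 1 * w" by (intro tendsto_intros rlim)
    ultimately show ?thesis unfolding g_def by (metis isCont_tendsto_compose mult_1 of_real_1)
  qed
  have setint: "(\<integral>t. indicator {0..1} t *\<^sub>R F t \<partial>lborel) = integral {0..1} F"
     "integrable lborel (\<lambda>t. indicator {0..1} t *\<^sub>R F t)"
    if "continuous_on {0..1} F" for F :: "real \<Rightarrow> complex"
  proof -
    have "set_integrable lborel {0..1} F" by (rule borel_integrable_atLeastAtMost'[OF that])
    then show "integrable lborel (\<lambda>t. indicator {0..1} t *\<^sub>R F t)" "(\<integral>t. indicator {0..1} t *\<^sub>R F t \<partial>lborel) = integral {0..1} F"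
      using set_borel_integral_eq_integral(2)[of "{0..1}" F]
      by (auto simp: set_integrable_def set_lebesgue_integral_def)
  qed
  show ?thesis
  proof (cases "c = 0")
    \<comment> \<open>Normalisation by \<open>c\<close> breaks down here. A continuous nonnegative
      function with mean 0 vanishes, so \<open>Re f\<close> is 0 on all circles of radius
      \<open>r j\<close>, Schwarz's formula makes \<open>f\<close> constant, and the zero measure
      serves.\<close>
    case True
    have const: "f w = \<i> * of_real (Im (f 0))" if "cmod w < 1" for w
    proof -
      have Re0: "Re (g j (u t)) = 0" if t: "t \<in> {0..1}" for j t
      proof -
        have hi: "((\<lambda>t. Re (g j (u t))) has_integral 0) {0..1}" using gmean[of j] True by simp
        show ?thesis
          by (rule has_integral_0_cbox_imp_0[of 0 1 "\<lambda>t. Re (g j (u t))", unfolded cbox_interval, OF _ _ hi _ t])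
             (auto intro!: continuous_intros cg gpos)
      qed
      have "g j w = \<i> * of_real (Im (f 0))" for j
      proof -
        have "integral {0..1} (\<lambda>t. of_real (Re (g j (u t))) * k w t) = 0"
          using Henstock_Kurzweil_Integration.integral_cong[of "{0..1}" "\<lambda>t. of_real (Re (g j (u t))) * k w t" "\<lambda>t. 0"]
          by (simp add: Re0)
        then show ?thesis using gint[OF that, of j] by simp
      qed
      then show ?thesis using glim[OF that] by (simp add: LIMSEQ_const_iff)
    qed
    have null: "(\<integral>t. F t \<partial>null_measure borel) = 0" for F :: "real \<Rightarrow> complex"
      by (intro integral_eq_zero_AE AE_I[of _ _ UNIV]) auto
    show ?thesis
    proof (rule that[of "null_measure borel"])
      show "finite_measure (null_measure borel :: real measure)" by (rule finite_measureI) simp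
      show "f w = \<i> * of_real (Im (f 0)) +
         (\<integral>t. (cis (2 * pi * t) + w) / (cis (2 * pi * t) - w) \<partial>null_measure borel)" if "cmod w < 1" for w
        unfolding null using const[OF that] by (rule trans) simp
    qed simp
  next
    case False
    then have c: "c > 0" using pos[of 0] by (simp add: c_def)
    define P where "P = (\<lambda>j. density lborel (\<lambda>t. ennreal (indicator {0..1} t * (Re (g j (u t)) / c))))"
    have mg[measurable]: "(\<lambda>t. g j (u t)) \<in> borel_measurable borel" for j
      by (rule borel_measurable_continuous_onI[OF cg])
    have Pint: "(\<integral>t. F t \<partial>P j) = integral {0..1} (\<lambda>t. of_real (Re (g j (u t))) * F t) / of_real c"
      if F: "continuous_on UNIV F" for F :: "real \<Rightarrow> complex" and j
    proof -
      have [measurable]: "F \<in> borel_measurable borel" by (rule borel_measurable_continuous_onI[OF F])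
      have "(\<integral>t. F t \<partial>P j) = (\<integral>t. (indicator {0..1} t * (Re (g j (u t)) / c)) *\<^sub>R F t \<partial>lborel)"
        unfolding P_def using gpos c by (subst integral_density) auto
      also have "\<dots> = (\<integral>t. indicator {0..1} t *\<^sub>R (of_real (Re (g j (u t))) * F t / of_real c) \<partial>lborel)"
        by (intro Bochner_Integration.integral_cong) (auto simp: scaleR_conv_of_real)
      also have "\<dots> = integral {0..1} (\<lambda>t. of_real (Re (g j (u t))) * F t / of_real c)"
        by (rule setint(1)) (use c in \<open>auto intro!: continuous_intros cg continuous_on_subset[OF F]\<close>)
      finally show ?thesis by (simp add: integral_divide)
    qed
    have Pone: "emeasure (P j) {0..1} = 1" "emeasure (P j) (space (P j)) = 1" for j
    proof -
      from has_integral_divide[OF gmean, of j c] c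
      have "((\<lambda>t. Re (g j (u t)) / c) has_integral 1) {0..1}" by simp
      moreover have "(\<lambda>t. indicator {0..1} t * (Re (g j (u t)) / c)) = (\<lambda>t. if t \<in> {0..1} then Re (g j (u t)) / c else 0)"
        by (auto simp: fun_eq_iff indicator_def)
      ultimately have "((\<lambda>t. indicator {0..1} t * (Re (g j (u t)) / c)) has_integral 1) UNIV"
        by (simp only: has_integral_restrict_UNIV)
      then have "(\<integral>\<^sup>+t. ennreal (indicator {0..1} t * (Re (g j (u t)) / c)) \<partial>lborel) = 1"
        using gpos c by (subst nn_integral_has_integral_lborel[where I = 1]) (auto)
      moreover have "(\<integral>\<^sup>+t. ennreal (indicator {0..1} t * (Re (g j (u t)) / c)) * indicator {0..1} t \<partial>lborel) =
          (\<integral>\<^sup>+t. ennreal (indicator {0..1} t * (Re (g j (u t)) / c)) \<partial>lborel)"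
        by (intro nn_integral_cong) (auto simp: indicator_def)
      ultimately show "emeasure (P j) {0..1} = 1" "emeasure (P j) (space (P j)) = 1"
        unfolding P_def by (simp_all add: emeasure_density)
    qed
    have Prd: "real_distribution (P j)" for j
      unfolding real_distribution_def real_distribution_axioms_def
      using Pone(2)[of j] by (auto intro!: prob_spaceI simp: P_def)
    have "tight P"
      unfolding tight_def
    proof (intro conjI allI impI Prd)
      fix \<epsilon> :: real assume e: "\<epsilon> > 0"
      show "\<exists>a b::real. a < b \<and> (\<forall>n. 1 - \<epsilon> < measure (P n) {a<..b})"
      proof (intro exI conjI allI)
        \<comment> \<open>Tightness is phrased with half-open intervals, so the left end lies below
          0 in order to catch all of \<open>{0..1}\<close>.\<close>
        show "(-1::real) < 1" by simp
        fix j
        interpret real_distribution "P j" by (rule Prd)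
        have "measure (P j) {0..1} \<le> measure (P j) {-1<..1}" by (intro finite_measure_mono) auto
        moreover have "measure (P j) {0..1} = 1" using Pone(1)[of j] by (simp add: measure_def)
        ultimately show "1 - \<epsilon> < measure (P j) {-1<..1}" using e by simp
      qed
    qed
    from tight_imp_convergent_subsubsequence[OF this, of "\<lambda>x. x"]
    obtain s M where s: "strict_mono (s::nat\<Rightarrow>nat)" and M: "real_distribution M" and wc: "weak_conv_m (P \<circ> (\<lambda>x. x) \<circ> s) M"
      by (auto simp: strict_mono_def)
    interpret M: real_distribution M by (rule M)
    have main: "f w = \<i> * of_real (Im (f 0)) + of_real c * (\<integral>t. k w t \<partial>M)" if w: "cmod w < 1" for w
    proof -
      have "(\<lambda>j. \<integral>t. k w t \<partial>(P \<circ> (\<lambda>x. x) \<circ> s) j) \<longlonglongrightarrow> (\<integral>t. k w t \<partial>M)"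
        by (rule weak_conv_imp_integral_bdd_continuous_conv[OF _ _ wc _ kb[OF w]])
           (use Prd M ck[OF w, of UNIV] in \<open>auto simp: continuous_on_eq_continuous_at\<close>)
      then have "(\<lambda>j. (g (s j) w - \<i> * of_real (Im (f 0))) / of_real c) \<longlonglongrightarrow> (\<integral>t. k w t \<partial>M)"
        by (simp add: Pint[OF ck[OF w]] gint[OF w])
      moreover have "(\<lambda>j. (g (s j) w - \<i> * of_real (Im (f 0))) / of_real c) \<longlonglongrightarrow> (f w - \<i> * of_real (Im (f 0))) / of_real c"
        using c by (intro tendsto_intros LIMSEQ_subseq_LIMSEQ[OF glim[OF w] s, unfolded o_def]) auto
      ultimately have "(\<integral>t. k w t \<partial>M) = (f w - \<i> * of_real (Im (f 0))) / of_real c"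
        by (rule LIMSEQ_unique)
      then show ?thesis using c by simp
    qed
    show ?thesis
    proof (rule that[of "density M (\<lambda>_. ennreal c)"])
      show "finite_measure (density M (\<lambda>_. ennreal c))"
        using M.emeasure_finite[of UNIV]
        by (intro finite_measureI) (auto simp: emeasure_density ennreal_mult_eq_top_iff)
      fix w assume w: "cmod w < 1"
      have "k w \<in> borel_measurable M"
        using borel_measurable_continuous_onI[OF ck[OF w]] by simp
      then have "(\<integral>t. k w t \<partial>density M (\<lambda>_. ennreal c)) = of_real c * (\<integral>t. k w t \<partial>M)"
        using c by (subst integral_density) (auto simp: scaleR_conv_of_real)
      then show "f w = \<i> * of_real (Im (f 0)) +
           (\<integral>t. (cis (2 * pi * t) + w) / (cis (2 * pi * t) - w) \<partial>density M (\<lambda>_. ennreal c))"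
        using main[OF w] unfolding k_def u_def by simp
    qed simp
  qed
qed

text \<open>Integrability of the limit is a conclusion: this is how the weight
  \<open>1 + (X t)\<^sup>2\<close>, the even powers of \<open>t\<close> and the limits in L2 turn
  out to be integrable.\<close>

lemma fatou_integrable:
  fixes F :: "nat \<Rightarrow> 'a \<Rightarrow> real"
  assumes int: "\<And>j. integrable M (F j)" and G[measurable]: "G \<in> borel_measurable M"
    and nn: "\<And>j. AE t in M. 0 \<le> F j t"
    and lim: "AE t in M. (\<lambda>j. F j t) \<longlonglongrightarrow> G t"
    and bd: "\<forall>\<^sub>F j in sequentially. (\<integral>t. F j t \<partial>M) \<le> C"
  shows "integrable M G" "(\<integral>t. G t \<partial>M) \<le> C"
proof -
  have nn': "AE t in M. \<forall>j. 0 \<le> F j t" using nn by (simp add: AE_all_countable)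
  have G0: "AE t in M. 0 \<le> G t" using lim nn'
    by eventually_elim (auto intro: LIMSEQ_le_const)
  have [measurable]: "F j \<in> borel_measurable M" for j using int by auto
  have "0 \<le> (\<integral>t. F j t \<partial>M)" for j using nn by (intro integral_nonneg_AE) auto
  \<comment> \<open>\<open>ennreal\<close> truncates at 0, so the return to real numbers at the end
    needs this sign.\<close>
  with bd have C0: "C \<ge> 0" by (metis (mono_tags, lifting) eventually_happens' order_trans sequentially_bot)
  have "(\<integral>\<^sup>+t. ennreal (G t) \<partial>M) = (\<integral>\<^sup>+t. liminf (\<lambda>j. ennreal (F j t)) \<partial>M)"
  proof (rule nn_integral_cong_AE)
    show "AE t in M. ennreal (G t) = liminf (\<lambda>j. ennreal (F j t))"
      using lim
    proof eventually_elim
      case (elim t)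
      from lim_imp_Liminf[OF sequentially_bot tendsto_ennrealI[OF elim]] show ?case by simp
    qed
  qed
  also have "\<dots> \<le> liminf (\<lambda>j. \<integral>\<^sup>+t. ennreal (F j t) \<partial>M)"
    by (rule nn_integral_liminf) auto
  also have "\<dots> \<le> liminf (\<lambda>j. ennreal C)"
    by (rule Liminf_mono, use bd in eventually_elim) (auto simp: nn_integral_eq_integral[OF int nn] intro: ennreal_leI)
  also have "\<dots> = ennreal C" by (simp add: Liminf_const)
  finally have *: "(\<integral>\<^sup>+t. ennreal (G t) \<partial>M) \<le> ennreal C" .
  show I: "integrable M G"
    using * G0 by (intro integrableI_nonneg) (auto simp: top.not_eq_extremum order_le_less_trans)
  show "(\<integral>t. G t \<partial>M) \<le> C"
    using * C0 nn_integral_eq_integral[OF I G0] by (simp add: ennreal_le_iff)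
qed

section \<open>Cauchy kernels and the representation in the half plane\<close>

declare (in finite_borel_measure) M_is_borel [simp, measurable_cong]

lemma nonreal_kernel_bound:
  assumes "Im z \<noteq> 0"
  shows "cmod (1 / (of_real t - z)) \<le> 1 / \<bar>Im z\<bar>"
proof -
  have "\<bar>Im z\<bar> \<le> cmod (of_real t - z)" using abs_Im_le_cmod[of "of_real t - z"] by simp
  then show ?thesis using assms by (simp add: norm_divide frac_le)
qed

lemma nonreal_neq_of_real: "Im z \<noteq> 0 \<Longrightarrow> complex_of_real t - z \<noteq> 0"
  by (auto simp: complex_eq_iff)

lemma (in finite_borel_measure) integrable_cauchy_kernel:
  "Im z \<noteq> 0 \<Longrightarrow> integrable M (\<lambda>t. 1 / (of_real t - z))"
  by (rule integrable_const_bound[where B = "1 / \<bar>Im z\<bar>"]) (use nonreal_kernel_bound in auto)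

lemma (in finite_borel_measure) cauchy_transform_bound:
  assumes "Im z \<noteq> 0"
  shows "cmod (\<integral>t. 1 / (of_real t - z) \<partial>M) \<le> measure M (space M) / \<bar>Im z\<bar>"
proof -
  have "cmod (\<integral>t. 1 / (of_real t - z) \<partial>M) \<le> (\<integral>t. cmod (1 / (of_real t - z)) \<partial>M)"
    by (rule integral_norm_bound)
  also have "\<dots> \<le> (\<integral>t. 1 / \<bar>Im z\<bar> \<partial>M)"
    using nonreal_kernel_bound[OF assms] integrable_cauchy_kernel[OF assms]
    by (intro integral_mono) auto
  finally show ?thesis by simp
qed

text \<open>The Cayley transform carries the disc formula to the upper half plane; the point \<open>1\<close> of the
  circle corresponds to infinity, where boundedness of \<open>y |n(iy)|\<close> forbids mass.\<close>

theorem nevanlinna_cauchy_representation: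
  assumes n: "nevanlinna n" and bd: "\<forall>\<^sub>F y in at_top. y * cmod (n (\<i> * of_real y)) \<le> C"
  shows "\<exists>\<sigma>. cauchy_represents \<sigma> n"
proof -
  \<comment> \<open>The factor \<open>- \<i>\<close> rotates the upper half plane onto the right
    half plane, as the disc formula wants a nonnegative real part.\<close>
  define f where "f = (\<lambda>w. - \<i> * n (\<i> * (1 + w) / (1 - w)))"
  have hol: "n holomorphic_on {z. Im z > 0}" using n by (simp add: nevanlinna_def analytic_imp_holomorphic)
  have imz: "Im (\<i> * (1 + w) / (1 - w)) > 0" if w: "cmod w < 1" for w
  proof -
    have 1: "1 - w \<noteq> 0" using w by auto
    have "Im (\<i> * (1 + w) / (1 - w)) = (1 - (cmod w)\<^sup>2) / (cmod (1 - w))\<^sup>2"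
      unfolding Im_divide cmod_power2 by (simp add: algebra_simps power2_eq_square)
    also have "\<dots> > 0" using w 1 by (intro divide_pos_pos) (auto simp: power_less_one_iff abs_square_less_1)
    finally show ?thesis .
  qed
  have "(\<lambda>w. n (\<i> * (1 + w) / (1 - w))) holomorphic_on ball 0 1"
    by (rule holomorphic_on_compose_gen[OF _ hol, unfolded o_def])
       (use imz in \<open>auto intro!: holomorphic_intros\<close>)
  then have fh: "f holomorphic_on ball 0 1" unfolding f_def by (intro holomorphic_intros)
  have fpos: "Re (f w) \<ge> 0" if "cmod w < 1" for w
    using n imz[OF that] by (simp add: f_def nevanlinna_def)
  obtain \<mu> where \<mu>: "finite_measure \<mu>" "sets \<mu> = sets (borel :: real measure)"
    and rep: "\<And>w. cmod w < 1 \<Longrightarrow> f w = \<i> * of_real (Im (f 0)) +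
       (\<integral>t. (cis (2 * pi * t) + w) / (cis (2 * pi * t) - w) \<partial>\<mu>)"
  proof (rule herglotz_disc[OF fh fpos])
    fix \<nu> :: "real measure"
    assume \<nu>: "finite_measure \<nu>" "sets \<nu> = sets borel"
      "\<And>w. cmod w < 1 \<Longrightarrow> f w = \<i> * of_real (Im (f 0)) +
         (\<integral>t. (cis (2 * pi * t) + w) / (cis (2 * pi * t) - w) \<partial>\<nu>)"
    show thesis by (rule that[OF \<nu>])
  qed
  interpret \<mu>: finite_borel_measure \<mu>
    using \<mu> by (simp add: finite_borel_measure_def finite_borel_measure_axioms_def)
  define u where "u = (\<lambda>t. cis (2 * pi * t))"
  define E where "E = {t. u t = 1}"
  \<comment> \<open>The Cayley image of the boundary point \<open>u t\<close>, that is
    \<open>- cot (pi * t)\<close>. It is real off \<open>E\<close>, so \<open>Re\<close> only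
    changes the type.\<close>
  define X where "X = (\<lambda>t. Re (\<i> * (1 + u t) / (1 - u t)))"
  define \<alpha> where "\<alpha> = - Im (f 0)"
  \<comment> \<open>This is \<open>\<i> * (u t + w) / (u t - w)\<close> in the coordinate
    \<open>X\<close>, with \<open>w\<close> the disc point corresponding to \<open>z\<close>. On
    \<open>E\<close> it degenerates to \<open>z\<close>, the linear term of Nevanlinna's
    representation.\<close>
  define K :: "complex \<Rightarrow> real \<Rightarrow> complex" where "K = (\<lambda>z t. if t \<in> E then z else (1 + of_real (X t) * z) / (of_real (X t) - z))"
  have um[measurable]: "u \<in> borel_measurable borel"
    unfolding u_def by (intro borel_measurable_continuous_onI continuous_intros)
  have Xm[measurable]: "X \<in> borel_measurable borel" unfolding X_def
    by (intro measurable_compose[OF _ borel_measurable_Re] borel_measurable_divide borel_measurable_times borel_measurable_add borel_measurable_diff borel_measurable_const um)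
  have Em[measurable]: "E \<in> sets borel"
  proof -
    have "E = u -` {1} \<inter> space borel" by (auto simp: E_def)
    then show ?thesis using measurable_sets[OF um, of "{1}"] by simp
  qed
  have XE: "X t = 0" if "t \<in> E" for t using that by (simp add: X_def E_def)
  have uX: "u t = (of_real (X t) - \<i>) / (of_real (X t) + \<i>)" "of_real (X t) + \<i> \<noteq> 0" if "t \<notin> E" for t
  proof -
    define v where "v = \<i> * (1 + u t) / (1 - u t)"
    have u: "cnj (u t) = 1 / u t" "u t \<noteq> 0" "1 - u t \<noteq> 0"
      using that by (auto simp: u_def cis_cnj divide_inverse E_def)
    have "cnj v = v" using u unfolding v_def by (simp add: divide_simps) (simp add: algebra_simps)
    then have v: "of_real (X t) = v" unfolding X_def v_def[symmetric] by (simp add: complex_eq_iff)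
    show "of_real (X t) + \<i> \<noteq> 0" by (simp add: complex_eq_iff)
    moreover have "u t * (v + \<i>) = v - \<i>" using u(3) unfolding v_def
      by (simp add: divide_simps) (simp add: algebra_simps)
    ultimately show "u t = (of_real (X t) - \<i>) / (of_real (X t) + \<i>)" unfolding v by (simp add: field_simps)
  qed
  have Kint: "integrable \<mu> (K z)" and nK: "n z = of_real \<alpha> + (\<integral>t. K z t \<partial>\<mu>)" if z: "Im z > 0" for z
  proof -
    define w where "w = (z - \<i>) / (z + \<i>)"
    have zi: "z + \<i> \<noteq> 0" using z by (auto simp: complex_eq_iff)
    have "(cmod (z - \<i>))\<^sup>2 < (cmod (z + \<i>))\<^sup>2" using z unfolding cmod_power2 by (simp add: power2_eq_square algebra_simps)
    then have "cmod (z - \<i>) < cmod (z + \<i>)" using power2_less_imp_less norm_ge_zero by blast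
    then have w: "cmod w < 1" using zi unfolding w_def by (simp add: norm_divide)
    have zw: "\<i> * (1 + w) / (1 - w) = z"
    proof -
      have "1 + w = 2 * z / (z + \<i>)" "1 - w = 2 * \<i> / (z + \<i>)" using zi unfolding w_def by (simp_all add: field_simps)
      then show ?thesis using zi by simp
    qed
    have cancel: "(a / c) / (b / c) = a / b" if "c \<noteq> 0" for a b c :: complex using that by simp
    have KK: "\<i> * ((u t + w) / (u t - w)) = K z t" for t
    proof (cases "t \<in> E")
      case True
      then show ?thesis using zw by (simp add: K_def E_def)
    next
      case False
      have Xz: "of_real (X t) - z \<noteq> 0" using z by (auto simp: complex_eq_iff)
      let ?x = "complex_of_real (X t)"
      have "u t + w = ((?x - \<i>) * (z + \<i>) + (z - \<i>) * (?x + \<i>)) / ((?x + \<i>) * (z + \<i>))"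
        using uX[OF False] zi unfolding w_def by (simp add: add_divide_eq_iff divide_add_eq_iff)
      moreover have "u t - w = ((?x - \<i>) * (z + \<i>) - (z - \<i>) * (?x + \<i>)) / ((?x + \<i>) * (z + \<i>))"
        using uX[OF False] zi unfolding w_def by (simp add: diff_divide_eq_iff divide_diff_eq_iff)
      moreover have "(?x - \<i>) * (z + \<i>) + (z - \<i>) * (?x + \<i>) = 2 * (1 + ?x * z)" by (simp add: algebra_simps)
      moreover have "(?x - \<i>) * (z + \<i>) - (z - \<i>) * (?x + \<i>) = 2 * \<i> * (?x - z)" by (simp add: algebra_simps)
      ultimately have "u t + w = 2 * (1 + ?x * z) / ((?x + \<i>) * (z + \<i>))"
          "u t - w = 2 * \<i> * (?x - z) / ((?x + \<i>) * (z + \<i>))" by simp_all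
      then have "\<i> * ((u t + w) / (u t - w)) = \<i> * (2 * (1 + ?x * z) / (2 * \<i> * (?x - z)))"
        using cancel[of "(?x + \<i>) * (z + \<i>)" "2 * (1 + ?x * z)" "2 * \<i> * (?x - z)"] uX(2)[OF False] zi
        by (simp only: no_zero_divisors[OF uX(2)[OF False] zi] not_False_eq_True simp_thms)
      also have "\<dots> = (2 * \<i>) * (1 + ?x * z) / ((2 * \<i>) * (?x - z))" by (simp only: times_divide_eq_right ac_simps)
      also have "\<dots> = (1 + ?x * z) / (?x - z)" by (rule mult_divide_mult_cancel_left) simp
      finally show ?thesis using False by (simp add: K_def)
    qed
    have int: "integrable \<mu> (\<lambda>t. (u t + w) / (u t - w))"
    proof (rule \<mu>.integrable_const_bound[where B = "2 / (1 - cmod w)"])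
      have "cmod ((u t + w) / (u t - w)) \<le> 2 / (1 - cmod w)" for t
      proof -
        have "cmod (u t - w) \<ge> 1 - cmod w" using norm_triangle_ineq2[of "u t" w] by (simp add: u_def)
        moreover have "cmod (u t + w) \<le> 2" using norm_triangle_ineq[of "u t" w] w by (simp add: u_def)
        ultimately show ?thesis unfolding norm_divide using w by (intro frac_le) auto
      qed
      then show "AE t in \<mu>. cmod ((u t + w) / (u t - w)) \<le> 2 / (1 - cmod w)" by simp
    qed measurable
    have Kz: "K z = (\<lambda>t. \<i> * ((u t + w) / (u t - w)))" using KK by auto
    show "integrable \<mu> (K z)" unfolding Kz by (rule integrable_mult_right[OF int])
    have "n z = \<i> * f w" unfolding f_def zw by simp
    also have "\<dots> = of_real \<alpha> + \<i> * (\<integral>t. (u t + w) / (u t - w) \<partial>\<mu>)"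
      unfolding rep[OF w] \<alpha>_def u_def by (simp add: algebra_simps)
    also have "\<i> * (\<integral>t. (u t + w) / (u t - w) \<partial>\<mu>) = (\<integral>t. K z t \<partial>\<mu>)"
      unfolding Kz by (rule integral_mult_right_zero[symmetric])
    finally show "n z = of_real \<alpha> + (\<integral>t. K z t \<partial>\<mu>)" .
  qed
  \<comment> \<open>On \<open>E\<close> this grows like \<open>y\<^sup>2\<close>; elsewhere it tends
    to \<open>1 + (X t)\<^sup>2\<close>. Its integral is
    \<open>y * Im (n (\<i> * of_real y))\<close>, so the one bound \<open>C\<close> both excludes
    mass on \<open>E\<close> and, through Fatou, makes the limit integrable.\<close>
  define \<phi> where "\<phi> = (\<lambda>y t. if t \<in> E then y\<^sup>2 else y\<^sup>2 * (1 + (X t)\<^sup>2) / ((X t)\<^sup>2 + y\<^sup>2))"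
  have \<phi>: "\<phi> y t = y * Im (K (\<i> * of_real y) t)" for y t
    by (simp add: \<phi>_def K_def Im_divide power2_eq_square algebra_simps add_divide_distrib)
  have \<phi>0: "\<phi> y t \<ge> 0" for y t unfolding \<phi>_def by auto
  have \<phi>int: "integrable \<mu> (\<phi> y)" "(\<integral>t. \<phi> y t \<partial>\<mu>) = y * Im (n (\<i> * of_real y))" if "y > 0" for y
    using that unfolding \<phi> by (auto intro!: integrable_mult_right integrable_Im Kint simp: nK integral_Im Kint)
  obtain Y where Y: "Y > 0" "\<And>y. y \<ge> Y \<Longrightarrow> y * cmod (n (\<i> * of_real y)) \<le> C"
  proof -
    from bd obtain Y0 where "\<And>y. y \<ge> Y0 \<Longrightarrow> y * cmod (n (\<i> * of_real y)) \<le> C"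
      unfolding eventually_at_top_linorder by auto
    then show thesis by (intro that[of "max Y0 1"]) auto
  qed
  have \<phi>C: "(\<integral>t. \<phi> y t \<partial>\<mu>) \<le> C" if "y \<ge> Y" for y
  proof -
    have "(\<integral>t. \<phi> y t \<partial>\<mu>) = y * Im (n (\<i> * of_real y))" using \<phi>int that Y by auto
    also have "\<dots> \<le> y * cmod (n (\<i> * of_real y))" using Y(1) that abs_Im_le_cmod[of "n (\<i> * of_real y)"]
      by (intro mult_left_mono) auto
    also have "\<dots> \<le> C" using Y that by auto
    finally show ?thesis .
  qed
  have E0: "measure \<mu> E = 0"
  proof (rule ccontr)
    assume "measure \<mu> E \<noteq> 0"
    then have pos: "measure \<mu> E > 0" using zero_less_measure_iff by blast
    have *: "y\<^sup>2 * measure \<mu> E \<le> C" if "y \<ge> Y" for y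
    proof -
      have "y\<^sup>2 * measure \<mu> E = (\<integral>t. y\<^sup>2 * indicator E t \<partial>\<mu>)" by (simp add: \<mu>)
      also have "\<dots> \<le> (\<integral>t. \<phi> y t \<partial>\<mu>)"
      proof (intro integral_mono \<phi>int)
        show "integrable \<mu> (\<lambda>t. y\<^sup>2 * indicator E t)"
          by (intro integrable_mult_right integrable_real_indicator) (simp_all add: \<mu>.emeasure_finite less_top[symmetric])
        show "y > 0" using that Y by simp
        show "y\<^sup>2 * indicator E t \<le> \<phi> y t" for t using \<phi>0[of y t] by (auto simp: \<phi>_def indicator_def)
      qed
      also have "\<dots> \<le> C" using \<phi>C that by simp
      finally show ?thesis .
    qed
    have "filterlim (\<lambda>y. y\<^sup>2 * measure \<mu> E) at_top at_top" using pos by real_asymp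
    then have "\<forall>\<^sub>F y in at_top. y\<^sup>2 * measure \<mu> E > C" by (simp add: filterlim_at_top_dense)
    then have "\<forall>\<^sub>F y::real in at_top. False"
      using eventually_ge_at_top[of Y] by eventually_elim (use * in fastforce)
    then show False by simp
  qed
  then have AE: "AE t in \<mu>. t \<notin> E"
    by (intro AE_I[of _ _ E]) (auto simp: \<mu> \<mu>.emeasure_eq_measure)
  define yy where "yy = (\<lambda>j::nat. Y + real j)"
  have yy: "yy j \<ge> Y" "yy j > 0" for j using Y by (auto simp: yy_def)
  have lim: "(\<lambda>j. \<phi> (yy j) t) \<longlonglongrightarrow> 1 + (X t)\<^sup>2" if "t \<notin> E" for t
    using that unfolding \<phi>_def yy_def by simp real_asymp
  have Xint: "integrable \<mu> (\<lambda>t. 1 + (X t)\<^sup>2)"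
  proof (rule fatou_integrable(1)[where F = "\<lambda>j. \<phi> (yy j)" and C = C])
    show "integrable \<mu> (\<phi> (yy j))" for j by (rule \<phi>int(1)[OF yy(2)])
    show "\<forall>\<^sub>F j in sequentially. (\<integral>t. \<phi> (yy j) t \<partial>\<mu>) \<le> C"
      by (intro always_eventually allI \<phi>C yy(1))
    show "AE t in \<mu>. (\<lambda>j. \<phi> (yy j) t) \<longlonglongrightarrow> 1 + (X t)\<^sup>2" using AE by eventually_elim (rule lim)
  qed (use \<phi>0 in simp_all)
  \<comment> \<open>Off \<open>E\<close>, \<open>(1 + X\<^sup>2) / (X - z) = K z + X\<close>.
    Absorbing the weight into the measure thus turns the kernel into Cauchy's, at the cost of the
    integral of \<open>X\<close>, which is collected in \<open>\<beta>\<close>.\<close>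
  define \<sigma> where "\<sigma> = distr (density \<mu> (\<lambda>t. ennreal (1 + (X t)\<^sup>2))) borel X"
  have \<sigma>s: "sets \<sigma> = sets borel" by (simp add: \<sigma>_def)
  have \<sigma>f: "finite_measure \<sigma>"
  proof (rule finite_measureI)
    let ?D = "density \<mu> (\<lambda>t. ennreal (1 + (X t)\<^sup>2))"
    have "emeasure \<sigma> (space \<sigma>) = emeasure ?D (X -` UNIV \<inter> space ?D)"
      unfolding \<sigma>_def by (subst emeasure_distr) auto
    also have "\<dots> = (\<integral>\<^sup>+t. ennreal (1 + (X t)\<^sup>2) * indicator (space \<mu>) t \<partial>\<mu>)"
      by (subst emeasure_density) (auto simp: \<mu>.borel_UNIV)
    also have "\<dots> = (\<integral>\<^sup>+t. ennreal (1 + (X t)\<^sup>2) \<partial>\<mu>)"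
      by (rule nn_integral_cong) (auto simp: indicator_def)
    also have "\<dots> = ennreal (\<integral>t. 1 + (X t)\<^sup>2 \<partial>\<mu>)" by (rule nn_integral_eq_integral[OF Xint]) simp
    also have "\<dots> < \<infinity>" by simp
    finally show "emeasure \<sigma> (space \<sigma>) \<noteq> \<infinity>" by simp
  qed
  interpret \<sigma>: finite_borel_measure \<sigma>
    using \<sigma>f \<sigma>s by (simp add: finite_borel_measure_def finite_borel_measure_axioms_def)
  have abs_le: "\<bar>x\<bar> \<le> 1 + x\<^sup>2" for x :: real
  proof -
    have "0 \<le> (\<bar>x\<bar> - 1)\<^sup>2 + \<bar>x\<bar>" by simp
    then show ?thesis by (simp add: power2_eq_square algebra_simps)
  qed
  have X1: "integrable \<mu> X"
    by (rule Bochner_Integration.integrable_bound[OF Xint]) (auto simp: abs_le)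
  define \<beta> where "\<beta> = complex_of_real (\<alpha> - (\<integral>t. X t \<partial>\<mu>))"
  have nsig: "n z = \<beta> + (\<integral>t. 1 / (of_real t - z) \<partial>\<sigma>)" if z: "Im z > 0" for z
  proof -
    have nz: "complex_of_real x - z \<noteq> 0" for x using z by (auto simp: complex_eq_iff)
    have "(\<integral>t. 1 / (of_real t - z) \<partial>\<sigma>) = (\<integral>t. (1 + (X t)\<^sup>2) *\<^sub>R (1 / (of_real (X t) - z)) \<partial>\<mu>)"
      unfolding \<sigma>_def by (subst integral_distr, simp, simp, subst integral_density) auto
    also have "\<dots> = (\<integral>t. K z t + of_real (X t) \<partial>\<mu>)"
    proof (rule integral_cong_AE)
      show "(\<lambda>t. (1 + (X t)\<^sup>2) *\<^sub>R (1 / (of_real (X t) - z))) \<in> borel_measurable \<mu>" by measurable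
      show "(\<lambda>t. K z t + of_real (X t)) \<in> borel_measurable \<mu>"
        using Kint[OF z] X1 by (intro borel_measurable_integrable) auto
      show "AE t in \<mu>. (1 + (X t)\<^sup>2) *\<^sub>R (1 / (of_real (X t) - z)) = K z t + of_real (X t)"
        using AE
      proof eventually_elim
        case (elim t)
        then show ?case
          using nz[of "X t"] by (simp add: K_def scaleR_conv_of_real divide_simps) (simp add: power2_eq_square algebra_simps)
      qed
    qed
    also have "\<dots> = (\<integral>t. K z t \<partial>\<mu>) + of_real (\<integral>t. X t \<partial>\<mu>)"
      using Kint[OF z] X1 by simp
    finally show ?thesis using nK[OF z] by (simp add: \<beta>_def)
  qed
  \<comment> \<open>Along the positive imaginary axis both \<open>n\<close> and the Cauchy transform
    are O(1/y), so no nonzero constant can separate them.\<close>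
  have "\<beta> = 0"
  proof (rule ccontr)
    assume b: "\<beta> \<noteq> 0"
    define T where "T = measure \<sigma> (space \<sigma>)"
    have *: "y * cmod \<beta> \<le> C + T" if "y \<ge> Y" for y
    proof -
      have y: "y > 0" using that Y by simp
      have "cmod \<beta> \<le> cmod (n (\<i> * of_real y)) + cmod (\<integral>t. 1 / (of_real t - \<i> * of_real y) \<partial>\<sigma>)"
        using nsig[of "\<i> * of_real y"] y norm_triangle_ineq4[of "n (\<i> * of_real y)" "\<integral>t. 1 / (of_real t - \<i> * of_real y) \<partial>\<sigma>"] by simp
      also have "\<dots> \<le> cmod (n (\<i> * of_real y)) + T / y"
        using \<sigma>.cauchy_transform_bound[of "\<i> * of_real y"] y by (simp add: T_def)
      finally have "y * cmod \<beta> \<le> y * (cmod (n (\<i> * of_real y)) + T / y)" using y by (intro mult_left_mono) auto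
      then show ?thesis using Y(2)[OF that] y by (simp add: distrib_left)
    qed
    have "filterlim (\<lambda>y. y * cmod \<beta>) at_top at_top" using b zero_less_norm_iff[of \<beta>] by real_asymp
    then have "\<forall>\<^sub>F y in at_top. y * cmod \<beta> > C + T" by (simp add: filterlim_at_top_dense)
    then have "\<forall>\<^sub>F y::real in at_top. False"
      using eventually_ge_at_top[of Y] by eventually_elim (use * in fastforce)
    then show False by simp
  qed
  have "n z = (\<integral>t. 1 / (of_real t - z) \<partial>\<sigma>)" if z: "z \<in> nonreal" for z
  proof (cases "Im z > 0")
    case True
    then show ?thesis using nsig \<open>\<beta> = 0\<close> by simp
  next
    case False
    then have "Im z < 0" using z by auto
    then have "n z = cnj (n (cnj z))" "Im (cnj z) > 0" using n by (auto simp: nevanlinna_def)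
    then have "n z = cnj (\<integral>t. 1 / (of_real t - cnj z) \<partial>\<sigma>)" using nsig \<open>\<beta> = 0\<close> by simp
    also have "\<dots> = (\<integral>t. cnj (1 / (of_real t - cnj z)) \<partial>\<sigma>)" by (rule Bochner_Integration.integral_cnj[symmetric])
    finally show ?thesis by simp
  qed
  then have "cauchy_represents \<sigma> n" unfolding cauchy_represents_def by (intro conjI \<sigma>f \<sigma>s ballI)
  then show ?thesis by (rule exI)
qed

section \<open>Moments\<close>

lemma inverse_imaginary_tendsto_0: "((\<lambda>y::real. inverse (\<i> * of_real y)) \<longlongrightarrow> 0) at_infinity"
proof -
  have "filterlim (\<lambda>y::real. norm (\<i> * of_real y)) at_top at_infinity"
    using filterlim_at_infinity_imp_norm_at_top[OF filterlim_ident[of "at_infinity :: real filter"]] by (simp add: norm_mult)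
  then show ?thesis
    by (intro filterlim_compose[OF tendsto_inverse_0] filterlim_norm_at_top_imp_at_infinity)
qed

text \<open>What the stronger expansions add, including the term with \<open>s (2 * p + 1)\<close>,
  has order \<open>z^(-2p-2)\<close> and is absorbed by \<open>o(z^(-2p-1))\<close>. Hence all three
  cases reduce to the first.\<close>

lemma property_imp_property1:
  assumes "property1 p n s \<or> property2 p n s \<or> property3 p n s"
  shows "property1 p n s"
proof -
  have a: "(\<lambda>y::real. 1 / (\<i> * of_real y) ^ (2 * p + 2)) \<in> o[at_infinity](\<lambda>y. 1 / (\<i> * of_real y) ^ (2 * p + 1))"
  proof (rule smalloI_tendsto)
    note inverse_imaginary_tendsto_0
    moreover have "\<forall>\<^sub>F y::real in at_infinity. inverse (\<i> * of_real y) = 1 / (\<i> * of_real y) ^ (2 * p + 2) / (1 / (\<i> * of_real y) ^ (2 * p + 1))"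
      using eventually_not_equal_at_infinity[of 0] by eventually_elim (simp add: field_simps)
    ultimately show "((\<lambda>y::real. 1 / (\<i> * of_real y) ^ (2 * p + 2) / (1 / (\<i> * of_real y) ^ (2 * p + 1))) \<longlongrightarrow> 0) at_infinity"
      by (rule Lim_transform_eventually)
    show "\<forall>\<^sub>F y::real in at_infinity. 1 / (\<i> * of_real y) ^ (2 * p + 1) \<noteq> 0"
      using eventually_not_equal_at_infinity[of 0] by eventually_elim simp
  qed
  consider "property1 p n s" | "property2 p n s" | "property3 p n s" using assms by blast
  then show ?thesis
  proof cases
    case 2
    then show ?thesis unfolding property1_def property2_def using a landau_o.big_small_trans by blast
  next
    case 3
    then have "expansion_remainder n s (2 * p + 1) \<in> o[at_infinity](\<lambda>y. 1 / (\<i> * of_real y) ^ (2 * p + 1))"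
      unfolding property3_def using a landau_o.small_trans by blast
    moreover have "(\<lambda>y. of_real (s (2 * p + 1)) * (1 / (\<i> * of_real y) ^ (2 * p + 2))) \<in> o[at_infinity](\<lambda>y. 1 / (\<i> * of_real y) ^ (2 * p + 1))"
    proof (cases "s (2 * p + 1) = 0")
      case False
      then show ?thesis using a by (subst landau_o.small.cmult_in_iff) simp_all
    qed simp
    ultimately have "(\<lambda>y. expansion_remainder n s (2 * p + 1) y - of_real (s (2 * p + 1)) * (1 / (\<i> * of_real y) ^ (2 * p + 2))) \<in> o[at_infinity](\<lambda>y. 1 / (\<i> * of_real y) ^ (2 * p + 1))"
      by (rule sum_in_smallo(2))
    moreover have "expansion_remainder n s (2 * p + 1) y - of_real (s (2 * p + 1)) * (1 / (\<i> * of_real y) ^ (2 * p + 2)) = expansion_remainder n s (2 * p) y" for y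
      by (simp add: expansion_remainder_def)
    ultimately show ?thesis unfolding property1_def by simp
  qed
qed

text \<open>The remainder truncated just before a coefficient isolates that coefficient. By
  \<open>?G N y = ?G (N + 1) y / (\<i> * y) - s N\<close>, convergence of one truncation settles the
  next lower one, so the argument descends from \<open>2 * p\<close>.\<close>

lemma asymptotic_coefficient:
  assumes "property1 p n s" "N \<le> 2 * p"
  shows "((\<lambda>y. (\<i> * of_real y) ^ (N + 1) * (n (\<i> * of_real y) + (\<Sum>k<N. of_real (s k) / (\<i> * of_real y) ^ (k + 1)))) \<longlongrightarrow> - of_real (s N)) at_top"
    (is "(?G N \<longlongrightarrow> _) _")
proof -
  have ev: "\<forall>\<^sub>F y::real in at_top. y > 0" by (rule eventually_gt_at_top)
  have step: "?G N y = ?G (N + 1) y / (\<i> * of_real y) - of_real (s N)" if "y > 0" for N y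
    using that by (simp add: field_simps)
  have inv: "((\<lambda>y::real. inverse (\<i> * of_real y)) \<longlongrightarrow> 0) at_top"
    by (rule filterlim_mono[OF inverse_imaginary_tendsto_0 order_refl at_top_le_at_infinity])
  have conc: "(?G N \<longlongrightarrow> - of_real (s N)) at_top"
    if "((\<lambda>y. ?G (N + 1) y / (\<i> * of_real y)) \<longlongrightarrow> 0) at_top" for N
  proof -
    have "((\<lambda>y. ?G (N + 1) y / (\<i> * of_real y) - of_real (s N)) \<longlongrightarrow> 0 - of_real (s N)) at_top"
      by (intro tendsto_diff tendsto_const that)
    moreover have "\<forall>\<^sub>F y in at_top. ?G (N + 1) y / (\<i> * of_real y) - of_real (s N) = ?G N y"
      using ev by eventually_elim (use step in auto)
    ultimately have "(?G N \<longlongrightarrow> 0 - of_real (s N)) at_top" by (rule Lim_transform_eventually)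
    then show ?thesis by simp
  qed
  \<comment> \<open>The induction carries the decay of this quotient rather than a limit of
    \<open>?G (N + 1)\<close>: at the top, \<open>N = 2 * p\<close>, the hypothesis provides only a
    little-o.\<close>
  have "((\<lambda>y. ?G (N + 1) y / (\<i> * of_real y)) \<longlongrightarrow> 0) at_top" using assms(2)
  proof (induction N rule: inc_induct)
    case base
    have "((\<lambda>y. expansion_remainder n s (2 * p) y / (1 / (\<i> * of_real y) ^ (2 * p + 1))) \<longlongrightarrow> 0) at_infinity"
      using assms(1) unfolding property1_def by (rule smalloD_tendsto)
    then have "((\<lambda>y. expansion_remainder n s (2 * p) y / (1 / (\<i> * of_real y) ^ (2 * p + 1))) \<longlongrightarrow> 0) at_top"
      by (rule filterlim_mono[OF _ order_refl at_top_le_at_infinity])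
    then show ?case
    proof (rule Lim_transform_eventually)
      show "\<forall>\<^sub>F y in at_top. expansion_remainder n s (2 * p) y / (1 / (\<i> * of_real y) ^ (2 * p + 1)) = ?G (2 * p + 1) y / (\<i> * of_real y)"
        using ev
      proof eventually_elim
        case (elim y)
        have "(\<Sum>k\<le>2*p. complex_of_real (s k) / (\<i> * of_real y) ^ (k + 1)) = (\<Sum>k<2*p+1. of_real (s k) / (\<i> * of_real y) ^ (k + 1))"
          by (rule sum.cong) auto
        then show ?case using elim by (simp add: expansion_remainder_def mult_ac)
      qed
    qed
  next
    case (step N)
    have "(?G (Suc N) \<longlongrightarrow> - of_real (s (Suc N))) at_top" by (rule conc) (use step in simp)
    from tendsto_mult[OF this inv] show ?case by (simp add: divide_inverse)
  qed
  then show ?thesis by (rule conc)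
qed

text \<open>Pointwise this is a finite geometric sum. Division by \<open>t - z\<close> gains one
  power of \<open>t\<close>, which is why moments of order below \<open>N\<close> suffice for an
  integrand containing \<open>t ^ N\<close>.\<close>

lemma (in finite_borel_measure) cauchy_transform_expansion:
  assumes z: "Im z \<noteq> 0" and int: "\<And>k. k < N \<Longrightarrow> integrable M (\<lambda>t. t ^ k)"
  shows "integrable M (\<lambda>t. of_real (t ^ N) / (of_real t - z))"
    and "z ^ N * ((\<integral>t. 1 / (of_real t - z) \<partial>M) + (\<Sum>k<N. of_real (\<integral>t. t ^ k \<partial>M) / z ^ (k + 1))) =
         (\<integral>t. of_real (t ^ N) / (of_real t - z) \<partial>M)"
proof -
  have z0: "z \<noteq> 0" using z by auto
  have tz: "complex_of_real t - z \<noteq> 0" for t by (rule nonreal_neq_of_real[OF z])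
  have eq: "of_real (t ^ N) / (of_real t - z) = z ^ N * (1 / (of_real t - z) + (\<Sum>k<N. of_real (t ^ k) / z ^ (k + 1)))" for t
  proof (induction N)
    case (Suc N)
    have "complex_of_real (t ^ Suc N) / (of_real t - z) = of_real (t ^ N) + z * (of_real (t ^ N) / (of_real t - z))"
      using tz[of t] by (simp add: field_simps)
    also have "\<dots> = z ^ Suc N * (1 / (of_real t - z) + (\<Sum>k<Suc N. of_real (t ^ k) / z ^ (k + 1)))"
      unfolding Suc using z0 by (simp add: algebra_simps)
    finally show ?case .
  qed simp
  have term_int: "integrable M (\<lambda>t. complex_of_real (t ^ k) / z ^ (k + 1))" if "k < N" for k
    by (intro integrable_divide integrable_of_real int that)
  show "integrable M (\<lambda>t. of_real (t ^ N) / (of_real t - z))"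
    unfolding eq using integrable_cauchy_kernel[OF z]
    by (intro integrable_mult_right Bochner_Integration.integrable_add Bochner_Integration.integrable_sum term_int) auto
  have "(\<integral>t. of_real (t ^ N) / (of_real t - z) \<partial>M) = z ^ N * (\<integral>t. 1 / (of_real t - z) + (\<Sum>k<N. of_real (t ^ k) / z ^ (k + 1)) \<partial>M)"
    unfolding eq by (rule integral_mult_right_zero)
  also have "(\<integral>t. 1 / (of_real t - z) + (\<Sum>k<N. of_real (t ^ k) / z ^ (k + 1)) \<partial>M) =
      (\<integral>t. 1 / (of_real t - z) \<partial>M) + (\<integral>t. (\<Sum>k<N. of_real (t ^ k) / z ^ (k + 1)) \<partial>M)"
    by (intro Bochner_Integration.integral_add integrable_cauchy_kernel[OF z] Bochner_Integration.integrable_sum term_int) auto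
  also have "(\<integral>t. (\<Sum>k<N. complex_of_real (t ^ k) / z ^ (k + 1)) \<partial>M) = (\<Sum>k<N. (\<integral>t. complex_of_real (t ^ k) / z ^ (k + 1) \<partial>M))"
    by (intro Bochner_Integration.integral_sum term_int) auto
  also have "(\<Sum>k<N. (\<integral>t. complex_of_real (t ^ k) / z ^ (k + 1) \<partial>M)) = (\<Sum>k<N. of_real (\<integral>t. t ^ k \<partial>M) / z ^ (k + 1))"
    by (intro sum.cong refl) (simp del: of_real_power)
  finally show "z ^ N * ((\<integral>t. 1 / (of_real t - z) \<partial>M) + (\<Sum>k<N. of_real (\<integral>t. t ^ k \<partial>M) / z ^ (k + 1))) =
         (\<integral>t. of_real (t ^ N) / (of_real t - z) \<partial>M)" by simp
qed

text \<open>The cut-off comes from the real and imaginary parts of the Cauchy kernel on the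
  imaginary axis; being bounded by 1, it permits limits under the integral.\<close>

lemma damped_limit: "(\<lambda>j. x * ((real j + 1)\<^sup>2 / (t\<^sup>2 + (real j + 1)\<^sup>2))) \<longlonglongrightarrow> (x::real)"
proof -
  have "(\<lambda>j. x * ((real j + 1)\<^sup>2 / (t\<^sup>2 + (real j + 1)\<^sup>2))) \<longlonglongrightarrow> x * 1"
    by (intro tendsto_mult tendsto_const) real_asymp
  then show ?thesis by simp
qed

lemma damping_le_1: "\<bar>(y::real)\<^sup>2 / (t\<^sup>2 + y\<^sup>2)\<bar> \<le> 1"
  by (cases "y = 0") (auto simp: divide_le_eq add_pos_nonneg add_nonneg_pos sum_power2_gt_zero_iff)

lemma integrable_power_le:
  fixes M :: "real measure"
  assumes "finite_measure M" "sets M = sets borel" "integrable M (\<lambda>t. t ^ (2 * j))" "k \<le> 2 * j"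
  shows "integrable M (\<lambda>t. t ^ k)"
proof -
  interpret finite_borel_measure M using assms by (simp add: finite_borel_measure_def finite_borel_measure_axioms_def)
  show ?thesis
  proof (rule Bochner_Integration.integrable_bound[where f = "\<lambda>t. 1 + t ^ (2 * j)"])
    show "integrable M (\<lambda>t. 1 + t ^ (2 * j))" using assms by simp
    have "\<bar>t ^ k\<bar> \<le> 1 + t ^ (2 * j)" for t :: real
    proof (cases "\<bar>t\<bar> \<le> 1")
      case True
      then have "\<bar>t ^ k\<bar> \<le> 1" by (simp add: power_abs power_le_one)
      moreover have "0 \<le> t ^ (2 * j)" by (simp add: power_mult)
      ultimately show ?thesis by linarith
    next
      case False
      then have "\<bar>t\<bar> ^ k \<le> \<bar>t\<bar> ^ (2 * j)" using assms(4) by (intro power_increasing) auto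
      then show ?thesis by (simp add: power_abs power_even_abs)
    qed
    then show "AE t in M. norm (t ^ k) \<le> norm (1 + t ^ (2 * j))" by (intro AE_I2) (simp add: order_trans[OF _ abs_ge_self])
  qed simp
qed

text \<open>Two orders are gained per round. For odd \<open>N\<close> the imaginary part of
  \<open>G N\<close> is an integral of \<open>t ^ (N + 1)\<close> against a positive cut-off, and
  the expansion keeps it bounded after rescaling. As \<open>N + 1\<close> is even, Fatou makes
  \<open>t ^ (N + 1)\<close> integrable; \<open>t ^ N\<close> follows, and dominated convergence
  identifies both moments.\<close>

lemma moments_of_expansion:
  assumes rep: "cauchy_represents \<sigma> n" and asy: "property1 p n s" and k: "k \<le> 2 * p"
  shows "integrable \<sigma> (\<lambda>t. t ^ k) \<and> (\<integral>t. t ^ k \<partial>\<sigma>) = s k"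
proof -
  interpret finite_borel_measure \<sigma>
    using rep by (simp add: cauchy_represents_def finite_borel_measure_def finite_borel_measure_axioms_def)
  have n: "n z = (\<integral>t. 1 / (of_real t - z) \<partial>\<sigma>)" if "Im z \<noteq> 0" for z
    using rep that by (simp add: cauchy_represents_def)
  \<comment> \<open>The bound is strict: \<open>good N\<close> provides exactly what
    \<open>cauchy_transform_expansion\<close> requires at order \<open>N\<close>.\<close>
  define good where "good = (\<lambda>N. \<forall>k<N. integrable \<sigma> (\<lambda>t. t ^ k) \<and> (\<integral>t. t ^ k \<partial>\<sigma>) = s k)"
  define z where "z = (\<lambda>j. \<i> * complex_of_real (real j + 1))"
  define G where "G = (\<lambda>N j. z j * (\<integral>t. of_real (t ^ N) / (of_real t - z j) \<partial>\<sigma>))"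
  define Q where "Q = (\<lambda>j t. (real j + 1)\<^sup>2 / (t\<^sup>2 + (real j + 1)\<^sup>2))"
  have Im: "Im (z j) = real j + 1" "Im (z j) \<noteq> 0" "z j \<noteq> 0" for j by (simp_all add: z_def complex_eq_iff)
  have fl: "filterlim (\<lambda>j. real j + 1) at_top sequentially" by real_asymp
  have Glim: "G N \<longlonglongrightarrow> - of_real (s N)" if "good N" "N \<le> 2 * p" for N
  proof -
    have "(\<lambda>j. z j ^ (N + 1) * (n (z j) + (\<Sum>k<N. of_real (s k) / z j ^ (k + 1)))) \<longlonglongrightarrow> - of_real (s N)"
      unfolding z_def by (rule filterlim_compose[OF asymptotic_coefficient[OF asy that(2)] fl])
    moreover have "z j ^ (N + 1) * (n (z j) + (\<Sum>k<N. of_real (s k) / z j ^ (k + 1))) = G N j" for j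
      unfolding G_def using that(1) cauchy_transform_expansion(2)[OF Im(2), of N] by (simp add: n[OF Im(2)] good_def mult.assoc)
    ultimately show ?thesis by simp
  qed
  \<comment> \<open>With \<open>y = real j + 1\<close>, the number
    \<open>\<i> * y / (t - \<i> * y)\<close> has real part \<open>- Q j t\<close> and imaginary part
    \<open>t / y * Q j t\<close>, so one transform controls two consecutive powers of
    \<open>t\<close>.\<close>
  have ker: "z j * (of_real x / (of_real t - z j)) = of_real (- x * Q j t) + \<i> * of_real (x * t / (real j + 1) * Q j t)" for x t j
  proof -
    define y where "y = real j + 1"
    have y: "y > 0" by (simp add: y_def)
    have "complex_of_real (t\<^sup>2 + y\<^sup>2) = (of_real t - \<i> * y) * (of_real t + \<i> * y)"
      by (simp add: power2_eq_square algebra_simps)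
    moreover have "t\<^sup>2 + y\<^sup>2 \<noteq> 0" using y by (simp add: sum_power2_eq_zero_iff)
    moreover have "complex_of_real t - \<i> * y \<noteq> 0" using y by (auto simp: complex_eq_iff)
    ultimately show ?thesis unfolding Q_def z_def y_def[symmetric] using y
      by (simp add: complex_eq_iff Re_divide Im_divide) (simp add: power2_eq_square divide_simps)
  qed
  have Ker_int: "integrable \<sigma> (\<lambda>t. z j * (of_real (t ^ N) / (of_real t - z j)))" if "good N" for N j
    using that by (intro integrable_mult_right cauchy_transform_expansion(1)[OF Im(2)]) (auto simp: good_def)
  have Qint: "integrable \<sigma> (\<lambda>t. t ^ N * Q j t)" "(\<integral>t. t ^ N * Q j t \<partial>\<sigma>) = - Re (G N j)"
             "integrable \<sigma> (\<lambda>t. t ^ (N + 1) * Q j t)" "(\<integral>t. t ^ (N + 1) * Q j t \<partial>\<sigma>) = (real j + 1) * Im (G N j)"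
    if "good N" for N j
  proof -
    have G: "G N j = (\<integral>t. z j * (of_real (t ^ N) / (of_real t - z j)) \<partial>\<sigma>)"
      unfolding G_def by (rule integral_mult_right_zero[symmetric])
    have 1: "t ^ N * Q j t = - Re (z j * (of_real (t ^ N) / (of_real t - z j)))" for t unfolding ker by simp
    have 2: "t ^ (N + 1) * Q j t = (real j + 1) * Im (z j * (of_real (t ^ N) / (of_real t - z j)))" for t
      unfolding ker by (simp add: field_simps)
    note I = Ker_int[OF that, of j]
    show "integrable \<sigma> (\<lambda>t. t ^ N * Q j t)" unfolding 1 by (intro Bochner_Integration.integrable_minus integrable_Re I)
    show "(\<integral>t. t ^ N * Q j t \<partial>\<sigma>) = - Re (G N j)" unfolding 1 G using I by (simp add: integral_Re)
    show "integrable \<sigma> (\<lambda>t. t ^ (N + 1) * Q j t)" unfolding 2 by (intro integrable_mult_right integrable_Im I)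
    show "(\<integral>t. t ^ (N + 1) * Q j t \<partial>\<sigma>) = (real j + 1) * Im (G N j)" unfolding 2 G using I by (simp add: integral_Im)
  qed
  have adv: "good (N + 1)" if g: "good N" and N: "N \<le> 2 * p" and i: "integrable \<sigma> (\<lambda>t. t ^ N)" for N
  proof -
    have "(\<lambda>j. \<integral>t. t ^ N * Q j t \<partial>\<sigma>) \<longlonglongrightarrow> (\<integral>t. t ^ N \<partial>\<sigma>)"
    proof (rule integral_dominated_convergence[where w = "\<lambda>t. \<bar>t ^ N\<bar>"])
      show "AE t in \<sigma>. norm (t ^ N * Q j t) \<le> \<bar>t ^ N\<bar>" for j
        by (intro AE_I2) (simp only: Q_def real_norm_def abs_mult mult_left_le[OF damping_le_1 abs_ge_zero])
    qed (use damped_limit i in \<open>auto simp: Q_def\<close>)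
    moreover have "(\<lambda>j. \<integral>t. t ^ N * Q j t \<partial>\<sigma>) \<longlonglongrightarrow> s N"
      unfolding Qint[OF g] using tendsto_minus[OF tendsto_Re[OF Glim[OF g N]]] by simp
    ultimately have "(\<integral>t. t ^ N \<partial>\<sigma>) = s N" by (rule LIMSEQ_unique)
    then show ?thesis using g i by (auto simp: good_def less_Suc_eq)
  qed
  have good: "j \<le> p \<Longrightarrow> good (2 * j + 1)" for j
  proof (induction j)
    case 0
    show ?case using adv[of 0] by (simp add: good_def)
  next
    case (Suc j)
    define N where "N = 2 * j + 1"
    have g: "good N" using Suc by (simp add: N_def)
    have N: "N + 1 \<le> 2 * p" using Suc by (simp add: N_def)
    have N1: "N + 1 = 2 * (j + 1)" by (simp add: N_def)
    \<comment> \<open>Adding the real number \<open>s N\<close> leaves the imaginary part alone but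
      completes the truncation before order \<open>N + 1\<close>, whose limit is known.\<close>
    have step: "(real i + 1) * Im (G N i) = - Re (z i * (G N i + of_real (s N)))" for i by (simp add: z_def)
    have "(\<lambda>i. z i ^ (N + 2) * (n (z i) + (\<Sum>k<N+1. of_real (s k) / z i ^ (k + 1)))) \<longlonglongrightarrow> - of_real (s (N + 1))"
      unfolding z_def using filterlim_compose[OF asymptotic_coefficient[OF asy N] fl] by (simp add: numeral_2_eq_2)
    moreover have G_eq: "z i ^ (N + 2) * (n (z i) + (\<Sum>k<N+1. of_real (s k) / z i ^ (k + 1))) = z i * (G N i + of_real (s N))" for i
    proof -
      have "G N i = z i * (z i ^ N * (n (z i) + (\<Sum>k<N. of_real (s k) / z i ^ (k + 1))))"
        unfolding G_def using g cauchy_transform_expansion(2)[OF Im(2), of N] by (simp add: n[OF Im(2)] good_def)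
      then show ?thesis using Im(3)[of i] by (simp add: field_simps)
    qed
    ultimately have "(\<lambda>i. z i * (G N i + of_real (s N))) \<longlonglongrightarrow> - of_real (s (N + 1))"
      by (simp only: G_eq)
    then have "(\<lambda>i. - Re (z i * (G N i + of_real (s N)))) \<longlonglongrightarrow> - Re (- of_real (s (N + 1)))"
      by (intro tendsto_minus tendsto_Re)
    then have "(\<lambda>i. \<integral>t. t ^ (N + 1) * Q i t \<partial>\<sigma>) \<longlonglongrightarrow> s (N + 1)"
      unfolding Qint(4)[OF g] step by simp
    then have "\<forall>\<^sub>F i in sequentially. (\<integral>t. t ^ (N + 1) * Q i t \<partial>\<sigma>) < s (N + 1) + 1"
      by (rule order_tendstoD(2)) simp
    then have ev: "\<forall>\<^sub>F i in sequentially. (\<integral>t. t ^ (N + 1) * Q i t \<partial>\<sigma>) \<le> s (N + 1) + 1"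
      by eventually_elim (rule less_imp_le)
    have pos: "0 \<le> t ^ (N + 1) * Q i t" for t i unfolding N1 power_mult Q_def by simp
    have I: "integrable \<sigma> (\<lambda>t. t ^ (N + 1))"
    proof (rule fatou_integrable(1)[OF Qint(3)[OF g] _ _ _ ev])
      show "(\<lambda>t. t ^ (N + 1)) \<in> borel_measurable \<sigma>" by measurable
      show "AE t in \<sigma>. 0 \<le> t ^ (N + 1) * Q i t" for i by (intro AE_I2 pos)
      show "AE t in \<sigma>. (\<lambda>i. t ^ (N + 1) * Q i t) \<longlonglongrightarrow> t ^ (N + 1)"
        unfolding Q_def by (intro AE_I2 damped_limit)
    qed
    have "integrable \<sigma> (\<lambda>t. t ^ N)"
      by (rule integrable_power_le[OF finite_measure_axioms M_is_borel I[unfolded N1]]) (simp add: N_def)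
    then have "good (N + 1)" using adv[OF g] N by simp
    then have "good (N + 2)" using adv[OF _ _ I] N by simp
    then show ?case by (simp add: N_def)
  qed
  show ?thesis using good[of p] k by (auto simp: good_def)
qed

lemma bounded_along_imaginary_axis:
  assumes "property1 p n s"
  shows "\<forall>\<^sub>F y in at_top. y * cmod (n (\<i> * of_real y)) \<le> \<bar>s 0\<bar> + 1"
proof -
  have "((\<lambda>y. cmod (\<i> * of_real y * n (\<i> * of_real y))) \<longlongrightarrow> cmod (- of_real (s 0))) at_top"
    using asymptotic_coefficient[OF assms, of 0] by (intro tendsto_norm) simp
  then have "\<forall>\<^sub>F y in at_top. cmod (\<i> * of_real y * n (\<i> * of_real y)) < \<bar>s 0\<bar> + 1"
    by (rule order_tendstoD(2)) simp
  then show ?thesis using eventually_gt_at_top[of 0] by eventually_elim (simp add: norm_mult)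
qed

section \<open>Gram--Schmidt polynomials\<close>

lemma integrable_poly:
  fixes M :: "real measure"
  assumes "\<And>k. k \<le> N \<Longrightarrow> integrable M (\<lambda>t. t ^ k)" "degree q \<le> N"
  shows "integrable M (poly q)"
proof -
  have "poly q = (\<lambda>t. \<Sum>i\<le>degree q. coeff q i * t ^ i)" by (simp add: poly_altdef fun_eq_iff)
  then show ?thesis using assms by auto
qed

text \<open>The vector before normalisation, local to \<open>first_kind\<close>. It has degree
  \<open>k\<close> even where \<open>first_kind\<close> collapses to 0.\<close>

definition gs_residual :: "real measure \<Rightarrow> nat \<Rightarrow> real poly" where
  "gs_residual \<sigma> k = Polynomial.monom 1 k -
     (\<Sum>i<k. Polynomial.smult (\<integral>t. t ^ k * poly (first_kind \<sigma> i) t \<partial>\<sigma>) (first_kind \<sigma> i))"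

lemma first_kind_residual:
  "first_kind \<sigma> k = Polynomial.smult (1 / sqrt (\<integral>t. (poly (gs_residual \<sigma> k) t)\<^sup>2 \<partial>\<sigma>)) (gs_residual \<sigma> k)"
  unfolding gs_residual_def by (subst first_kind.simps) (simp add: Let_def)

text \<open>Earlier polynomials have degree below \<open>k\<close> and cannot touch the leading
  monomial. For \<open>first_kind\<close> only an upper bound holds at this stage: a residual of
  norm 0 is scaled to 0 by the convention \<open>1 / 0 = 0\<close>.\<close>

lemma degree_gs_residual: "degree (gs_residual \<sigma> k) = k" and degree_first_kind_le: "degree (first_kind \<sigma> k) \<le> k"
proof (induction k rule: less_induct)
  case (less k)
  have sm: "degree (\<Sum>i<k. Polynomial.smult (c i) (first_kind \<sigma> i)) \<le> k - 1" for c
    using less(2) by (intro degree_sum_le) (force intro: order_trans[OF degree_smult_le] order_trans)+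
  show 1: "degree (gs_residual \<sigma> k) = k"
  proof (cases k)
    case 0
    then show ?thesis by (simp add: gs_residual_def degree_monom_eq)
  next
    case (Suc j)
    have "degree (\<Sum>i<k. Polynomial.smult (\<integral>t. t ^ k * poly (first_kind \<sigma> i) t \<partial>\<sigma>) (first_kind \<sigma> i)) < degree (Polynomial.monom (1::real) k)"
      using sm[of "\<lambda>i. \<integral>t. t ^ k * poly (first_kind \<sigma> i) t \<partial>\<sigma>"] Suc by (simp add: degree_monom_eq)
    then show ?thesis unfolding gs_residual_def diff_conv_add_uminus
      by (subst degree_add_eq_left) (simp_all add: degree_monom_eq)
  qed
  then show "degree (first_kind \<sigma> k) \<le> k" unfolding first_kind_residual by (metis degree_smult_le)
qed

context
  fixes \<sigma> :: "real measure" and p :: nat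
  assumes moments: "\<And>k. k \<le> 2 * p \<Longrightarrow> integrable \<sigma> (\<lambda>t. t ^ k)"
begin

lemma integrable_poly_mult:
  assumes "degree q \<le> p" "degree r \<le> p"
  shows "integrable \<sigma> (\<lambda>t. poly q t * poly r t)"
proof -
  have "integrable \<sigma> (poly (q * r))"
    using degree_mult_le[of q r] assms by (intro integrable_poly[of "2 * p"] moments) auto
  moreover have "poly (q * r) = (\<lambda>t. poly q t * poly r t)" by auto
  ultimately show ?thesis by simp
qed

text \<open>Being nonzero certifies that the squared norm of the residual was not 0, so the division
  by its root was genuine.\<close>

lemma first_kind_norm:
  assumes "k \<le> p" "first_kind \<sigma> k \<noteq> 0"
  shows "(\<integral>t. poly (first_kind \<sigma> k) t * poly (first_kind \<sigma> k) t \<partial>\<sigma>) = 1" "degree (first_kind \<sigma> k) = k"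
proof -
  define I where "I = (\<integral>t. (poly (gs_residual \<sigma> k) t)\<^sup>2 \<partial>\<sigma>)"
  have e: "first_kind \<sigma> k = Polynomial.smult (1 / sqrt I) (gs_residual \<sigma> k)" unfolding I_def by (rule first_kind_residual)
  have "I \<ge> 0" unfolding I_def by (rule integral_nonneg_AE) simp
  then have I: "I > 0" using assms(2) e by (cases "I = 0") auto
  have "poly (first_kind \<sigma> k) t * poly (first_kind \<sigma> k) t = (1 / I) * (poly (gs_residual \<sigma> k) t)\<^sup>2" for t
    unfolding e using I by (simp add: power2_eq_square divide_simps)
  then show "(\<integral>t. poly (first_kind \<sigma> k) t * poly (first_kind \<sigma> k) t \<partial>\<sigma>) = 1"
    using I by (simp add: I_def)
  show "degree (first_kind \<sigma> k) = k" using I by (simp add: e degree_gs_residual)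
qed

lemma first_kind_orthonormal:
  assumes nz: "\<And>k. k \<le> p \<Longrightarrow> first_kind \<sigma> k \<noteq> 0" and i: "i \<le> p" and k: "k \<le> p"
  shows "(\<integral>t. poly (first_kind \<sigma> i) t * poly (first_kind \<sigma> k) t \<partial>\<sigma>) = (if i = k then 1 else 0)"
proof -
  let ?e = "first_kind \<sigma>"
  have int: "integrable \<sigma> (\<lambda>t. poly (?e i) t * poly (?e k) t)" if "i \<le> p" "k \<le> p" for i k
    using that degree_first_kind_le order_trans by (intro integrable_poly_mult) blast+
  \<comment> \<open>The induction runs on the larger index, so both orders of any two indices below
    \<open>k\<close> are available when the sum is collapsed.\<close>
  have orth: "(\<integral>t. poly (?e j) t * poly (?e k) t \<partial>\<sigma>) = 0" if "j < k" "k \<le> p" for j k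
    using that
  proof (induction k arbitrary: j rule: less_induct)
    case (less k)
    have int2: "integrable \<sigma> (\<lambda>t. t ^ k * poly (?e j) t)"
      using integrable_poly_mult[of "Polynomial.monom 1 k" "?e j"] less degree_first_kind_le[of \<sigma> j]
      by (simp add: poly_monom degree_monom_eq)
    define c where "c = (\<lambda>i. \<integral>t. t ^ k * poly (?e i) t \<partial>\<sigma>)"
    have "poly (?e j) t * poly (gs_residual \<sigma> k) t = t ^ k * poly (?e j) t - (\<Sum>i<k. c i * (poly (?e i) t * poly (?e j) t))" for t
      by (simp add: gs_residual_def c_def poly_monom poly_sum algebra_simps sum_distrib_left)
    then have "(\<integral>t. poly (?e j) t * poly (gs_residual \<sigma> k) t \<partial>\<sigma>) = c j - (\<Sum>i<k. c i * (\<integral>t. poly (?e i) t * poly (?e j) t \<partial>\<sigma>))"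
      using int2 int less.prems
      by (simp only:, subst Bochner_Integration.integral_diff)
         (auto simp: c_def intro!: Bochner_Integration.integrable_sum integrable_mult_right)
    also have "(\<Sum>i<k. c i * (\<integral>t. poly (?e i) t * poly (?e j) t \<partial>\<sigma>)) = (\<Sum>i<k. if i = j then c i else 0)"
    proof (rule sum.cong[OF refl])
      fix i assume i: "i \<in> {..<k}"
      consider "i < j" | "i = j" | "j < i" by linarith
      then show "c i * (\<integral>t. poly (?e i) t * poly (?e j) t \<partial>\<sigma>) = (if i = j then c i else 0)"
      proof cases
        case 1
        then show ?thesis using less.IH[of j i] less.prems by simp
      next
        case 2
        then show ?thesis using first_kind_norm(1)[of j] nz less.prems by simp
      next
        case 3
        then have "(\<integral>t. poly (?e j) t * poly (?e i) t \<partial>\<sigma>) = 0" using less.IH[of i j] less.prems i by simp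
        then show ?thesis using 3 by (simp add: mult.commute)
      qed
    qed
    also have "\<dots> = c j" using less.prems by simp
    finally have "(\<integral>t. poly (?e j) t * poly (gs_residual \<sigma> k) t \<partial>\<sigma>) = 0" by simp
    then show ?case unfolding first_kind_residual[of \<sigma> k] by (simp add: mult.left_commute)
  qed
  consider "i < k" | "i = k" | "k < i" by linarith
  then show ?thesis
  proof cases
    case 3
    then have "(\<integral>t. poly (?e k) t * poly (?e i) t \<partial>\<sigma>) = 0" using orth i by simp
    then show ?thesis using 3 by (simp add: mult.commute)
  qed (use orth k first_kind_norm(1) nz in auto)
qed

text \<open>If the polynomial of index \<open>k + 1\<close> vanished, the recurrence would express
  \<open>t * e k\<close>, of degree \<open>k + 1\<close>, by polynomials of degree at most
  \<open>k\<close>. The start is a constant, normalised by the total mass.\<close>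

lemma first_kind_nonzero:
  assumes rec: "recurrence_coeffs (first_kind \<sigma>) p a b" and pos: "measure \<sigma> (space \<sigma>) > 0" and k: "k \<le> p"
  shows "first_kind \<sigma> k \<noteq> 0"
  using k
proof (induction k)
  case 0
  have "gs_residual \<sigma> 0 = 1" by (simp add: gs_residual_def one_pCons monom_0)
  then have "first_kind \<sigma> 0 = Polynomial.smult (1 / sqrt (measure \<sigma> (space \<sigma>))) 1"
    unfolding first_kind_residual by simp
  then show ?case using pos by simp
next
  case (Suc k)
  have deg: "degree (first_kind \<sigma> k) = k" using first_kind_norm(2) Suc by simp
  show ?case
  proof
    assume "first_kind \<sigma> (Suc k) = 0"
    then have eq: "[:0, 1:] * first_kind \<sigma> k = (if k = 0 then 0 else Polynomial.smult (b (k - 1)) (first_kind \<sigma> (k - 1)))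
          + Polynomial.smult (a k) (first_kind \<sigma> k)"
      using rec Suc.prems unfolding recurrence_coeffs_def by auto
    have "degree ([:0, 1:] * first_kind \<sigma> k) = Suc k"
      using Suc deg by (subst degree_mult_eq) auto
    moreover have "degree ((if k = 0 then 0 else Polynomial.smult (b (k - 1)) (first_kind \<sigma> (k - 1)))
          + Polynomial.smult (a k) (first_kind \<sigma> k)) \<le> k"
      using order_trans[OF degree_smult_le degree_first_kind_le[of \<sigma> "k - 1"], of "b (k - 1)"]
        order_trans[OF degree_smult_le degree_first_kind_le[of \<sigma> k], of "a k"]
      by (intro degree_add_le) auto
    ultimately show False unfolding eq by simp
  qed
qed

end

text \<open>Without mass all moments vanish, and the Hankel matrix is a zero matrix of positive size
  \<open>p + 1\<close>.\<close>

lemma total_mass_pos: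
  assumes "hankel_det s p \<noteq> 0" and mom: "\<And>k. k \<le> 2 * p \<Longrightarrow> (\<integral>t. t ^ k \<partial>\<sigma>) = s k"
    and "finite_measure \<sigma>"
  shows "measure \<sigma> (space \<sigma>) > 0"
proof (rule ccontr)
  assume "\<not> measure \<sigma> (space \<sigma>) > 0"
  then have "measure \<sigma> (space \<sigma>) = 0" using zero_less_measure_iff by blast
  then have 0: "emeasure \<sigma> (space \<sigma>) = 0"
    using assms(3) by (simp add: finite_measure.emeasure_eq_measure)
  have "(\<integral>t. t ^ k \<partial>\<sigma>) = 0" for k
    by (intro integral_eq_zero_AE AE_I[of _ _ "space \<sigma>"]) (use 0 in auto)
  then have s: "s k = 0" if "k \<le> 2 * p" for k using mom[OF that] by simp
  have "mat (p + 1) (p + 1) (\<lambda>(i, l). s (i + l)) = 0\<^sub>m (p + 1) (p + 1)"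
    by (intro eq_matI) (auto simp: s)
  then have "hankel_det s p = Determinant.det (0\<^sub>m (p + 1) (p + 1) :: real mat)"
    unfolding hankel_det_def by simp
  also have "\<dots> = 0" by (subst det_zero) auto
  finally show False using assms(1) by simp
qed

section \<open>The space \<open>\<L>(m)\<close> of a Cauchy transform\<close>

context finite_borel_measure
begin

text \<open>Functions, not classes modulo null sets: equality here is meant almost everywhere and
  becomes honest equality only after the Cauchy transform.\<close>

definition L2 :: "(real \<Rightarrow> complex) set" where
  "L2 = {f \<in> borel_measurable M. integrable M (\<lambda>t. (cmod (f t))\<^sup>2)}"

definition l2_ip :: "(real \<Rightarrow> complex) \<Rightarrow> (real \<Rightarrow> complex) \<Rightarrow> complex" where
  "l2_ip f g = (\<integral>t. f t * cnj (g t) \<partial>M)"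

definition cauchy_tr :: "(real \<Rightarrow> complex) \<Rightarrow> complex \<Rightarrow> complex" where
  "cauchy_tr f z = (\<integral>t. f t / (of_real t - z) \<partial>M)"

lemma L2_meas [measurable_dest]: "f \<in> L2 \<Longrightarrow> f \<in> borel_measurable M"
  by (simp add: L2_def)

lemma L2_sq: "f \<in> L2 \<Longrightarrow> integrable M (\<lambda>t. (cmod (f t))\<^sup>2)"
  by (simp add: L2_def)

lemma L2_I: "f \<in> borel_measurable M \<Longrightarrow> integrable M (\<lambda>t. (cmod (f t))\<^sup>2) \<Longrightarrow> f \<in> L2"
  by (simp add: L2_def)

lemma L2_bounded:
  assumes "f \<in> borel_measurable M" "\<And>t. cmod (f t) \<le> B"
  shows "f \<in> L2"
proof (rule L2_I[OF assms(1)], rule integrable_const_bound[where B = "B\<^sup>2"])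
  show "AE t in M. norm ((cmod (f t))\<^sup>2) \<le> B\<^sup>2" using assms(2) by (simp add: power_mono)
qed (use assms in measurable)

lemma L2_mult_integrable:
  assumes f: "f \<in> L2" and g: "g \<in> L2"
  shows "integrable M (\<lambda>t. f t * cnj (g t))"
proof (rule Bochner_Integration.integrable_bound[where f = "\<lambda>t. (cmod (f t))\<^sup>2 + (cmod (g t))\<^sup>2"])
  show "integrable M (\<lambda>t. (cmod (f t))\<^sup>2 + (cmod (g t))\<^sup>2)" using f g by (simp add: L2_sq)
  show "(\<lambda>t. f t * cnj (g t)) \<in> borel_measurable M"
    using L2_meas[OF f] L2_meas[OF g] by (intro borel_measurable_times) (auto intro: measurable_compose[OF _ borel_measurable_continuous_onI[OF continuous_on_cnj[OF continuous_on_id]]])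
  have "x * y \<le> x\<^sup>2 + y\<^sup>2" if "x \<ge> 0" "y \<ge> 0" for x y :: real
    using sum_squares_bound[of x y] mult_nonneg_nonneg[OF that] by linarith
  then show "AE t in M. norm (f t * cnj (g t)) \<le> norm ((cmod (f t))\<^sup>2 + (cmod (g t))\<^sup>2)"
    by (intro AE_I2) (simp add: norm_mult)
qed

lemma L2_add: assumes f: "f \<in> L2" and g: "g \<in> L2" shows "(\<lambda>t. f t + g t) \<in> L2"
proof (rule L2_I)
  show "integrable M (\<lambda>t. (cmod (f t + g t))\<^sup>2)"
  proof (rule Bochner_Integration.integrable_bound[where f = "\<lambda>t. 2 * (cmod (f t))\<^sup>2 + 2 * (cmod (g t))\<^sup>2"])
    have "(cmod (f t + g t))\<^sup>2 \<le> 2 * (cmod (f t))\<^sup>2 + 2 * (cmod (g t))\<^sup>2" for t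
    proof -
      have "(cmod (f t + g t))\<^sup>2 \<le> (cmod (f t) + cmod (g t))\<^sup>2" by (intro power_mono norm_triangle_ineq) simp
      then show ?thesis using sum_squares_bound[of "cmod (f t)" "cmod (g t)"] by (simp add: power2_sum)
    qed
    then show "AE t in M. norm ((cmod (f t + g t))\<^sup>2) \<le> norm (2 * (cmod (f t))\<^sup>2 + 2 * (cmod (g t))\<^sup>2)" by simp
  qed (use f g in \<open>auto simp: L2_sq intro: borel_measurable_power borel_measurable_norm borel_measurable_add L2_meas\<close>)
qed (use f g in \<open>auto intro: borel_measurable_add L2_meas\<close>)

lemma L2_scale: assumes f: "f \<in> L2" shows "(\<lambda>t. c * f t) \<in> L2"
  using f by (auto simp: L2_def norm_mult power_mult_distrib)

lemma L2_diff: assumes f: "f \<in> L2" and g: "g \<in> L2" shows "(\<lambda>t. f t - g t) \<in> L2"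
  using L2_add[OF f L2_scale[OF g, of "-1"]] by simp

lemma L2_kernel: "Im z \<noteq> 0 \<Longrightarrow> (\<lambda>t. 1 / (of_real t - z)) \<in> L2"
  by (rule L2_bounded[of _ "1 / \<bar>Im z\<bar>"]) (use nonreal_kernel_bound in auto)

lemma L2_const: "(\<lambda>t. c) \<in> L2"
  by (rule L2_bounded[of _ "cmod c"]) auto

lemma l2_ip_add: "f \<in> L2 \<Longrightarrow> g \<in> L2 \<Longrightarrow> h \<in> L2 \<Longrightarrow> l2_ip (\<lambda>t. f t + g t) h = l2_ip f h + l2_ip g h"
  unfolding l2_ip_def distrib_right by (intro Bochner_Integration.integral_add L2_mult_integrable)

lemma l2_ip_scale: "l2_ip (\<lambda>t. c * f t) h = c * l2_ip f h"
  unfolding l2_ip_def mult.assoc by simp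

lemma l2_ip_diff: "f \<in> L2 \<Longrightarrow> g \<in> L2 \<Longrightarrow> h \<in> L2 \<Longrightarrow> l2_ip (\<lambda>t. f t - g t) h = l2_ip f h - l2_ip g h"
  using l2_ip_add[of f "\<lambda>t. - 1 * g t" h] l2_ip_scale[of "-1" g h] L2_scale[of g "-1"] by simp

lemma l2_ip_commute: "l2_ip g f = cnj (l2_ip f g)"
  unfolding l2_ip_def by (subst Bochner_Integration.integral_cnj[symmetric]) (simp add: mult.commute)

lemma l2_ip_self: "l2_ip f f = of_real (\<integral>t. (cmod (f t))\<^sup>2 \<partial>M)"
  unfolding l2_ip_def complex_norm_square[symmetric] integral_complex_of_real[symmetric] by simp

lemma l2_ip_cong_AE:
  assumes "AE t in M. f t = f' t" "AE t in M. g t = g' t" "f \<in> L2" "f' \<in> L2" "g \<in> L2" "g' \<in> L2"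
  shows "l2_ip f g = l2_ip f' g'"
  unfolding l2_ip_def
proof (rule integral_cong_AE)
  show "AE t in M. f t * cnj (g t) = f' t * cnj (g' t)" using assms(1,2) by eventually_elim simp
qed (use assms in \<open>auto intro: borel_measurable_integrable L2_mult_integrable\<close>)

definition l2_norm :: "(real \<Rightarrow> complex) \<Rightarrow> real" where
  "l2_norm f = sqrt (\<integral>t. (cmod (f t))\<^sup>2 \<partial>M)"

lemma l2_norm_nonneg [simp]: "l2_norm f \<ge> 0"
  by (simp add: l2_norm_def)

lemma l2_norm_sq: "(l2_norm f)\<^sup>2 = (\<integral>t. (cmod (f t))\<^sup>2 \<partial>M)"
  by (simp add: l2_norm_def)

lemma l2_norm_0: assumes f: "f \<in> L2" and "l2_norm f = 0" shows "AE t in M. f t = 0"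
proof -
  have "(\<integral>t. (cmod (f t))\<^sup>2 \<partial>M) = 0" using assms by (simp add: l2_norm_def)
  then show ?thesis using integral_nonneg_eq_0_iff_AE[OF L2_sq[OF f]] by simp
qed

text \<open>With moduli inside the integral the bound serves inner products, the triangle inequality
  and, against the constant 1, integrals of \<open>|f|\<close>. It follows from positivity of the
  quadratic form in \<open>x\<close>, \<open>y\<close> at \<open>x = sqrt B\<close>,
  \<open>y = sqrt A\<close>.\<close>

lemma l2_cauchy_schwarz:
  assumes f: "f \<in> L2" and g: "g \<in> L2"
  shows "(\<integral>t. cmod (f t) * cmod (g t) \<partial>M) \<le> l2_norm f * l2_norm g"
proof -
  define A B C where "A = (\<integral>t. (cmod (f t))\<^sup>2 \<partial>M)" and "B = (\<integral>t. (cmod (g t))\<^sup>2 \<partial>M)"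
    and "C = (\<integral>t. cmod (f t) * cmod (g t) \<partial>M)"
  have int: "integrable M (\<lambda>t. cmod (f t) * cmod (g t))"
    using integrable_norm[OF L2_mult_integrable[OF f g]] by (simp add: norm_mult)
  have AB: "A \<ge> 0" "B \<ge> 0" "C \<ge> 0" unfolding A_def B_def C_def by (simp_all add: integral_nonneg_AE)
  have key: "2 * x * y * C \<le> x\<^sup>2 * A + y\<^sup>2 * B" for x y :: real
  proof -
    have "0 \<le> (\<integral>t. (x * cmod (f t) - y * cmod (g t))\<^sup>2 \<partial>M)" by simp
    also have "\<dots> = (\<integral>t. x\<^sup>2 * (cmod (f t))\<^sup>2 - (2 * x * y) * (cmod (f t) * cmod (g t)) + y\<^sup>2 * (cmod (g t))\<^sup>2 \<partial>M)"
      by (simp add: power2_diff power_mult_distrib algebra_simps)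
    also have "\<dots> = x\<^sup>2 * A - 2 * x * y * C + y\<^sup>2 * B"
      unfolding A_def B_def C_def using int L2_sq[OF f] L2_sq[OF g] by simp
    finally show ?thesis by simp
  qed
  have "C \<le> sqrt A * sqrt B"
  proof (cases "A = 0 \<or> B = 0")
    case True
    have C0: "C = 0"
    proof (rule ccontr)
      assume "C \<noteq> 0"
      then have C: "C > 0" using AB by simp
      show False using True
      proof
        assume "A = 0"
        \<comment> \<open>With \<open>A = 0\<close> and \<open>y = 1\<close> any large
          \<open>x\<close> refutes \<open>key\<close>; this one makes its left side
          \<open>2 * (B + 1)\<close>, against \<open>B\<close> on the right.\<close>
        have "2 * ((B + 1) / C) * 1 * C = 2 * (B + 1)" using C by simp
        then show False using key[of "(B + 1) / C" 1] AB \<open>A = 0\<close> by simp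
      next
        assume "B = 0"
        have "2 * 1 * ((A + 1) / C) * C = 2 * (A + 1)" using C by simp
        then show False using key[of 1 "(A + 1) / C"] AB \<open>B = 0\<close> by simp
      qed
    qed
    then show ?thesis using AB by simp
  next
    case False
    then have "sqrt A > 0" "sqrt B > 0" using AB by auto
    then have pos: "sqrt A * sqrt B > 0" by simp
    have "2 * (sqrt A * sqrt B) * C \<le> 2 * (A * B)"
      using key[of "sqrt B" "sqrt A"] AB by (simp add: mult_ac)
    also have "A * B = (sqrt A * sqrt B) * (sqrt A * sqrt B)" using AB by (simp add: mult_ac)
    finally have "(sqrt A * sqrt B) * C \<le> (sqrt A * sqrt B) * (sqrt A * sqrt B)" by simp
    then show ?thesis using pos by (simp only: mult_le_cancel_left_pos)
  qed
  then show ?thesis by (simp add: A_def B_def C_def l2_norm_def)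
qed

lemma l2_ip_bound: "f \<in> L2 \<Longrightarrow> g \<in> L2 \<Longrightarrow> cmod (l2_ip f g) \<le> l2_norm f * l2_norm g"
  unfolding l2_ip_def using integral_norm_bound[of M "\<lambda>t. f t * cnj (g t)"] l2_cauchy_schwarz[of f g]
  by (simp add: norm_mult)

lemma l2_norm_triangle:
  assumes f: "f \<in> L2" and g: "g \<in> L2"
  shows "l2_norm (\<lambda>t. f t + g t) \<le> l2_norm f + l2_norm g"
proof (rule power2_le_imp_le)
  have "(l2_norm (\<lambda>t. f t + g t))\<^sup>2 \<le> (\<integral>t. (cmod (f t))\<^sup>2 + 2 * (cmod (f t) * cmod (g t)) + (cmod (g t))\<^sup>2 \<partial>M)"
    unfolding l2_norm_sq
  proof (rule integral_mono)
    show "(cmod (f t + g t))\<^sup>2 \<le> (cmod (f t))\<^sup>2 + 2 * (cmod (f t) * cmod (g t)) + (cmod (g t))\<^sup>2" for t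
      using power_mono[OF norm_triangle_ineq[of "f t" "g t"], of 2] by (simp add: power2_sum)
    show "integrable M (\<lambda>t. (cmod (f t))\<^sup>2 + 2 * (cmod (f t) * cmod (g t)) + (cmod (g t))\<^sup>2)"
      using integrable_norm[OF L2_mult_integrable[OF f g]] L2_sq[OF f] L2_sq[OF g] by (simp add: norm_mult)
  qed (use L2_sq[OF L2_add[OF f g]] in simp)
  also have "\<dots> = (l2_norm f)\<^sup>2 + 2 * (\<integral>t. cmod (f t) * cmod (g t) \<partial>M) + (l2_norm g)\<^sup>2"
    using integrable_norm[OF L2_mult_integrable[OF f g]] L2_sq[OF f] L2_sq[OF g] by (simp add: norm_mult l2_norm_sq)
  also have "\<dots> \<le> (l2_norm f + l2_norm g)\<^sup>2"
    using l2_cauchy_schwarz[OF f g] by (simp add: power2_sum)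
  finally show "(l2_norm (\<lambda>t. f t + g t))\<^sup>2 \<le> (l2_norm f + l2_norm g)\<^sup>2" .
qed simp

text \<open>Riesz-Fischer. The measure is finite, so Cauchy-Schwarz against 1 makes the increments
  of a fast subsequence summable in L1, hence pointwise absolutely summable almost
  everywhere.\<close>

lemma L2_complete:
  assumes f: "\<And>j. f j \<in> L2"
    and C: "\<And>\<epsilon>. \<epsilon> > 0 \<Longrightarrow> \<exists>N. \<forall>i\<ge>N. \<forall>j\<ge>N. l2_norm (\<lambda>t. f i t - f j t) < \<epsilon>"
  obtains F where "F \<in> L2" "(\<lambda>j. l2_norm (\<lambda>t. f j t - F t)) \<longlonglongrightarrow> 0"
proof -
  have [measurable]: "f j \<in> borel_measurable M" for j using L2_meas[OF f] .
  define N where "N = (\<lambda>k::nat. SOME N. \<forall>i\<ge>N. \<forall>j\<ge>N. l2_norm (\<lambda>t. f i t - f j t) < (1/2)^k)"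
  have N: "l2_norm (\<lambda>t. f i t - f j t) < (1/2)^k" if "i \<ge> N k" "j \<ge> N k" for i j k
    using someI_ex[OF C[of "(1/2)^k"]] that unfolding N_def by simp
  \<comment> \<open>Summing all earlier thresholds yields the three lower bounds below without a
    recursive choice of indices.\<close>
  define r where "r = (\<lambda>k. k + (\<Sum>i\<le>k. N i))"
  have rN: "r k \<ge> N k" "r (Suc k) \<ge> N k" "r k \<ge> k" for k
    unfolding r_def using member_le_sum[of k "{..k}" N] by (auto simp: trans_le_add2 trans_le_add1)
  define g where "g = (\<lambda>k t. f (r (Suc k)) t - f (r k) t)"
  have gL: "g k \<in> L2" for k unfolding g_def by (intro L2_diff f)
  have gn: "(\<integral>\<^sup>+t. ennreal (cmod (g k t)) \<partial>M) \<le> ennreal (l2_norm (\<lambda>_. 1) * (1/2)^k)" for k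
  proof -
    have "(\<integral>\<^sup>+t. ennreal (cmod (g k t)) \<partial>M) = ennreal (\<integral>t. cmod (g k t) \<partial>M)"
      using integrable_norm[OF L2_mult_integrable[OF gL[of k] L2_const[of 1]]] by (intro nn_integral_eq_integral) auto
    also have "\<dots> \<le> ennreal (l2_norm (\<lambda>_. 1) * (1/2)^k)"
    proof (rule ennreal_leI)
      have "(\<integral>t. cmod (g k t) \<partial>M) \<le> l2_norm (g k) * l2_norm (\<lambda>_. 1)"
        using l2_cauchy_schwarz[OF gL[of k] L2_const[of 1]] by simp
      also have "\<dots> \<le> (1/2)^k * l2_norm (\<lambda>_. 1)"
        unfolding g_def using N[OF rN(2) rN(1), of k] by (intro mult_right_mono) auto
      finally show "(\<integral>t. cmod (g k t) \<partial>M) \<le> l2_norm (\<lambda>_. 1) * (1/2)^k" by (simp add: mult.commute)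
    qed
    finally show ?thesis .
  qed
  have [measurable]: "g k \<in> borel_measurable M" for k using L2_meas[OF gL] .
  have "(\<integral>\<^sup>+t. (\<Sum>k. ennreal (cmod (g k t))) \<partial>M) = (\<Sum>k. \<integral>\<^sup>+t. ennreal (cmod (g k t)) \<partial>M)"
    by (rule nn_integral_suminf) auto
  also have "\<dots> \<le> (\<Sum>k. ennreal (l2_norm (\<lambda>_. 1) * (1/2)^k))"
    by (intro suminf_le gn) auto
  also have "\<dots> < \<infinity>"
  proof -
    have "summable (\<lambda>k. l2_norm (\<lambda>_. 1) * (1/2::real)^k)" by (intro summable_mult summable_geometric) auto
    then show ?thesis by (subst suminf_ennreal2) auto
  qed
  finally have "AE t in M. (\<Sum>k. ennreal (cmod (g k t))) \<noteq> \<infinity>"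
    by (intro nn_integral_PInf_AE) auto
  then have conv: "AE t in M. convergent (\<lambda>k. f (r k) t)"
  proof eventually_elim
    case (elim t)
    then have "summable (\<lambda>k. cmod (g k t))" by (intro summable_suminf_not_top) auto
    then have "summable (\<lambda>k. g k t)" by (rule summable_norm_cancel)
    then have "convergent (\<lambda>n. \<Sum>k<n. g k t)" by (simp add: summable_iff_convergent)
    moreover have "(\<Sum>k<n. g k t) = f (r n) t - f (r 0) t" for n
      unfolding g_def by (rule sum_lessThan_telescope)
    ultimately have "convergent (\<lambda>n. f (r n) t - f (r 0) t)" by simp
    then have "convergent (\<lambda>n. f (r n) t - f (r 0) t + f (r 0) t)" by (rule convergent_add) (rule convergent_const)
    then show ?case by simp
  qed
  define F where "F = (\<lambda>t. lim (\<lambda>k. f (r k) t))"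
  have Fm[measurable]: "F \<in> borel_measurable M" unfolding F_def by measurable
  have lim: "AE t in M. (\<lambda>k. f (r k) t) \<longlonglongrightarrow> F t"
    using conv by eventually_elim (simp add: F_def convergent_LIMSEQ_iff)
  \<comment> \<open>Fatou along the subsequence with \<open>i\<close> fixed in the full sequence:
    this gives convergence of the whole sequence, not merely of the subsequence.\<close>
  have fatou: "integrable M (\<lambda>t. (cmod (f i t - F t))\<^sup>2) \<and> (\<integral>t. (cmod (f i t - F t))\<^sup>2 \<partial>M) \<le> ((1/2)^k)\<^sup>2"
    if i: "i \<ge> N k" for i k
  proof -
    have 1: "integrable M (\<lambda>t. (cmod (f i t - f (r j) t))\<^sup>2)" for j by (intro L2_sq L2_diff f)
    have 2: "AE t in M. (\<lambda>j. (cmod (f i t - f (r j) t))\<^sup>2) \<longlonglongrightarrow> (cmod (f i t - F t))\<^sup>2"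
      using lim by eventually_elim (intro tendsto_intros)
    have 3: "\<forall>\<^sub>F j in sequentially. (\<integral>t. (cmod (f i t - f (r j) t))\<^sup>2 \<partial>M) \<le> ((1/2)^k)\<^sup>2"
      using eventually_ge_at_top[of "N k"]
    proof eventually_elim
      case (elim j)
      then have "l2_norm (\<lambda>t. f i t - f (r j) t) \<le> (1/2)^k" using N[OF i, of "r j"] rN(3)[of j] by simp
      then show ?case unfolding l2_norm_sq[symmetric] by (intro power_mono) auto
    qed
    show ?thesis using fatou_integrable[OF 1 _ _ 2 3] by auto
  qed
  have FL: "F \<in> L2"
  proof -
    have "(\<lambda>t. f (N 0) t - F t) \<in> L2" using fatou[of 0 "N 0"] by (intro L2_I) auto
    from L2_diff[OF f this, of "N 0"] have "(\<lambda>t. f (N 0) t - (f (N 0) t - F t)) \<in> L2" .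
    also have "(\<lambda>t. f (N 0) t - (f (N 0) t - F t)) = F" by (simp add: fun_eq_iff)
    finally show ?thesis .
  qed
  have "(\<lambda>j. l2_norm (\<lambda>t. f j t - F t)) \<longlonglongrightarrow> 0"
  proof (rule LIMSEQ_I)
    fix \<epsilon> :: real assume "\<epsilon> > 0"
    moreover have "(1 / 2 :: real) < 1" by simp
    ultimately obtain k where k: "(1/2)^k < \<epsilon>" using real_arch_pow_inv by blast
    have "norm (l2_norm (\<lambda>t. f j t - F t) - 0) < \<epsilon>" if "j \<ge> N k" for j
    proof -
      have "l2_norm (\<lambda>t. f j t - F t) \<le> (1/2)^k"
      proof (rule power2_le_imp_le)
        show "(l2_norm (\<lambda>t. f j t - F t))\<^sup>2 \<le> ((1/2)^k)\<^sup>2"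
          unfolding l2_norm_sq using fatou[OF that] by blast
      qed simp
      then show ?thesis using k by simp
    qed
    then show "\<exists>no. \<forall>j\<ge>no. norm (l2_norm (\<lambda>t. f j t - F t) - 0) < \<epsilon>" by blast
  qed
  with FL show ?thesis by (rule that)
qed

section \<open>Cauchy transforms of square-integrable functions\<close>

abbreviation cauchy_kernel :: "complex \<Rightarrow> real \<Rightarrow> complex" where
  "cauchy_kernel z \<equiv> \<lambda>t. 1 / (of_real t - z)"

lemma L2_div_kernel:
  assumes f: "f \<in> L2" and z: "Im z \<noteq> 0"
  shows "(\<lambda>t. f t / (of_real t - z)) \<in> L2"
proof (rule L2_I)
  have [measurable]: "f \<in> borel_measurable M" by (rule L2_meas[OF f])
  show "(\<lambda>t. f t / (of_real t - z)) \<in> borel_measurable M" by measurable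
  show "integrable M (\<lambda>t. (cmod (f t / (of_real t - z)))\<^sup>2)"
  proof (rule Bochner_Integration.integrable_bound[where f = "\<lambda>t. (1 / \<bar>Im z\<bar>)\<^sup>2 * (cmod (f t))\<^sup>2"])
    have "(cmod (f t / (of_real t - z)))\<^sup>2 \<le> (1 / \<bar>Im z\<bar>)\<^sup>2 * (cmod (f t))\<^sup>2" for t
    proof -
      have "(cmod (f t / (of_real t - z)))\<^sup>2 = (cmod (1 / (of_real t - z)))\<^sup>2 * (cmod (f t))\<^sup>2"
        by (simp add: norm_divide power_divide)
      also have "\<dots> \<le> (1 / \<bar>Im z\<bar>)\<^sup>2 * (cmod (f t))\<^sup>2"
        by (intro mult_right_mono power_mono nonreal_kernel_bound z) auto
      finally show ?thesis .
    qed
    then show "AE t in M. norm ((cmod (f t / (of_real t - z)))\<^sup>2) \<le> norm ((1 / \<bar>Im z\<bar>)\<^sup>2 * (cmod (f t))\<^sup>2)"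
      by (intro AE_I2) simp
  qed (use L2_sq[OF f] in \<open>auto intro: integrable_mult_right\<close>)
qed

lemma L2_integrable: "f \<in> L2 \<Longrightarrow> integrable M f"
  using L2_mult_integrable[of f "\<lambda>_. 1"] L2_const[of 1] by simp

text \<open>As \<open>t\<close> is real, conjugating the kernel at \<open>cnj z\<close> gives the
  kernel at \<open>z\<close>. Evaluation at a point becomes an inner product, the source of
  linearity and of the reproducing property.\<close>

lemma cauchy_tr_conv_l2_ip: "cauchy_tr f z = l2_ip f (cauchy_kernel (cnj z))"
  unfolding cauchy_tr_def l2_ip_def by (intro Bochner_Integration.integral_cong) auto

lemma cauchy_tr_add: "f \<in> L2 \<Longrightarrow> g \<in> L2 \<Longrightarrow> Im z \<noteq> 0 \<Longrightarrow> cauchy_tr (\<lambda>t. f t + g t) z = cauchy_tr f z + cauchy_tr g z"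
  unfolding cauchy_tr_conv_l2_ip by (intro l2_ip_add L2_kernel) auto

lemma cauchy_tr_scale: "cauchy_tr (\<lambda>t. c * f t) z = c * cauchy_tr f z"
  unfolding cauchy_tr_conv_l2_ip by (rule l2_ip_scale)

lemma cauchy_tr_diff: "f \<in> L2 \<Longrightarrow> g \<in> L2 \<Longrightarrow> Im z \<noteq> 0 \<Longrightarrow> cauchy_tr (\<lambda>t. f t - g t) z = cauchy_tr f z - cauchy_tr g z"
  unfolding cauchy_tr_conv_l2_ip by (intro l2_ip_diff L2_kernel) auto

text \<open>The resolvent identity
  \<open>1/(t - z) - 1/(t - w) = (z - w) / ((t - z) * (t - w))\<close> under the integral.
  Continuity, derivatives, the Nevanlinna kernel and the difference quotients all rest on
  it.\<close>

lemma cauchy_tr_increment: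
  assumes f: "f \<in> L2" and z: "Im z \<noteq> 0" and w: "Im w \<noteq> 0"
  shows "cauchy_tr f z - cauchy_tr f w = (z - w) * cauchy_tr (\<lambda>t. f t / (of_real t - w)) z"
proof -
  have "cauchy_tr f z - cauchy_tr f w = (\<integral>t. f t / (of_real t - z) - f t / (of_real t - w) \<partial>M)"
    unfolding cauchy_tr_def using L2_integrable[OF L2_div_kernel[OF f]] z w by simp
  also have "\<dots> = (\<integral>t. (z - w) * (f t / (of_real t - w) / (of_real t - z)) \<partial>M)"
  proof (rule Bochner_Integration.integral_cong[OF refl])
    fix t
    have "complex_of_real t - z \<noteq> 0" "complex_of_real t - w \<noteq> 0" using z w nonreal_neq_of_real by auto
    then show "f t / (of_real t - z) - f t / (of_real t - w) = (z - w) * (f t / (of_real t - w) / (of_real t - z))"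
      by (simp add: divide_simps) (simp add: algebra_simps)
  qed
  also have "\<dots> = (z - w) * cauchy_tr (\<lambda>t. f t / (of_real t - w)) z"
    unfolding cauchy_tr_def by (rule integral_mult_right_zero)
  finally show ?thesis .
qed

lemma cauchy_tr_continuous:
  assumes f: "f \<in> L2" and z: "Im z \<noteq> 0"
  shows "(cauchy_tr f \<longlongrightarrow> cauchy_tr f z) (at z)"
proof -
  have ev: "\<forall>\<^sub>F w in at z. Im w \<noteq> 0"
    using tendsto_imp_eventually_ne[OF tendsto_Im[OF tendsto_ident_at] z] .
  define B where "B = (\<integral>t. cmod (f t / (of_real t - z)) \<partial>M)"
  have "((\<lambda>w. cauchy_tr f w - cauchy_tr f z) \<longlongrightarrow> 0) (at z)"
  proof (rule Lim_null_comparison)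
    show "\<forall>\<^sub>F w in at z. norm (cauchy_tr f w - cauchy_tr f z) \<le> cmod (w - z) * (B / \<bar>Im w\<bar>)"
      using ev
    proof eventually_elim
      case (elim w)
      have "cmod (cauchy_tr (\<lambda>t. f t / (of_real t - z)) w) \<le> (\<integral>t. cmod (f t / (of_real t - z) / (of_real t - w)) \<partial>M)"
        unfolding cauchy_tr_def by (rule integral_norm_bound)
      also have "\<dots> \<le> (\<integral>t. cmod (f t / (of_real t - z)) * (1 / \<bar>Im w\<bar>) \<partial>M)"
      proof (rule integral_mono)
        show "cmod (f t / (of_real t - z) / (of_real t - w)) \<le> cmod (f t / (of_real t - z)) * (1 / \<bar>Im w\<bar>)" for t
          using mult_left_mono[OF nonreal_kernel_bound[OF elim, of t], of "cmod (f t / (of_real t - z))"]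
          by (simp add: norm_divide norm_mult)
      qed (use L2_integrable[OF L2_div_kernel[OF f z]] L2_integrable[OF L2_div_kernel[OF L2_div_kernel[OF f z] elim]] in \<open>auto intro: integrable_norm integrable_mult_left\<close>)
      also have "\<dots> = B / \<bar>Im w\<bar>" by (simp add: B_def)
      finally show ?case unfolding cauchy_tr_increment[OF f elim z] norm_mult by (intro mult_left_mono) auto
    qed
    have "((\<lambda>w. cmod (w - z) * (B / \<bar>Im w\<bar>)) \<longlongrightarrow> cmod (z - z) * (B / \<bar>Im z\<bar>)) (at z)"
      using z by (intro tendsto_intros) auto
    then show "((\<lambda>w. cmod (w - z) * (B / \<bar>Im w\<bar>)) \<longlongrightarrow> 0) (at z)" by simp
  qed
  then show ?thesis by (simp add: LIM_zero_iff)
qed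

lemma cauchy_tr_difference_quotient:
  assumes f: "f \<in> L2" and z: "Im z \<noteq> 0"
  shows "((\<lambda>w. (cauchy_tr f w - cauchy_tr f z) / (w - z)) \<longlongrightarrow> cauchy_tr (\<lambda>t. f t / (of_real t - z)) z) (at z)"
proof (rule Lim_transform_eventually[OF cauchy_tr_continuous[OF L2_div_kernel[OF f z] z]])
  have ev: "\<forall>\<^sub>F w in at z. Im w \<noteq> 0"
    using tendsto_imp_eventually_ne[OF tendsto_Im[OF tendsto_ident_at] z] .
  show "\<forall>\<^sub>F w in at z. cauchy_tr (\<lambda>t. f t / (of_real t - z)) w = (cauchy_tr f w - cauchy_tr f z) / (w - z)"
    using ev eventually_neq_at_within[of z z UNIV]
    by eventually_elim (simp add: cauchy_tr_increment[OF f _ z])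
qed

definition cauchy_null :: "(real \<Rightarrow> complex) set" where
  "cauchy_null = {g \<in> L2. \<forall>z\<in>nonreal. cauchy_tr g z = 0}"

text \<open>\<open>cauchy_null\<close> is in fact trivial; passing to its orthogonal complement avoids proving this
  uniqueness theorem, because the Cauchy transform is injective there for trivial reasons.\<close>

definition L2_reduced :: "(real \<Rightarrow> complex) set" where
  "L2_reduced = {f \<in> L2. \<forall>g\<in>cauchy_null. l2_ip f g = 0}"

definition cauchy_fun :: "(real \<Rightarrow> complex) \<Rightarrow> complex \<Rightarrow> complex" where
  "cauchy_fun f = off_real (cauchy_tr f)"

definition L_carrier :: "(complex \<Rightarrow> complex) set" where
  "L_carrier = cauchy_fun ` L2_reduced"

definition L_rep :: "(complex \<Rightarrow> complex) \<Rightarrow> real \<Rightarrow> complex" where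
  "L_rep F = (SOME f. f \<in> L2_reduced \<and> cauchy_fun f = F)"

text \<open>The value 0 off the carrier keeps \<open>L_dist\<close> nonnegative and symmetric for
  arbitrary arguments, as \<open>Metric_space\<close> requires. On the carrier the choice in
  \<open>L_rep\<close> is harmless, since representatives agree almost everywhere.\<close>

definition L_ip :: "(complex \<Rightarrow> complex) \<Rightarrow> (complex \<Rightarrow> complex) \<Rightarrow> complex" where
  "L_ip F G = (if F \<in> L_carrier \<and> G \<in> L_carrier then l2_ip (L_rep F) (L_rep G) else 0)"

lemma reduced_L2: "f \<in> L2_reduced \<Longrightarrow> f \<in> L2"
  by (simp add: L2_reduced_def)

lemma reduced_add: "f \<in> L2_reduced \<Longrightarrow> g \<in> L2_reduced \<Longrightarrow> (\<lambda>t. f t + g t) \<in> L2_reduced"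
  by (auto simp: L2_reduced_def cauchy_null_def L2_add l2_ip_add)

lemma reduced_scale: "f \<in> L2_reduced \<Longrightarrow> (\<lambda>t. c * f t) \<in> L2_reduced"
  by (auto simp: L2_reduced_def L2_scale l2_ip_scale)

lemma reduced_diff: "f \<in> L2_reduced \<Longrightarrow> g \<in> L2_reduced \<Longrightarrow> (\<lambda>t. f t - g t) \<in> L2_reduced"
  using reduced_add[of f "\<lambda>t. -1 * g t"] reduced_scale[of g "-1"] by simp

text \<open>The inner product with \<open>g\<close> is the conjugate of
  \<open>cauchy_tr g (cnj z)\<close>, which vanishes for \<open>g\<close> in
  \<open>cauchy_null\<close>.\<close>

lemma reduced_kernel:
  assumes "Im z \<noteq> 0" shows "cauchy_kernel z \<in> L2_reduced"
proof -
  have "l2_ip (cauchy_kernel z) g = 0" if "g \<in> cauchy_null" for g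
  proof -
    have "cauchy_tr g (cnj z) = 0" using that assms by (simp add: cauchy_null_def)
    then have "l2_ip g (cauchy_kernel z) = 0" by (simp add: cauchy_tr_conv_l2_ip)
    then show ?thesis using l2_ip_commute[of "cauchy_kernel z" g] by simp
  qed
  then show ?thesis using L2_kernel[OF assms] by (simp add: L2_reduced_def)
qed

text \<open>The constant 1 is the limit of \<open>- z / (t - z)\<close> as \<open>z\<close> runs up
  the imaginary axis. These multiples of kernels are bounded by 1, so orthogonality to
  \<open>g\<close> survives the limit by dominated convergence.\<close>

lemma reduced_one: "(\<lambda>_. 1) \<in> L2_reduced"
proof -
  have "l2_ip g (\<lambda>_. 1) = 0" if g: "g \<in> cauchy_null" for g
  proof -
    have gL: "g \<in> L2" using g by (simp add: cauchy_null_def)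
    define z where "z = (\<lambda>j. \<i> * complex_of_real (real j + 1))"
    have z: "Im (z j) = real j + 1" "Im (z j) \<noteq> 0" "cmod (z j) = real j + 1" for j
      by (auto simp: z_def norm_mult) (metis abs_of_nonneg norm_of_nat of_nat_0_le_iff of_nat_Suc add.commute)+
    have "(\<lambda>j. \<integral>t. - z j * (g t / (of_real t - z j)) \<partial>M) \<longlonglongrightarrow> (\<integral>t. g t \<partial>M)"
    proof (rule integral_dominated_convergence[where w = "\<lambda>t. cmod (g t)"])
      have "(\<lambda>j. - z j * (g t / (of_real t - z j))) \<longlonglongrightarrow> g t" for t
      proof -
        have nz: "complex_of_real t - z j \<noteq> 0" for j using nonreal_neq_of_real[OF z(2)] .
        have "(\<lambda>j. g t - (g t * of_real t) * (1 / (of_real t - z j))) \<longlonglongrightarrow> g t - (g t * of_real t) * 0"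
        proof (intro tendsto_diff tendsto_mult tendsto_const)
          have "(\<lambda>j. 1 / (real j + 1)) \<longlonglongrightarrow> 0" by real_asymp
          then show "(\<lambda>j. 1 / (complex_of_real t - z j)) \<longlonglongrightarrow> 0"
            by (rule Lim_null_comparison[rotated]) (use nonreal_kernel_bound[OF z(2)] z(1) in \<open>auto intro!: always_eventually\<close>)
        qed
        moreover have "g t - (g t * of_real t) * (1 / (of_real t - z j)) = - z j * (g t / (of_real t - z j))" for j
          using nz[of j] by (simp add: field_simps)
        ultimately show ?thesis by simp
      qed
      then show "AE t in M. (\<lambda>j. - z j * (g t / (of_real t - z j))) \<longlonglongrightarrow> g t" by simp
      show "AE t in M. norm (- z j * (g t / (of_real t - z j))) \<le> cmod (g t)" for j
      proof (rule AE_I2)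
        fix t
        have "norm (- z j * (g t / (of_real t - z j))) = cmod (g t) * (cmod (z j) * cmod (1 / (of_real t - z j)))"
          by (simp add: norm_mult norm_divide)
        also have "\<dots> \<le> cmod (g t) * 1"
        proof (rule mult_left_mono)
          have "cmod (z j) * cmod (1 / (of_real t - z j)) \<le> (real j + 1) * (1 / \<bar>Im (z j)\<bar>)"
            unfolding z(3) by (intro mult_left_mono nonreal_kernel_bound z) simp
          then show "cmod (z j) * cmod (1 / (of_real t - z j)) \<le> 1" by (simp add: z(1))
        qed simp
        finally show "norm (- z j * (g t / (of_real t - z j))) \<le> cmod (g t)" by simp
      qed
    qed (use L2_integrable[OF gL] L2_integrable[OF L2_div_kernel[OF gL z(2)]] in \<open>auto intro!: borel_measurable_integrable integrable_mult_right integrable_norm\<close>)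
    moreover have "(\<integral>t. - z j * (g t / (of_real t - z j)) \<partial>M) = 0" for j
    proof -
      have "(\<integral>t. - z j * (g t / (of_real t - z j)) \<partial>M) = - z j * cauchy_tr g (z j)"
        unfolding cauchy_tr_def by (rule integral_mult_right_zero)
      then show ?thesis using g z(2) by (simp add: cauchy_null_def)
    qed
    ultimately have "(\<integral>t. g t \<partial>M) = 0" by (simp add: LIMSEQ_const_iff)
    then show ?thesis by (simp add: l2_ip_def)
  qed
  then have "l2_ip (\<lambda>_. 1) g = 0" if "g \<in> cauchy_null" for g
    using that l2_ip_commute[of "\<lambda>_. 1" g] by simp
  then show ?thesis using L2_const[of 1] by (simp add: L2_reduced_def)
qed

text \<open>The difference lies in \<open>cauchy_null\<close> and is orthogonal to it, hence
  orthogonal to itself.\<close>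

lemma reduced_inj:
  assumes f: "f \<in> L2_reduced" and g: "g \<in> L2_reduced" and eq: "cauchy_fun f = cauchy_fun g"
  shows "AE t in M. f t = g t"
proof -
  let ?h = "\<lambda>t. f t - g t"
  have h: "?h \<in> L2_reduced" by (rule reduced_diff[OF f g])
  have "cauchy_tr ?h z = 0" if "Im z \<noteq> 0" for z
    using fun_cong[OF eq, of z] that cauchy_tr_diff[OF reduced_L2[OF f] reduced_L2[OF g] that]
    by (simp add: cauchy_fun_def off_real_def)
  then have "?h \<in> cauchy_null" using reduced_L2[OF h] by (simp add: cauchy_null_def)
  then have "l2_ip ?h ?h = 0" using h unfolding L2_reduced_def by blast
  then have "l2_norm ?h = 0" unfolding l2_ip_self l2_norm_def by simp
  from l2_norm_0[OF reduced_L2[OF h] this] show ?thesis by simp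
qed

lemma L_rep:
  assumes f: "f \<in> L2_reduced"
  shows "L_rep (cauchy_fun f) \<in> L2_reduced" "AE t in M. L_rep (cauchy_fun f) t = f t"
proof -
  have *: "L_rep (cauchy_fun f) \<in> L2_reduced \<and> cauchy_fun (L_rep (cauchy_fun f)) = cauchy_fun f"
    unfolding L_rep_def by (rule someI[of _ f]) (simp add: f)
  then show "L_rep (cauchy_fun f) \<in> L2_reduced" by blast
  show "AE t in M. L_rep (cauchy_fun f) t = f t" using * by (intro reduced_inj f) auto
qed

lemma L_ip_eq:
  assumes f: "f \<in> L2_reduced" and g: "g \<in> L2_reduced"
  shows "L_ip (cauchy_fun f) (cauchy_fun g) = l2_ip f g"
  using f g L_rep[OF f] L_rep[OF g] unfolding L_ip_def L_carrier_def
  by (auto intro!: l2_ip_cong_AE reduced_L2)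

lemma cauchy_fun_add: "f \<in> L2 \<Longrightarrow> g \<in> L2 \<Longrightarrow> cauchy_fun (\<lambda>t. f t + g t) = (\<lambda>x. cauchy_fun f x + cauchy_fun g x)"
  by (auto simp: cauchy_fun_def off_real_def fun_eq_iff cauchy_tr_add)

lemma cauchy_fun_diff: "f \<in> L2 \<Longrightarrow> g \<in> L2 \<Longrightarrow> cauchy_fun (\<lambda>t. f t - g t) = (\<lambda>x. cauchy_fun f x - cauchy_fun g x)"
  by (auto simp: cauchy_fun_def off_real_def fun_eq_iff cauchy_tr_diff)

lemma cauchy_fun_scale: "cauchy_fun (\<lambda>t. c * f t) = (\<lambda>x. c * cauchy_fun f x)"
  by (auto simp: cauchy_fun_def off_real_def fun_eq_iff cauchy_tr_scale)

abbreviation L_dist :: "(complex \<Rightarrow> complex) \<Rightarrow> (complex \<Rightarrow> complex) \<Rightarrow> real" where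
  "L_dist F G \<equiv> sqrt (Re (L_ip (\<lambda>x. F x - G x) (\<lambda>x. F x - G x)))"

lemma L_dist_eq:
  assumes f: "f \<in> L2_reduced" and g: "g \<in> L2_reduced"
  shows "L_dist (cauchy_fun f) (cauchy_fun g) = l2_norm (\<lambda>t. f t - g t)"
  unfolding cauchy_fun_diff[OF reduced_L2[OF f] reduced_L2[OF g], symmetric]
    L_ip_eq[OF reduced_diff[OF f g] reduced_diff[OF f g]]
  by (simp add: l2_ip_self l2_norm_def)

lemma L_carrier_E:
  assumes "F \<in> L_carrier" obtains f where "f \<in> L2_reduced" "F = cauchy_fun f"
  using assms by (auto simp: L_carrier_def)

lemma L_carrier_I: "f \<in> L2_reduced \<Longrightarrow> cauchy_fun f \<in> L_carrier"
  by (simp add: L_carrier_def)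

lemma L_metric: "Metric_space L_carrier L_dist"
proof
  show "0 \<le> L_dist F G" for F G by (simp add: L_ip_def l2_ip_self)
  show "L_dist F G = L_dist G F" for F G
  \<comment> \<open>Symmetry is demanded off the carrier too; a difference belongs to the carrier
    exactly when its negative does.\<close>
  proof (cases "(\<lambda>x. F x - G x) \<in> L_carrier")
    case True
    then obtain f where f: "f \<in> L2_reduced" and F: "(\<lambda>x. F x - G x) = cauchy_fun f" by (rule L_carrier_E)
    have f': "(\<lambda>t. -1 * f t) \<in> L2_reduced" by (rule reduced_scale[OF f])
    have "(\<lambda>x. G x - F x) = (\<lambda>x. -1 * (F x - G x))" by simp
    also have "\<dots> = cauchy_fun (\<lambda>t. -1 * f t)" unfolding cauchy_fun_scale using fun_cong[OF F] by simp
    finally have "L_ip (\<lambda>x. G x - F x) (\<lambda>x. G x - F x) = L_ip (\<lambda>x. F x - G x) (\<lambda>x. F x - G x)"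
      by (simp only: F L_ip_eq[OF f f] L_ip_eq[OF f' f'] l2_ip_self) simp
    then show ?thesis by simp
  next
    case False
    have "(\<lambda>x. G x - F x) \<notin> L_carrier"
    proof
      assume "(\<lambda>x. G x - F x) \<in> L_carrier"
      then obtain f where f: "f \<in> L2_reduced" and F: "(\<lambda>x. G x - F x) = cauchy_fun f" by (rule L_carrier_E)
      have "(\<lambda>x. F x - G x) = (\<lambda>x. -1 * (G x - F x))" by simp
      also have "\<dots> = cauchy_fun (\<lambda>t. -1 * f t)" unfolding cauchy_fun_scale using fun_cong[OF F] by simp
      finally show False using False L_carrier_I[OF reduced_scale[OF f, of "-1"]] by (simp only: not_True_eq_False)
    qed
    then show ?thesis using False by (simp add: L_ip_def)
  qed
  show "(L_dist F G = 0) = (F = G)" if FG: "F \<in> L_carrier" "G \<in> L_carrier" for F G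
  proof -
    obtain f g where f: "f \<in> L2_reduced" "F = cauchy_fun f" and g: "g \<in> L2_reduced" "G = cauchy_fun g"
      using FG by (metis L_carrier_E)
    have L: "f \<in> L2" "g \<in> L2" using f g reduced_L2 by auto
    show ?thesis
    proof
      assume "L_dist F G = 0"
      then have "l2_norm (\<lambda>t. f t - g t) = 0" using L_dist_eq[OF f(1) g(1)] f g by simp
      from l2_norm_0[OF L2_diff[OF L] this] have AE: "AE t in M. f t = g t" by simp
      have "cauchy_tr f z = cauchy_tr g z" if "Im z \<noteq> 0" for z
        unfolding cauchy_tr_conv_l2_ip using AE that L by (intro l2_ip_cong_AE L2_kernel) auto
      then show "F = G" by (auto simp: f g cauchy_fun_def off_real_def fun_eq_iff)
    next
      assume "F = G"
      moreover have "L_dist F F = l2_norm (\<lambda>t. f t - f t)" unfolding f(2) by (rule L_dist_eq[OF f(1) f(1)])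
      ultimately show "L_dist F G = 0" by (simp add: l2_norm_def)
    qed
  qed
  show "L_dist F K \<le> L_dist F G + L_dist G K" if FGK: "F \<in> L_carrier" "G \<in> L_carrier" "K \<in> L_carrier" for F G K
  proof -
    obtain f g k where f: "f \<in> L2_reduced" "F = cauchy_fun f" and g: "g \<in> L2_reduced" "G = cauchy_fun g"
      and k: "k \<in> L2_reduced" "K = cauchy_fun k"
      using FGK by (metis L_carrier_E)
    have L: "f \<in> L2" "g \<in> L2" "k \<in> L2" using f g k reduced_L2 by auto
    have "l2_norm (\<lambda>t. f t - k t) \<le> l2_norm (\<lambda>t. f t - g t) + l2_norm (\<lambda>t. g t - k t)"
      using l2_norm_triangle[OF L2_diff[OF L(1,2)] L2_diff[OF L(2,3)]] by simp
    then show ?thesis unfolding f(2) g(2) k(2) L_dist_eq[OF f(1) k(1)] L_dist_eq[OF f(1) g(1)] L_dist_eq[OF g(1) k(1)] .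
  qed
qed

lemma L_mcomplete: "Metric_space.mcomplete L_carrier L_dist"
proof -
  interpret L: Metric_space L_carrier L_dist by (rule L_metric)
  show ?thesis
    unfolding L.mcomplete_def
  proof (intro allI impI)
    fix S assume S: "L.MCauchy S"
    have "\<exists>f. f \<in> L2_reduced \<and> S j = cauchy_fun f" for j
    proof -
      have "S j \<in> L_carrier" using S unfolding L.MCauchy_def by blast
      then show ?thesis by (auto elim: L_carrier_E)
    qed
    then obtain f where f: "\<And>j. f j \<in> L2_reduced" "\<And>j. S j = cauchy_fun (f j)" by metis
    have fL: "f j \<in> L2" for j by (rule reduced_L2[OF f(1)])
    have "\<forall>\<epsilon>>0. \<exists>N. \<forall>i j. N \<le> i \<longrightarrow> N \<le> j \<longrightarrow> L_dist (S i) (S j) < \<epsilon>"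
      using S unfolding L.MCauchy_def by (rule conjunct2)
    then have C: "\<forall>\<epsilon>>0. \<exists>N. \<forall>i j. N \<le> i \<longrightarrow> N \<le> j \<longrightarrow> l2_norm (\<lambda>t. f i t - f j t) < \<epsilon>"
      unfolding f(2) by (simp only: L_dist_eq[OF f(1) f(1)])
    obtain F where F: "F \<in> L2" and lim: "(\<lambda>j. l2_norm (\<lambda>t. f j t - F t)) \<longlonglongrightarrow> 0"
    proof (rule L2_complete[OF fL])
      show "\<exists>N. \<forall>i\<ge>N. \<forall>j\<ge>N. l2_norm (\<lambda>t. f i t - f j t) < \<epsilon>" if e: "\<epsilon> > 0" for \<epsilon>
        using C[rule_format, OF e] by meson
      fix F assume F: "F \<in> L2" "(\<lambda>j. l2_norm (\<lambda>t. f j t - F t)) \<longlonglongrightarrow> 0"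
      show thesis by (rule that[OF F])
    qed
    \<comment> \<open>The orthogonal complement is closed: the inner product with \<open>g\<close>
      is bounded by the distance to \<open>f j\<close>, which tends to 0.\<close>
    have "l2_ip F g = 0" if g: "g \<in> cauchy_null" for g
    proof -
      have gL: "g \<in> L2" using g by (simp add: cauchy_null_def)
      have "cmod (l2_ip F g) \<le> l2_norm (\<lambda>t. f j t - F t) * l2_norm g" for j
      proof -
        have "l2_ip (\<lambda>t. f j t - F t) g = - l2_ip F g"
          using l2_ip_diff[OF fL F gL, of j] f(1)[of j] g by (simp add: L2_reduced_def)
        then show ?thesis using l2_ip_bound[OF L2_diff[OF fL F] gL, of j] by simp
      qed
      moreover have "(\<lambda>j. l2_norm (\<lambda>t. f j t - F t) * l2_norm g) \<longlonglongrightarrow> 0 * l2_norm g"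
        by (intro tendsto_mult lim tendsto_const)
      ultimately have "cmod (l2_ip F g) \<le> 0 * l2_norm g" by (intro LIMSEQ_le_const) auto
      then show ?thesis by simp
    qed
    then have FR: "F \<in> L2_reduced" using F by (simp add: L2_reduced_def)
    have "limitin L.mtopology S (cauchy_fun F) sequentially"
      unfolding L.limit_metric_sequentially
    proof (intro conjI allI impI L_carrier_I[OF FR])
      fix \<epsilon> :: real assume "\<epsilon> > 0"
      then have "\<forall>\<^sub>F j in sequentially. l2_norm (\<lambda>t. f j t - F t) < \<epsilon>" using order_tendstoD(2)[OF lim] by blast
      then obtain N where N: "\<And>j. j \<ge> N \<Longrightarrow> l2_norm (\<lambda>t. f j t - F t) < \<epsilon>"
        unfolding eventually_sequentially by blast
      have "S j \<in> L_carrier \<and> L_dist (S j) (cauchy_fun F) < \<epsilon>" if "j \<ge> N" for j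
        unfolding f(2) L_dist_eq[OF f(1) FR] using N[OF that] L_carrier_I[OF f(1)] by blast
      then show "\<exists>N. \<forall>j\<ge>N. S j \<in> L_carrier \<and> L_dist (S j) (cauchy_fun F) < \<epsilon>" by blast
    qed
    then show "\<exists>x. limitin L.mtopology S x sequentially" by blast
  qed
qed

lemma cnj_cauchy_tr_one: "cnj (cauchy_tr (\<lambda>_. 1) z) = cauchy_tr (\<lambda>_. 1) (cnj z)"
  unfolding cauchy_tr_def by (subst Bochner_Integration.integral_cnj[symmetric]) simp

section \<open>Kernel and difference quotients of a Cauchy transform\<close>

context
  fixes m :: "complex \<Rightarrow> complex"
  assumes m: "\<And>z. Im z \<noteq> 0 \<Longrightarrow> m z = cauchy_tr (\<lambda>_. 1) z"
begin

text \<open>The second function \<open>m'\<close> lets one statement serve both \<open>m\<close> and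
  \<open>off_real m\<close>, which agree off the real axis.\<close>

lemma difference_quotient_limit:
  assumes z: "Im z \<noteq> 0" and m': "\<And>w. Im w \<noteq> 0 \<Longrightarrow> m' w = m w"
  shows "Lim (at z) (\<lambda>w. (m' w - m' z) / (w - z)) = cauchy_tr (cauchy_kernel z) z"
proof (rule tendsto_Lim)
  have ev: "\<forall>\<^sub>F w in at z. Im w \<noteq> 0"
    using tendsto_imp_eventually_ne[OF tendsto_Im[OF tendsto_ident_at] z] .
  show "((\<lambda>w. (m' w - m' z) / (w - z)) \<longlongrightarrow> cauchy_tr (cauchy_kernel z) z) (at z)"
    by (rule Lim_transform_eventually[OF cauchy_tr_difference_quotient[OF L2_const[of 1] z]],
        use ev in eventually_elim) (simp add: m m' z)
qed simp

text \<open>Since \<open>cnj (m w) = m (cnj w)\<close>, the kernel is a difference quotient of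
  \<open>m\<close> between \<open>z\<close> and \<open>cnj w\<close>, to which the resolvent
  identity applies. At \<open>z = cnj w\<close> the \<open>Lim\<close> is evaluated as a
  derivative.\<close>

lemma nev_kernel_eq:
  assumes z: "Im z \<noteq> 0" and w: "Im w \<noteq> 0"
  shows "nev_kernel m z w = cauchy_tr (cauchy_kernel (cnj w)) z"
proof (cases "z = cnj w")
  case True
  have "cnj (m w) = m z" using True z w by (simp add: m cnj_cauchy_tr_one)
  then show ?thesis using difference_quotient_limit[OF z, of m] True by (simp add: nev_kernel_def)
next
  case False
  have "cnj (m w) = cauchy_tr (\<lambda>_. 1) (cnj w)" using w by (simp add: m cnj_cauchy_tr_one)
  then show ?thesis using False cauchy_tr_increment[OF L2_const[of 1] z, of "cnj w"] z w
    by (simp add: nev_kernel_def m)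
qed

lemma diff_quot_eq:
  assumes z: "Im z \<noteq> 0"
  shows "diff_quot z (off_real m) = cauchy_fun (cauchy_kernel z)"
proof
  fix w
  have om: "off_real m w = m w" if "Im w \<noteq> 0" for w using that by (simp add: off_real_def)
  show "diff_quot z (off_real m) w = cauchy_fun (cauchy_kernel z) w"
  proof (cases "Im w = 0")
    case True
    then show ?thesis by (simp add: diff_quot_def cauchy_fun_def off_real_def)
  next
    case False
    show ?thesis
    proof (cases "w = z")
      case True
      then show ?thesis using False difference_quotient_limit[OF z om]
        by (simp add: diff_quot_def cauchy_fun_def off_real_def[of _ z])
    next
      case wz: False
      have "(off_real m w - off_real m z) / (w - z) = cauchy_tr (cauchy_kernel z) w"
        using cauchy_tr_increment[OF L2_const[of 1] False z] wz False z by (simp add: om m)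
      then show ?thesis using False wz by (simp add: diff_quot_def cauchy_fun_def off_real_def[of _ w])
    qed
  qed
qed

lemma kernel_section:
  assumes w: "Im w \<noteq> 0"
  shows "(\<lambda>z. if z \<in> nonreal then nev_kernel m z w else 0) = cauchy_fun (cauchy_kernel (cnj w))"
  by (auto simp: cauchy_fun_def off_real_def fun_eq_iff nev_kernel_eq w)

text \<open>The kernel section at \<open>w\<close> is the transform of
  \<open>cauchy_kernel (cnj w)\<close>, and pairing with that kernel is evaluation of the transform
  at \<open>w\<close>; the remaining axioms are carried over from L2.\<close>

lemma cauchy_L_space: "is_L_space m L_carrier L_ip"
  unfolding is_L_space_def
proof
  show "f x = 0" if "f \<in> L_carrier" "x \<notin> nonreal" for f x
    using that by (auto simp: L_carrier_def cauchy_fun_def off_real_def)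
  show "(\<lambda>x. 0) \<in> L_carrier"
    using L_carrier_I[OF reduced_scale[OF reduced_one, of 0]] by (simp add: cauchy_fun_scale[of 0, simplified])
  show "(\<lambda>x. f x + g x) \<in> L_carrier" if "f \<in> L_carrier" "g \<in> L_carrier" for f g
    using that by (auto elim!: L_carrier_E simp: cauchy_fun_add[symmetric] reduced_L2 intro!: L_carrier_I reduced_add)
  show "(\<lambda>x. c * f x) \<in> L_carrier" if "f \<in> L_carrier" for f c
    using that by (auto elim!: L_carrier_E simp: cauchy_fun_scale[symmetric] intro!: L_carrier_I reduced_scale)
  show "L_ip (\<lambda>x. f x + g x) h = L_ip f h + L_ip g h" if "f \<in> L_carrier" "g \<in> L_carrier" "h \<in> L_carrier" for f g h
    using that by (auto elim!: L_carrier_E simp: cauchy_fun_add[symmetric] reduced_L2 L_ip_eq reduced_add l2_ip_add)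
  show "L_ip (\<lambda>x. c * f x) h = c * L_ip f h" if "f \<in> L_carrier" "h \<in> L_carrier" for f h c
    using that by (auto elim!: L_carrier_E simp: cauchy_fun_scale[symmetric] L_ip_eq reduced_scale l2_ip_scale)
  show "L_ip g f = cnj (L_ip f g)" if "f \<in> L_carrier" "g \<in> L_carrier" for f g
    using that by (auto elim!: L_carrier_E simp: L_ip_eq intro: l2_ip_commute)
  show "0 \<le> Re (L_ip f f)" for f by (simp add: L_ip_def l2_ip_self)
  \<comment> \<open>Definiteness is contained in the zero axiom of the metric, applied to
    \<open>f\<close> and the zero function.\<close>
  show "f = (\<lambda>x. 0)" if f: "f \<in> L_carrier" and 0: "L_ip f f = 0" for f
  proof -
    interpret L: Metric_space L_carrier L_dist by (rule L_metric)
    have z: "(\<lambda>x. 0) \<in> L_carrier"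
      using L_carrier_I[OF reduced_scale[OF reduced_one, of 0]] by (simp add: cauchy_fun_scale[of 0, simplified])
    show ?thesis using L.zero[OF f z] 0 by simp
  qed
  show "Metric_space.mcomplete L_carrier L_dist" by (rule L_mcomplete)
  show "(\<lambda>z. if z \<in> nonreal then nev_kernel m z w else 0) \<in> L_carrier" if "w \<in> nonreal" for w
    using that by (subst kernel_section) (auto intro!: L_carrier_I reduced_kernel)
  show "L_ip f (\<lambda>z. if z \<in> nonreal then nev_kernel m z w else 0) = f w" if fH: "f \<in> L_carrier" and wX: "w \<in> nonreal" for f w
  proof -
    obtain g where g: "g \<in> L2_reduced" "f = cauchy_fun g" using fH by (rule L_carrier_E)
    have w: "Im w \<noteq> 0" using wX by simp
    show ?thesis unfolding kernel_section[OF w] g(2)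
      using L_ip_eq[OF g(1) reduced_kernel[of "cnj w"]] w
      by (simp add: cauchy_tr_conv_l2_ip[symmetric] cauchy_fun_def off_real_def)
  qed
qed

lemma cauchy_L_space_identity:
  "off_real m \<in> L_carrier"
  "Im z \<noteq> 0 \<Longrightarrow> diff_quot z (off_real m) \<in> L_carrier"
  "Im z \<noteq> 0 \<Longrightarrow> m z = L_ip (diff_quot z (off_real m)) (off_real m)"
proof -
  have om: "off_real m = cauchy_fun (\<lambda>_. 1)"
    by (auto simp: off_real_def cauchy_fun_def m fun_eq_iff)
  show "off_real m \<in> L_carrier" unfolding om by (rule L_carrier_I[OF reduced_one])
  assume z: "Im z \<noteq> 0"
  show "diff_quot z (off_real m) \<in> L_carrier"
    unfolding diff_quot_eq[OF z] by (rule L_carrier_I[OF reduced_kernel[OF z]])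
  show "m z = L_ip (diff_quot z (off_real m)) (off_real m)"
    unfolding diff_quot_eq[OF z] unfolding om L_ip_eq[OF reduced_kernel[OF z] reduced_one]
    by (simp add: m[OF z] l2_ip_def cauchy_tr_def)
qed

end

end

section \<open>Functions of the second kind\<close>

lemma Im_of_real_mult: "Im (of_real x * w) = x * Im w"
  by simp

lemma cpoly_add: "cpoly (q + r) z = cpoly q z + cpoly r z"
  unfolding cpoly_def poly_add[symmetric]
  by (intro arg_cong2[where f = poly] poly_eqI refl) (simp add: coeff_map_poly)

lemma cpoly_smult: "cpoly (Polynomial.smult c q) z = of_real c * cpoly q z"
  unfolding cpoly_def poly_smult[symmetric]
  by (intro arg_cong2[where f = poly] poly_eqI refl) (simp add: coeff_map_poly)

lemma cpoly_X_mult: "cpoly ([:0, 1:] * q) z = z * cpoly q z"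
  by (simp add: cpoly_def map_poly_pCons)

lemma cpoly_0: "cpoly 0 z = 0"
  by (simp add: cpoly_def)

text \<open>Isolates the consequences of Gram-Schmidt that the algebra of the \<open>q k\<close>
  relies on; the identity \<open>e = first_kind M\<close> returns only where the second-kind
  polynomials enter.\<close>

locale orthonormal_system =
  finite_borel_measure M for M :: "real measure" +
  fixes p :: nat and e :: "nat \<Rightarrow> real poly" and a b :: "nat \<Rightarrow> real" and n :: "complex \<Rightarrow> complex"
  assumes p: "p \<ge> 1"
    and moments: "\<And>k. k \<le> 2 * p \<Longrightarrow> integrable M (\<lambda>t. t ^ k)"
    and degree_e: "\<And>k. degree (e k) \<le> k"
    and orthonormal: "\<And>i k. i \<le> p \<Longrightarrow> k \<le> p \<Longrightarrow>
          (\<integral>t. poly (e i) t * poly (e k) t \<partial>M) = (if i = k then 1 else 0)"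
    and recurrence: "recurrence_coeffs e p a b"
    and n: "nevanlinna n" "\<And>z. Im z \<noteq> 0 \<Longrightarrow> n z = (\<integral>t. 1 / (of_real t - z) \<partial>M)"
begin

definition q :: "nat \<Rightarrow> complex \<Rightarrow> complex" where
  "q k z = (\<integral>t. of_real (poly (e k) t) / (of_real t - z) \<partial>M)"

lemma b_pos: "k < p \<Longrightarrow> b k > 0"
  using recurrence by (simp add: recurrence_coeffs_def)

lemma integrable_e: "k \<le> p \<Longrightarrow> integrable M (poly (e k))"
  using degree_e[of k] by (intro integrable_poly[of p] moments) auto

lemma integrable_e_e: "i \<le> p \<Longrightarrow> k \<le> p \<Longrightarrow> integrable M (\<lambda>t. poly (e i) t * poly (e k) t)"
  using degree_e[of k] degree_e[of i] by (intro integrable_poly_mult[of p] moments) auto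

lemma integrable_e_kernel:
  assumes "k \<le> p" "Im z \<noteq> 0"
  shows "integrable M (\<lambda>t. complex_of_real (poly (e k) t) / (of_real t - z))"
proof (rule Bochner_Integration.integrable_bound[where f = "\<lambda>t. (1 / \<bar>Im z\<bar>) * poly (e k) t"])
  show "integrable M (\<lambda>t. (1 / \<bar>Im z\<bar>) * poly (e k) t)" using integrable_e[OF assms(1)] by (rule integrable_mult_right)
  have [measurable]: "poly (e k) \<in> borel_measurable M" using integrable_e[OF assms(1)] by (rule borel_measurable_integrable)
  show "(\<lambda>t. complex_of_real (poly (e k) t) / (of_real t - z)) \<in> borel_measurable M" by measurable
  show "AE t in M. norm (complex_of_real (poly (e k) t) / (of_real t - z)) \<le> norm ((1 / \<bar>Im z\<bar>) * poly (e k) t)"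
  proof (rule AE_I2)
    fix t
    show "norm (complex_of_real (poly (e k) t) / (of_real t - z)) \<le> norm ((1 / \<bar>Im z\<bar>) * poly (e k) t)"
      using mult_right_mono[OF nonreal_kernel_bound[OF assms(2), of t], of "\<bar>poly (e k) t\<bar>"]
      by (simp add: norm_divide abs_mult)
  qed
qed

text \<open>The value \<open>1 / c\<close> is the inhomogeneous term of the recurrence for the
  \<open>q k\<close>; it follows from \<open>c * c\<close> times the total mass being 1.\<close>

lemma e_0: "\<exists>c. e 0 = [:c:] \<and> c \<noteq> 0 \<and> (\<forall>t. poly (e 0) t = c) \<and> (\<integral>t. poly (e 0) t \<partial>M) = 1 / c"
proof -
  obtain c where c: "e 0 = [:c:]" using degree_e[of 0] by (auto elim: degree_eq_zeroE)
  have *: "(\<integral>t. c * c \<partial>M) = 1" using orthonormal[of 0 0] c by simp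
  then have c0: "c \<noteq> 0" by auto
  have "(\<integral>t. poly (e 0) t \<partial>M) = 1 / c" using * c c0 by (simp add: field_simps)
  then show ?thesis using c c0 by auto
qed

lemma integral_e: "0 < k \<Longrightarrow> k \<le> p \<Longrightarrow> (\<integral>t. poly (e k) t \<partial>M) = 0"
  using orthonormal[of 0 k] e_0 by auto

lemma e_recurrence:
  assumes "k < p"
  shows "t * poly (e k) t = (if k = 0 then 0 else b (k - 1) * poly (e (k - 1)) t) + a k * poly (e k) t + b k * poly (e (k + 1)) t"
proof -
  have "poly ([:0, 1:] * e k) t = poly ((if k = 0 then 0 else Polynomial.smult (b (k - 1)) (e (k - 1)))
          + Polynomial.smult (a k) (e k) + Polynomial.smult (b k) (e (k + 1))) t"
    using recurrence assms unfolding recurrence_coeffs_def by metis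
  then show ?thesis by (auto simp del: mult_pCons_left)
qed

lemma cpoly_e_recurrence:
  assumes "k < p"
  shows "z * cpoly (e k) z = (if k = 0 then 0 else of_real (b (k - 1)) * cpoly (e (k - 1)) z) + of_real (a k) * cpoly (e k) z + of_real (b k) * cpoly (e (k + 1)) z"
proof -
  have "cpoly ([:0, 1:] * e k) z = cpoly ((if k = 0 then 0 else Polynomial.smult (b (k - 1)) (e (k - 1)))
          + Polynomial.smult (a k) (e k) + Polynomial.smult (b k) (e (k + 1))) z"
    using recurrence assms unfolding recurrence_coeffs_def by metis
  then show ?thesis unfolding cpoly_X_mult cpoly_add cpoly_smult by (auto simp: cpoly_smult cpoly_0)
qed

text \<open>Writing \<open>z / (t - z) = t / (t - z) - 1\<close> transfers the polynomial recurrence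
  and leaves the integral of \<open>e k\<close>, which by orthogonality to \<open>e 0\<close> is
  nonzero only for \<open>k = 0\<close>.\<close>

lemma q_recurrence:
  assumes k: "k < p" and z: "Im z \<noteq> 0"
  shows "z * q k z = (if k = 0 then 0 else of_real (b (k - 1)) * q (k - 1) z) + of_real (a k) * q k z + of_real (b k) * q (k + 1) z
           - of_real (\<integral>t. poly (e k) t \<partial>M)"
proof -
  let ?K = "\<lambda>k t. complex_of_real (poly (e k) t) / (of_real t - z)"
  have I: "integrable M (?K k)" "integrable M (?K (k - 1))" "integrable M (?K (k + 1))"
    using k by (auto intro!: integrable_e_kernel z)
  have I0: "integrable M (\<lambda>t. complex_of_real (poly (e k) t))" using integrable_e[of k] k by (intro integrable_of_real) simp
  have "z * ?K k t = (if k = 0 then 0 else of_real (b (k - 1)) * ?K (k - 1) t) + of_real (a k) * ?K k t + of_real (b k) * ?K (k + 1) t - of_real (poly (e k) t)" for t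
  proof -
    have nz: "complex_of_real t - z \<noteq> 0" by (rule nonreal_neq_of_real[OF z])
    have "z * ?K k t = of_real (t * poly (e k) t) / (of_real t - z) - of_real (poly (e k) t)"
      using nz by (simp add: field_simps)
    then show ?thesis unfolding e_recurrence[OF k] by (simp add: add_divide_distrib)
  qed
  then have "(\<integral>t. z * ?K k t \<partial>M) = (\<integral>t. (if k = 0 then 0 else of_real (b (k - 1)) * ?K (k - 1) t) + of_real (a k) * ?K k t + of_real (b k) * ?K (k + 1) t - of_real (poly (e k) t) \<partial>M)"
    by simp
  also have "\<dots> = (\<integral>t. (if k = 0 then 0 else of_real (b (k - 1)) * ?K (k - 1) t) \<partial>M) + (\<integral>t. of_real (a k) * ?K k t \<partial>M) + (\<integral>t. of_real (b k) * ?K (k + 1) t \<partial>M) - (\<integral>t. of_real (poly (e k) t) \<partial>M)"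
    using I I0 by (cases "k = 0") (simp_all only: simp_thms if_True if_False Bochner_Integration.integral_diff Bochner_Integration.integral_add Bochner_Integration.integrable_add integrable_mult_right integrable_zero)
  also have "(\<integral>t. (if k = 0 then 0 else of_real (b (k - 1)) * ?K (k - 1) t) \<partial>M) = (if k = 0 then 0 else of_real (b (k - 1)) * q (k - 1) z)"
    by (cases "k = 0") (simp_all only: simp_thms if_True if_False integral_mult_right_zero q_def integral_zero)
  also have "(\<integral>t. z * ?K k t \<partial>M) = z * q k z" unfolding q_def by (rule integral_mult_right_zero)
  also have "(\<integral>t. of_real (a k) * ?K k t \<partial>M) = of_real (a k) * q k z" unfolding q_def by (rule integral_mult_right_zero)
  also have "(\<integral>t. of_real (b k) * ?K (k + 1) t \<partial>M) = of_real (b k) * q (k + 1) z" unfolding q_def by (rule integral_mult_right_zero)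
  also have "(\<integral>t. complex_of_real (poly (e k) t) \<partial>M) = of_real (\<integral>t. poly (e k) t \<partial>M)" by (rule integral_complex_of_real)
  finally show ?thesis .
qed

lemma q_0:
  assumes "Im z \<noteq> 0" shows "q 0 z = cpoly (e 0) z * n z"
proof -
  obtain c where c: "e 0 = [:c:]" "\<And>t. poly (e 0) t = c" using e_0 by blast
  have "q 0 z = (\<integral>t. of_real c * (1 / (of_real t - z)) \<partial>M)" unfolding q_def c(2) by simp
  also have "\<dots> = of_real c * n z" unfolding n(2)[OF assms] by (rule integral_mult_right_zero)
  finally show ?thesis by (simp add: c(1) cpoly_def map_poly_pCons)
qed

text \<open>For positive index \<open>e k\<close> and \<open>q k\<close> satisfy the same
  recurrence, so the weighted Casorati determinant does not depend on \<open>k\<close>; its value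
  comes from the inhomogeneity at index 0.\<close>

lemma wronskian:
  assumes z: "Im z \<noteq> 0" and "k < p"
  shows "of_real (b k) * (cpoly (e (k + 1)) z * q k z - cpoly (e k) z * q (k + 1) z) = -1"
  using \<open>k < p\<close>
proof (induction k)
  case 0
  obtain c where c: "e 0 = [:c:]" "c \<noteq> 0" "(\<integral>t. poly (e 0) t \<partial>M) = 1 / c" using e_0 by blast
  have ce: "cpoly (e 0) z = of_real c" by (simp add: c(1) cpoly_def map_poly_pCons)
  have 1: "of_real (b 0) * cpoly (e 1) z = z * cpoly (e 0) z - of_real (a 0) * cpoly (e 0) z"
    using cpoly_e_recurrence[OF 0, of z] by (simp add: algebra_simps)
  have 2: "of_real (b 0) * q 1 z = z * q 0 z - of_real (a 0) * q 0 z + of_real (1 / c)"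
    using q_recurrence[OF 0 z] c(3) by (simp add: algebra_simps)
  have "of_real (b 0) * (cpoly (e 1) z * q 0 z - cpoly (e 0) z * q 1 z) =
      (of_real (b 0) * cpoly (e 1) z) * q 0 z - cpoly (e 0) z * (of_real (b 0) * q 1 z)" by (simp add: algebra_simps)
  also have "\<dots> = - (cpoly (e 0) z * of_real (1 / c))" unfolding 1 2 by (simp add: algebra_simps)
  also have "\<dots> = -1" unfolding ce using c(2) by simp
  finally show ?case by simp
next
  case (Suc k)
  have 1: "of_real (b (Suc k)) * cpoly (e (Suc k + 1)) z = z * cpoly (e (Suc k)) z - of_real (b k) * cpoly (e k) z - of_real (a (Suc k)) * cpoly (e (Suc k)) z"
    using cpoly_e_recurrence[OF Suc.prems, of z] by (simp add: algebra_simps)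
  have 2: "of_real (b (Suc k)) * q (Suc k + 1) z = z * q (Suc k) z - of_real (b k) * q k z - of_real (a (Suc k)) * q (Suc k) z"
    using q_recurrence[OF Suc.prems z] integral_e[of "Suc k"] Suc.prems by (simp add: algebra_simps)
  have "of_real (b (Suc k)) * (cpoly (e (Suc k + 1)) z * q (Suc k) z - cpoly (e (Suc k)) z * q (Suc k + 1) z) =
      (of_real (b (Suc k)) * cpoly (e (Suc k + 1)) z) * q (Suc k) z - cpoly (e (Suc k)) z * (of_real (b (Suc k)) * q (Suc k + 1) z)" by (simp add: algebra_simps)
  also have "\<dots> = of_real (b k) * (cpoly (e (k + 1)) z * q k z - cpoly (e k) z * q (k + 1) z)"
    unfolding 1 2 by (simp add: algebra_simps)
  finally show ?case using Suc by simp
qed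

text \<open>The \<open>q i z\<close> are the Fourier coefficients of \<open>1 / (t - z)\<close> with
  respect to the \<open>e i\<close>, and the squared norm of this function is
  \<open>Im (n z) / Im z\<close> because
  \<open>Im (1 / (t - z)) = Im z * |1 / (t - z)|^2\<close>.\<close>

lemma bessel:
  assumes z: "Im z \<noteq> 0" and k: "k \<le> p"
  shows "(\<Sum>i\<le>k. (cmod (q i z))\<^sup>2) \<le> Im (n z) / Im z"
proof -
  let ?h = "\<lambda>t. 1 / (complex_of_real t - z)"
  let ?s = "\<lambda>t. \<Sum>i\<le>k. q i z * of_real (poly (e i) t)"
  define S where "S = (\<Sum>i\<le>k. (cmod (q i z))\<^sup>2)"
  have ip: "i \<le> p" if "i \<in> {..k}" for i using that k by simp
  have I1: "integrable M (\<lambda>t. (cmod (?h t))\<^sup>2)" by (rule L2_sq[OF L2_kernel[OF z]])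
  have I2: "integrable M (\<lambda>t. \<Sum>i\<le>k. cnj (q i z) * (of_real (poly (e i) t) / (of_real t - z)))"
    by (intro Bochner_Integration.integrable_sum integrable_mult_right integrable_e_kernel z ip)
  have I3: "integrable M (\<lambda>t. \<Sum>i\<le>k. \<Sum>j\<le>k. q i z * cnj (q j z) * of_real (poly (e i) t * poly (e j) t))"
    by (intro Bochner_Integration.integrable_sum integrable_mult_right integrable_of_real integrable_e_e ip)
  have A1: "(\<integral>t. (cmod (?h t))\<^sup>2 \<partial>M) = Im (n z) / Im z"
  proof -
    have "(cmod (?h t))\<^sup>2 = Im (?h t) / Im z" for t
      using z by (simp add: Im_divide norm_divide power_divide cmod_power2)
    then have "(\<integral>t. (cmod (?h t))\<^sup>2 \<partial>M) = (\<integral>t. Im (?h t) / Im z \<partial>M)" by simp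
    also have "\<dots> = (\<integral>t. Im (?h t) \<partial>M) / Im z" by (rule integral_divide_zero)
    also have "(\<integral>t. Im (?h t) \<partial>M) = Im (\<integral>t. ?h t \<partial>M)" by (rule integral_Im[OF integrable_cauchy_kernel[OF z]])
    finally show ?thesis by (simp add: n(2)[OF z])
  qed
  have A2: "(\<integral>t. (\<Sum>i\<le>k. cnj (q i z) * (of_real (poly (e i) t) / (of_real t - z))) \<partial>M) = of_real S"
  proof -
    have "(\<integral>t. (\<Sum>i\<le>k. cnj (q i z) * (of_real (poly (e i) t) / (of_real t - z))) \<partial>M) =
       (\<Sum>i\<le>k. \<integral>t. cnj (q i z) * (of_real (poly (e i) t) / (of_real t - z)) \<partial>M)"
      by (intro Bochner_Integration.integral_sum integrable_mult_right integrable_e_kernel z ip)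
    also have "\<dots> = (\<Sum>i\<le>k. cnj (q i z) * q i z)"
      by (intro sum.cong refl) (unfold q_def, rule integral_mult_right_zero)
    also have "\<dots> = of_real S" unfolding S_def of_real_sum complex_norm_square by (simp add: mult.commute)
    finally show ?thesis .
  qed
  have A3: "(\<integral>t. (\<Sum>i\<le>k. \<Sum>j\<le>k. q i z * cnj (q j z) * of_real (poly (e i) t * poly (e j) t)) \<partial>M) = of_real S"
  proof -
    have "(\<integral>t. (\<Sum>i\<le>k. \<Sum>j\<le>k. q i z * cnj (q j z) * of_real (poly (e i) t * poly (e j) t)) \<partial>M) =
      (\<Sum>i\<le>k. \<integral>t. (\<Sum>j\<le>k. q i z * cnj (q j z) * of_real (poly (e i) t * poly (e j) t)) \<partial>M)"
      by (intro Bochner_Integration.integral_sum Bochner_Integration.integrable_sum integrable_mult_right integrable_of_real integrable_e_e ip)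
    also have "\<dots> = (\<Sum>i\<le>k. \<Sum>j\<le>k. \<integral>t. q i z * cnj (q j z) * of_real (poly (e i) t * poly (e j) t) \<partial>M)"
      by (intro sum.cong refl Bochner_Integration.integral_sum integrable_mult_right integrable_of_real integrable_e_e ip)
    also have "\<dots> = (\<Sum>i\<le>k. \<Sum>j\<le>k. if j = i then q i z * cnj (q i z) else 0)"
    proof (intro sum.cong refl)
      fix i j assume "i \<in> {..k}" "j \<in> {..k}"
      then have o: "(\<integral>t. poly (e i) t * poly (e j) t \<partial>M) = (if i = j then 1 else 0)" by (intro orthonormal ip)
      have "(\<integral>t. q i z * cnj (q j z) * of_real (poly (e i) t * poly (e j) t) \<partial>M) = q i z * cnj (q j z) * (\<integral>t. of_real (poly (e i) t * poly (e j) t) \<partial>M)"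
        by (rule integral_mult_right_zero)
      also have "(\<integral>t. complex_of_real (poly (e i) t * poly (e j) t) \<partial>M) = of_real (\<integral>t. poly (e i) t * poly (e j) t \<partial>M)"
        by (rule integral_complex_of_real)
      also have "q i z * cnj (q j z) * of_real (\<integral>t. poly (e i) t * poly (e j) t \<partial>M) = (if j = i then q i z * cnj (q i z) else 0)"
        unfolding o by simp
      finally show "(\<integral>t. q i z * cnj (q j z) * of_real (poly (e i) t * poly (e j) t) \<partial>M) = (if j = i then q i z * cnj (q i z) else 0)" .
    qed
    also have "\<dots> = of_real S" unfolding S_def of_real_sum complex_norm_square by simp
    finally show ?thesis .
  qed
  have expand: "(cmod (?h t - ?s t))\<^sup>2 = (cmod (?h t))\<^sup>2
      - 2 * Re (\<Sum>i\<le>k. cnj (q i z) * (of_real (poly (e i) t) / (of_real t - z)))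
      + Re (\<Sum>i\<le>k. \<Sum>j\<le>k. q i z * cnj (q j z) * of_real (poly (e i) t * poly (e j) t))" for t
  proof -
    have polar: "(cmod (x - y))\<^sup>2 = (cmod x)\<^sup>2 - 2 * Re (x * cnj y) + Re (y * cnj y)" for x y :: complex
      by (simp only: cmod_power2) (simp add: power2_eq_square algebra_simps)
    have hs: "?h t * cnj (?s t) = (\<Sum>i\<le>k. cnj (q i z) * (of_real (poly (e i) t) / (of_real t - z)))"
      by (simp add: sum_divide_distrib sum_distrib_left)
    have ss: "?s t * cnj (?s t) = (\<Sum>i\<le>k. \<Sum>j\<le>k. q i z * cnj (q j z) * of_real (poly (e i) t * poly (e j) t))"
      by (simp add: sum_product mult_ac)
    show ?thesis unfolding polar hs ss ..
  qed
  have "0 \<le> (\<integral>t. (cmod (?h t - ?s t))\<^sup>2 \<partial>M)" by simp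
  also have "\<dots> = (\<integral>t. (cmod (?h t))\<^sup>2 \<partial>M)
      - 2 * (\<integral>t. Re (\<Sum>i\<le>k. cnj (q i z) * (of_real (poly (e i) t) / (of_real t - z))) \<partial>M)
      + (\<integral>t. Re (\<Sum>i\<le>k. \<Sum>j\<le>k. q i z * cnj (q j z) * of_real (poly (e i) t * poly (e j) t)) \<partial>M)"
    unfolding expand
    using I1 integrable_Re[OF I2] integrable_Re[OF I3] by (simp only: Bochner_Integration.integral_add Bochner_Integration.integral_diff Bochner_Integration.integrable_diff integrable_mult_right integral_mult_right_zero)
  also have "\<dots> = Im (n z) / Im z - 2 * S + S"
    unfolding A1 integral_Re[OF I2] integral_Re[OF I3] A2 A3 by simp
  finally show ?thesis by (simp add: S_def)
qed

text \<open>A Christoffel-Darboux type identity. Multiplying the recurrence by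
  \<open>cnj (q k z)\<close> and taking imaginary parts removes the real \<open>a k\<close>; each
  index contributes \<open>Im z * |q k|^2\<close>, and index 0 contributes
  \<open>- Im n\<close>.\<close>

lemma q_quadratic_form:
  assumes z: "Im z \<noteq> 0" and k: "k < p"
  shows "b k * Im (q (k + 1) z * cnj (q k z)) = Im z * (\<Sum>i\<le>k. (cmod (q i z))\<^sup>2) - Im (n z)"
  using k
proof (induction k)
  case 0
  obtain c where c: "e 0 = [:c:]" "c \<noteq> 0" "(\<integral>t. poly (e 0) t \<partial>M) = 1 / c" using e_0 by blast
  have q0: "q 0 z = of_real c * n z" using q_0[OF z] by (simp add: c(1) cpoly_def map_poly_pCons)
  have 2: "of_real (b 0) * q 1 z = (z - of_real (a 0)) * q 0 z + of_real (1 / c)"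
    using q_recurrence[OF 0 z] c(3) by (simp add: algebra_simps)
  have "b 0 * Im (q 1 z * cnj (q 0 z)) = Im ((of_real (b 0) * q 1 z) * cnj (q 0 z))"
    by (simp only: mult.assoc Im_of_real_mult)
  also have "\<dots> = Im ((z - of_real (a 0)) * (q 0 z * cnj (q 0 z)) + of_real (1 / c) * cnj (q 0 z))"
    unfolding 2 by (simp add: algebra_simps)
  also have "\<dots> = Im z * (cmod (q 0 z))\<^sup>2 + Im (of_real (1 / c) * cnj (q 0 z))"
    unfolding complex_norm_square[symmetric] by simp
  also have "of_real (1 / c) * cnj (q 0 z) = cnj (n z)" unfolding q0 using c(2) by simp
  finally show ?case by simp
next
  case (Suc k)
  have 2: "of_real (b (Suc k)) * q (Suc k + 1) z = (z - of_real (a (Suc k))) * q (Suc k) z - of_real (b k) * q k z"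
    using q_recurrence[OF Suc.prems z] integral_e[of "Suc k"] Suc.prems by (simp add: algebra_simps)
  have "b (Suc k) * Im (q (Suc k + 1) z * cnj (q (Suc k) z)) = Im ((of_real (b (Suc k)) * q (Suc k + 1) z) * cnj (q (Suc k) z))"
    by (simp only: mult.assoc Im_of_real_mult)
  also have "\<dots> = Im ((z - of_real (a (Suc k))) * (q (Suc k) z * cnj (q (Suc k) z)) - of_real (b k) * (q k z * cnj (q (Suc k) z)))"
    unfolding 2 by (simp add: algebra_simps)
  also have "\<dots> = Im z * (cmod (q (Suc k) z))\<^sup>2 - b k * Im (q k z * cnj (q (Suc k) z))"
    unfolding complex_norm_square[symmetric] by simp
  also have "Im (q k z * cnj (q (Suc k) z)) = - Im (q (k + 1) z * cnj (q k z))" by simp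
  finally show ?case using Suc by (simp add: algebra_simps)
qed

text \<open>Bessel runs to \<open>p\<close>, one index beyond the sum in the quadratic form; the
  surplus term is the right-hand side.\<close>

lemma q_form_bound:
  assumes z: "Im z > 0"
  shows "b (p - 1) * Im (q p z * cnj (q (p - 1) z)) \<le> - Im z * (cmod (q p z))\<^sup>2"
proof -
  have "Im z * (\<Sum>i\<le>p. (cmod (q i z))\<^sup>2) \<le> Im z * (Im (n z) / Im z)"
    using bessel[of z p] z by (intro mult_left_mono) auto
  moreover have "(\<Sum>i\<le>p. (cmod (q i z))\<^sup>2) = (\<Sum>i\<le>p - 1. (cmod (q i z))\<^sup>2) + (cmod (q p z))\<^sup>2"
    using p by (cases p) auto
  moreover have "b (p - 1) * Im (q p z * cnj (q (p - 1) z)) = Im z * (\<Sum>i\<le>p - 1. (cmod (q i z))\<^sup>2) - Im (n z)"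
    using q_quadratic_form[of z "p - 1"] z p by simp
  ultimately show ?thesis using z by (simp add: algebra_simps)
qed

lemma q_cnj: "q k (cnj z) = cnj (q k z)"
  unfolding q_def by (subst Bochner_Integration.integral_cnj[symmetric]) simp

text \<open>At a zero of \<open>q (p - 1)\<close> in the upper half plane the form bound forces
  \<open>q p\<close> to vanish as well, contradicting the Wronskian. Conjugation settles the lower
  half plane.\<close>

lemma q_nonzero:
  assumes z: "Im z \<noteq> 0" shows "q (p - 1) z \<noteq> 0"
proof -
  have *: "q (p - 1) z \<noteq> 0" if z: "Im z > 0" for z
  proof
    assume 0: "q (p - 1) z = 0"
    have "Im z * (cmod (q p z))\<^sup>2 \<le> 0" using q_form_bound[OF z] 0 by simp
    then have "q p z = 0" using z by (simp add: mult_le_0_iff)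
    then show False using wronskian[of z "p - 1"] 0 p z by simp
  qed
  show ?thesis
  proof (cases "Im z > 0")
    case False
    then have "q (p - 1) (cnj z) \<noteq> 0" using z by (intro *) simp
    then show ?thesis by (simp add: q_cnj)
  qed (rule *)
qed

text \<open>Analyticity is inherited from \<open>n\<close> through the recurrence, which avoids
  differentiation under the integral.\<close>

lemma q_analytic:
  assumes "k \<le> p" shows "q k analytic_on {z. Im z > 0}"
proof -
  have op: "open {z. Im z > 0}" by (rule open_halfspace_Im_gt)
  have hn: "n holomorphic_on {z. Im z > 0}" using n(1) by (simp add: nevanlinna_def analytic_imp_holomorphic)
  have h0: "q 0 holomorphic_on {z. Im z > 0}"
  proof -
    obtain c where c: "e 0 = [:c:]" using e_0 by blast
    have "(\<lambda>z. of_real c * n z) holomorphic_on {z. Im z > 0}" by (intro holomorphic_intros hn)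
    then show ?thesis
      by (rule holomorphic_transform) (simp add: q_0 c cpoly_def map_poly_pCons)
  qed
  have step: "q (Suc k) holomorphic_on {z. Im z > 0}"
    if k: "k < p" and h: "q k holomorphic_on {z. Im z > 0}" and h': "k \<noteq> 0 \<Longrightarrow> q (k - 1) holomorphic_on {z. Im z > 0}" for k
  proof -
    define I where "I = complex_of_real (\<integral>t. poly (e k) t \<partial>M)"
    have "(\<lambda>z. (z * q k z - (if k = 0 then 0 else of_real (b (k - 1)) * q (k - 1) z) - of_real (a k) * q k z + I) / of_real (b k)) holomorphic_on {z. Im z > 0}"
      using b_pos[OF k] h h' by (cases "k = 0") (auto intro!: holomorphic_intros)
    then show ?thesis
    proof (rule holomorphic_transform)
      fix z :: complex assume "z \<in> {z. Im z > 0}"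
      then have "z * q k z - (if k = 0 then 0 else of_real (b (k - 1)) * q (k - 1) z) - of_real (a k) * q k z + I = of_real (b k) * q (Suc k) z"
        using q_recurrence[OF k, of z] unfolding I_def by (simp add: algebra_simps)
      then show "(z * q k z - (if k = 0 then 0 else of_real (b (k - 1)) * q (k - 1) z) - of_real (a k) * q k z + I) / of_real (b k) = q (Suc k) z"
        using b_pos[OF k] by simp
    qed
  qed
  have "q k holomorphic_on {z. Im z > 0}" using assms
  proof (induction k rule: less_induct)
    case (less k)
    show ?case
    proof (cases k)
      case 0
      then show ?thesis using h0 by simp
    next
      case (Suc j)
      show ?thesis unfolding Suc by (rule step) (use less Suc in auto)
    qed
  qed
  then show ?thesis using op by (simp add: analytic_on_open)
qed

section \<open>The Nevanlinna function \<open>m\<close> and the fractional formula\<close>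

definition m :: "complex \<Rightarrow> complex" where
  "m z = - of_real (b (p - 1)) * q p z / q (p - 1) z"

text \<open>Where \<open>m\<close> is nonzero this says that \<open>- 1 / m(z) - z / b^2\<close>,
  with \<open>b\<close> the last coefficient, has nonnegative imaginary part. It is
  \<open>q_form_bound\<close> divided by \<open>|q (p - 1)|^2\<close> and multiplied by
  \<open>b^2\<close>.\<close>

lemma m_estimate:
  assumes z: "Im z > 0"
  shows "Im z * (cmod (m z))\<^sup>2 \<le> (b (p - 1))\<^sup>2 * Im (m z)"
proof -
  have bp: "b (p - 1) > 0" using b_pos p by simp
  have q0: "cmod (q (p - 1) z) > 0" using q_nonzero z by simp
  have "m z = - of_real (b (p - 1)) * (q p z * cnj (q (p - 1) z)) / of_real ((cmod (q (p - 1) z))\<^sup>2)"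
    using q0 unfolding m_def complex_norm_square by simp
  then have "Im (m z) = - (b (p - 1) * Im (q p z * cnj (q (p - 1) z))) / (cmod (q (p - 1) z))\<^sup>2"
    by (simp only: Im_divide_of_real) simp
  moreover have "Im z * (cmod (q p z))\<^sup>2 / (cmod (q (p - 1) z))\<^sup>2 \<le>
      - (b (p - 1) * Im (q p z * cnj (q (p - 1) z))) / (cmod (q (p - 1) z))\<^sup>2"
    using q_form_bound[OF z] by (intro divide_right_mono) auto
  ultimately have "(b (p - 1))\<^sup>2 * (Im z * (cmod (q p z))\<^sup>2 / (cmod (q (p - 1) z))\<^sup>2) \<le> (b (p - 1))\<^sup>2 * Im (m z)"
    by (intro mult_left_mono) auto
  moreover have "Im z * (cmod (m z))\<^sup>2 = (b (p - 1))\<^sup>2 * (Im z * (cmod (q p z))\<^sup>2 / (cmod (q (p - 1) z))\<^sup>2)"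
    unfolding m_def by (simp add: norm_divide norm_mult power_divide power_mult_distrib)
  ultimately show ?thesis by simp
qed

lemma m_nevanlinna: "nevanlinna m"
  unfolding nevanlinna_def
proof (intro conjI allI impI)
  show "m analytic_on {z. Im z > 0}"
    unfolding m_def using q_nonzero
    by (intro analytic_intros q_analytic) auto
  show "Im (m z) \<ge> 0" if "Im z > 0" for z
  proof -
    have "0 \<le> Im z * (cmod (m z))\<^sup>2" using that by simp
    also have "\<dots> \<le> (b (p - 1))\<^sup>2 * Im (m z)" by (rule m_estimate[OF that])
    finally show ?thesis using b_pos[of "p - 1"] p by (simp add: zero_le_mult_iff)
  qed
  show "m z = cnj (m (cnj z))" if "Im z < 0" for z by (simp add: m_def q_cnj)
qed

text \<open>Combining the quadratic estimate with \<open>Im m <= |m|\<close> and cancelling one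
  factor \<open>|m|\<close> leaves decay like \<open>1 / Im z\<close>, as the representation theorem
  needs.\<close>

lemma m_bound:
  assumes z: "Im z > 0" shows "Im z * cmod (m z) \<le> (b (p - 1))\<^sup>2"
proof (cases "m z = 0")
  case False
  have "(Im z * cmod (m z)) * cmod (m z) \<le> (b (p - 1))\<^sup>2 * Im (m z)"
    using m_estimate[OF z] by (simp add: power2_eq_square mult.assoc)
  also have "\<dots> \<le> (b (p - 1))\<^sup>2 * cmod (m z)"
    using abs_Im_le_cmod[of "m z"] by (intro mult_left_mono) auto
  finally show ?thesis using False by simp
qed simp

lemma m_representation: "\<exists>\<rho>. cauchy_represents \<rho> m"
proof (rule nevanlinna_cauchy_representation[OF m_nevanlinna])
  show "\<forall>\<^sub>F y in at_top. y * cmod (m (\<i> * of_real y)) \<le> (b (p - 1))\<^sup>2"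
    using eventually_gt_at_top[of 0]
  proof eventually_elim
    case (elim y)
    then show ?case using m_bound[of "\<i> * of_real y"] by simp
  qed
qed

lemma second_kind_eq:
  assumes e: "e = first_kind M" and z: "Im z \<noteq> 0" and k: "k \<le> p"
  shows "second_kind M k z = q k z - n z * cpoly (e k) z"
proof -
  have "second_kind M k z = (\<integral>t. of_real (poly (e k) t) / (of_real t - z) - cpoly (e k) z * (1 / (of_real t - z)) \<partial>M)"
    unfolding second_kind_def e[symmetric]
  proof (rule Bochner_Integration.integral_cong[OF refl])
    fix t
    have "complex_of_real t - z \<noteq> 0" "z - of_real t \<noteq> 0" using nonreal_neq_of_real[OF z, of t] by auto
    then show "(cpoly (e k) z - of_real (poly (e k) t)) / (z - of_real t) = of_real (poly (e k) t) / (of_real t - z) - cpoly (e k) z * (1 / (of_real t - z))"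
      by (simp add: divide_simps) (simp add: algebra_simps)
  qed
  also have "\<dots> = q k z - (\<integral>t. cpoly (e k) z * (1 / (of_real t - z)) \<partial>M)"
    unfolding q_def by (intro Bochner_Integration.integral_diff integrable_e_kernel[OF k z] integrable_mult_right integrable_cauchy_kernel[OF z])
  also have "(\<integral>t. cpoly (e k) z * (1 / (of_real t - z)) \<partial>M) = cpoly (e k) z * n z"
    unfolding n(2)[OF z] by (rule integral_mult_right_zero)
  finally show ?thesis by (simp add: mult.commute)
qed

text \<open>The denominator times \<open>q (p - 1)\<close> is the Wronskian expression, hence -1.
  The definition of \<open>m\<close> makes \<open>q (p - 1) * m + b * q p\<close> zero; substituting
  \<open>q k = n * e k + d k\<close> turns this into the formula.\<close>

lemma m_fraction:
  assumes e: "e = first_kind M" and z: "Im z \<noteq> 0"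
  shows "cpoly (e (p - 1)) z * m z + of_real (b (p - 1)) * cpoly (e p) z \<noteq> 0"
    and "n z = - ((second_kind M (p - 1) z * m z + of_real (b (p - 1)) * second_kind M p z) /
                (cpoly (e (p - 1)) z * m z + of_real (b (p - 1)) * cpoly (e p) z))"
proof -
  let ?D = "cpoly (e (p - 1)) z * m z + of_real (b (p - 1)) * cpoly (e p) z"
  have q0: "q (p - 1) z \<noteq> 0" by (rule q_nonzero[OF z])
  have "?D * q (p - 1) z = of_real (b (p - 1)) * (cpoly (e p) z * q (p - 1) z - cpoly (e (p - 1)) z * q p z)"
    using q0 by (simp add: m_def field_simps)
  also have "\<dots> = -1" using wronskian[OF z, of "p - 1"] p by simp
  finally show D: "?D \<noteq> 0" by auto
  have "q (p - 1) z * m z + of_real (b (p - 1)) * q p z = 0" using q0 by (simp add: m_def)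
  then have "second_kind M (p - 1) z * m z + of_real (b (p - 1)) * second_kind M p z = - n z * ?D"
    unfolding second_kind_eq[OF e z le_refl] second_kind_eq[OF e z diff_le_self] by (simp add: algebra_simps)
  then show "n z = - ((second_kind M (p - 1) z * m z + of_real (b (p - 1)) * second_kind M p z) / ?D)"
    using D by simp
qed

end

theorem theorem8p3:
  fixes p :: nat
    and n :: "complex \<Rightarrow> complex"
    and s a b :: "nat \<Rightarrow> real"
    and \<sigma> :: "real measure"
    and e :: "nat \<Rightarrow> real poly"
    and d :: "nat \<Rightarrow> complex \<Rightarrow> complex"
  assumes "p \<ge> 1"
    and "nevanlinna n"
    and "property1 p n s \<or> property2 p n s \<or> property3 p n s"
    and "hankel_det s p \<noteq> 0"
    and "\<sigma> = spectral_measure n"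
    and "e = first_kind \<sigma>"
    and "d = second_kind \<sigma>"
    and "recurrence_coeffs e p a b"
  shows "\<exists>m. nevanlinna m \<and>
    (\<forall>z\<in>nonreal.
       cpoly (e (p - 1)) z * m z + of_real (b (p - 1)) * cpoly (e p) z \<noteq> 0 \<and>
       n z = - ((d (p - 1) z * m z + of_real (b (p - 1)) * d p z) /
                (cpoly (e (p - 1)) z * m z + of_real (b (p - 1)) * cpoly (e p) z))) \<and>
    (\<exists>H ip. is_L_space m H ip \<and> off_real m \<in> H \<and>
       (\<forall>z\<in>nonreal. diff_quot z (off_real m) \<in> H \<and>
          m z = ip (diff_quot z (off_real m)) (off_real m)))"
proof -
  have asy: "property1 p n s" by (rule property_imp_property1[OF assms(3)])
  \<comment> \<open>Here the choice in \<open>spectral_measure\<close> becomes meaningful: the order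
    0 asymptotics supply the bound from which a representing measure exists.\<close>
  have rep: "cauchy_represents \<sigma> n"
    unfolding assms(5) spectral_measure_def
    by (rule someI_ex[OF nevanlinna_cauchy_representation[OF assms(2) bounded_along_imaginary_axis[OF asy]]])
  have mom: "integrable \<sigma> (\<lambda>t. t ^ k)" "(\<integral>t. t ^ k \<partial>\<sigma>) = s k" if "k \<le> 2 * p" for k
    using moments_of_expansion[OF rep asy that] by auto
  have fin: "finite_measure \<sigma>" using rep by (simp add: cauchy_represents_def)
  have pos: "measure \<sigma> (space \<sigma>) > 0" by (rule total_mass_pos[OF assms(4) mom(2) fin])
  have rec: "recurrence_coeffs (first_kind \<sigma>) p a b" using assms(6,8) by simp
  have nz: "first_kind \<sigma> k \<noteq> 0" if "k \<le> p" for k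
    by (rule first_kind_nonzero[OF mom(1) rec pos that])
  interpret finite_borel_measure \<sigma>
    using rep by (simp add: cauchy_represents_def finite_borel_measure_def finite_borel_measure_axioms_def)
  interpret \<sigma>: orthonormal_system \<sigma> p e a b n
  proof (intro orthonormal_system.intro orthonormal_system_axioms.intro finite_borel_measure_axioms)
    show "degree (e k) \<le> k" for k unfolding assms(6) by (rule degree_first_kind_le)
    show "(\<integral>t. poly (e i) t * poly (e k) t \<partial>\<sigma>) = (if i = k then 1 else 0)" if "i \<le> p" "k \<le> p" for i k
      unfolding assms(6) by (rule first_kind_orthonormal[OF mom(1) nz that])
    show "n z = (\<integral>t. 1 / (of_real t - z) \<partial>\<sigma>)" if "Im z \<noteq> 0" for z
      using rep that by (simp add: cauchy_represents_def)
  qed (use assms mom in auto)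
  \<comment> \<open>A second measure, representing \<open>m\<close> rather than \<open>n\<close>;
    the required space is built over its L2.\<close>
  obtain \<rho> where \<rho>: "cauchy_represents \<rho> \<sigma>.m" using \<sigma>.m_representation by blast
  interpret \<rho>: finite_borel_measure \<rho>
    using \<rho> by (simp add: cauchy_represents_def finite_borel_measure_def finite_borel_measure_axioms_def)
  have m: "\<sigma>.m z = \<rho>.cauchy_tr (\<lambda>_. 1) z" if "Im z \<noteq> 0" for z
    using \<rho> that by (simp add: cauchy_represents_def \<rho>.cauchy_tr_def)
  show ?thesis
  proof (intro exI[of _ \<sigma>.m] conjI \<sigma>.m_nevanlinna ballI exI[of _ \<rho>.L_carrier] exI[of _ \<rho>.L_ip])
    show "is_L_space \<sigma>.m \<rho>.L_carrier \<rho>.L_ip" by (rule \<rho>.cauchy_L_space[OF m])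
    show "off_real \<sigma>.m \<in> \<rho>.L_carrier" by (rule \<rho>.cauchy_L_space_identity(1)[OF m])
    fix z assume "z \<in> nonreal"
    then have z: "Im z \<noteq> 0" by simp
    show "cpoly (e (p - 1)) z * \<sigma>.m z + of_real (b (p - 1)) * cpoly (e p) z \<noteq> 0"
      by (rule \<sigma>.m_fraction(1)[OF assms(6) z])
    show "n z = - ((d (p - 1) z * \<sigma>.m z + of_real (b (p - 1)) * d p z) /
                (cpoly (e (p - 1)) z * \<sigma>.m z + of_real (b (p - 1)) * cpoly (e p) z))"
      unfolding assms(7) by (rule \<sigma>.m_fraction(2)[OF assms(6) z])
    show "diff_quot z (off_real \<sigma>.m) \<in> \<rho>.L_carrier" by (rule \<rho>.cauchy_L_space_identity(2)[OF m z])
    show "\<sigma>.m z = \<rho>.L_ip (diff_quot z (off_real \<sigma>.m)) (off_real \<sigma>.m)" by (rule \<rho>.cauchy_L_space_identity(3)[OF m z])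
  qed
qed

end
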